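(* Let $P_0,P_1,P_2,\ldots$ be a sequence of mutually independent random variables, where $P_i$ takes values in $\{0,1,\ldots,n_i-1\}$, and $n_i$ together with the probability distribution of $P_i$ is computable from $i$. Let $\mathcal{A}=\{A_0,A_1,\ldots\}$ be a sequence of events such that: each $A_j$ depends only on a finite set $\mathrm{vbl}(A_j)$ of the variables; given $j$ one can compute the list $\mathrm{vbl}(A_j)$ and the event itself (the list of evaluations of the variables in $\mathrm{vbl}(A_j)$ that belong to $A_j$); and every variable $P_i$ belongs to $\mathrm{vbl}(A)$ for only finitely many $A\in\mathcal{A}$, with the list of these events computable from $i$. For $A\in\mathcal{A}$ let $\Gamma(A)$ be the set of all $E\in\mathcal{A}$, $E\neq A$, with $\mathrm{vbl}(E)\cap\mathrm{vbl}(A)\neq\varnothing$. Suppose there is a rational constant $\varepsilon\in(0,1)$ and a computable assignment of rational numbers $x:\mathcal{A}\to(0,1)$ such that $$\Pr[A]\le (1-\varepsilon)\,x(A)\prod_{E\in\Gamma(A)}(1-x(E))\quad\text{for all } A\in\mathcal{A}.$$ Then there exists a computable evaluation of the variables (a computable sequence $(a_i)_{i\ge0}$ with $a_i\in\{0,\ldots,n_i-1\}$) that avoids all events $A\in\mathcal{A}$.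
   Context: An evaluation assigns a value to each variable $P_i$; it avoids an event $A$ if its restriction to $\mathrm{vbl}(A)$ is not among the evaluations belonging to $A$. *)

theory Defs
  imports "HOL-Probability.Probability" "HOL-Library.Nat_Bijection"
begin

section \<open>Computability\<close>

text \<open>
  Partial recursive functions: programs with their evaluation relation. A number-theoretic
  function is computable if some program computes it, i.e. if it is a total recursive function.
\<close>

datatype recf = Zero | Succ | Proj nat | Comp recf "recf list" | Prec recf recf | Mu recf

inductive computes :: "recf \<Rightarrow> nat list \<Rightarrow> nat \<Rightarrow> bool" where
  Zero: "computes Zero xs 0"
| Succ: "computes Succ [x] (Suc x)"
| Proj: "i < length xs \<Longrightarrow> computes (Proj i) xs (xs ! i)"
| Comp: "list_all2 (\<lambda>g y. computes g xs y) gs ys \<Longrightarrow> computes f ys z \<Longrightarrow> computes (Comp f gs) xs z"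
| Prec_0: "computes f xs y \<Longrightarrow> computes (Prec f g) (0 # xs) y"
| Prec_Suc: "computes (Prec f g) (k # xs) y \<Longrightarrow> computes g (k # y # xs) z \<Longrightarrow>
    computes (Prec f g) (Suc k # xs) z"
| Mu: "computes f (y # xs) 0 \<Longrightarrow> (\<forall>k<y. \<exists>v. computes f (k # xs) (Suc v)) \<Longrightarrow>
    computes (Mu f) xs y"

lemma computes_functional: "computes r xs y \<Longrightarrow> computes r xs z \<Longrightarrow> y = z"
proof (induction r xs y arbitrary: z rule: computes.induct)
  case (Comp xs gs ys f w)
  from Comp.prems obtain ys' where ys': "list_all2 (\<lambda>g y. computes g xs y) gs ys'"
    and z: "computes f ys' z"
    by (cases rule: computes.cases) auto
  have "ys = ys'"
    using Comp.IH(1) ys' by (auto simp: list_all2_conv_all_nth intro!: nth_equalityI)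
  with Comp.IH(2) z show ?case by simp
next
  case (Prec_Suc f g k xs y w)
  from Prec_Suc.prems show ?case
    by (cases rule: computes.cases) (use Prec_Suc.IH in auto)
next
  case (Mu f y xs)
  from Mu.prems obtain z0: "computes f (z # xs) 0"
    and z1: "\<forall>k<z. \<exists>v. computes f (k # xs) (Suc v)"
    by (cases rule: computes.cases) auto
  show ?case
  proof (rule linorder_cases[of y z])
    assume "y < z" with z1 Mu.IH(1) show ?thesis by blast
  next
    assume "z < y" with Mu.IH(2) z0 show ?thesis by blast
  qed
next
  case (Prec_0 f xs y g w)
  from Prec_0.prems show ?case
    by (cases rule: computes.cases) (use Prec_0.IH in auto)
qed (erule computes.cases; simp)+

definition computable :: "(nat \<Rightarrow> nat) \<Rightarrow> bool" where
  "computable f \<longleftrightarrow> (\<exists>r. \<forall>n. computes r [n] (f n))"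

definition computable_rat :: "(nat \<Rightarrow> rat) \<Rightarrow> bool" where
  "computable_rat q \<longleftrightarrow>
     computable (\<lambda>n. case quotient_of (q n) of (a, b) \<Rightarrow> prod_encode (int_encode a, nat b))"

text \<open>Uniformly computable sequences of real numbers, by rational approximation to any precision.\<close>

definition computable_real :: "(nat \<Rightarrow> real) \<Rightarrow> bool" where
  "computable_real r \<longleftrightarrow>
     (\<exists>q. computable_rat q \<and> (\<forall>n k. \<bar>of_rat (q (prod_encode (n, k))) - r n\<bar> \<le> 1 / 2 ^ k))"

text \<open>The finite sets \<open>S n\<close> can be listed, explicitly and completely, from \<open>n\<close>.\<close>

definition computable_finite_sets :: "(nat \<Rightarrow> nat set) \<Rightarrow> bool" where
  "computable_finite_sets S \<longleftrightarrow> (\<exists>l. computable l \<and> (\<forall>n. set (list_decode (l n)) = S n))"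

section \<open>Events\<close>

text \<open>
  An event comes with the set of variables it depends on and is the set of those evaluations of
  these variables that belong to it. Evaluations of a set \<open>V\<close> of variables are functions that are
  \<^const>\<open>undefined\<close> outside \<open>V\<close>, as in \<^const>\<open>PiE\<close> and \<^const>\<open>restrict\<close>.
\<close>

datatype event = Event (vbl: "nat set") (evals: "(nat \<Rightarrow> nat) set")

definition avoids :: "(nat \<Rightarrow> nat) \<Rightarrow> event \<Rightarrow> bool" where
  "avoids a E \<longleftrightarrow> restrict a (vbl E) \<notin> evals E"

definition event_prob :: "'a measure \<Rightarrow> (nat \<Rightarrow> 'a \<Rightarrow> nat) \<Rightarrow> event \<Rightarrow> real" where
  "event_prob M P E = measure M {\<omega> \<in> space M. \<not> avoids (\<lambda>i. P i \<omega>) E}"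

definition neighbours :: "event set \<Rightarrow> event \<Rightarrow> event set" where
  "neighbours \<A> A = {E \<in> \<A>. E \<noteq> A \<and> vbl E \<inter> vbl A \<noteq> {}}"

text \<open>
  An evaluation \<open>e\<close> of a finite set \<open>V\<close> of variables is coded by the list of its values, in
  increasing order of the variables; this is injective on the evaluations of \<open>V\<close>.
\<close>

definition eval_encode :: "nat set \<Rightarrow> (nat \<Rightarrow> nat) \<Rightarrow> nat" where
  "eval_encode V e = list_encode (map e (sorted_list_of_set V))"

definition computable_events :: "(nat \<Rightarrow> event) \<Rightarrow> bool" where
  "computable_events A \<longleftrightarrow>
     computable_finite_sets (\<lambda>j. vbl (A j)) \<and>
     computable_finite_sets (\<lambda>j. eval_encode (vbl (A j)) ` evals (A j))"

text \<open>
  The events containing a given variable are listed by indices. If an event has several indices,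
  the list needs to contain only one of them.
\<close>

definition computable_incidence :: "(nat \<Rightarrow> event) \<Rightarrow> bool" where
  "computable_incidence A \<longleftrightarrow>
     (\<exists>l. computable l \<and> (\<forall>i. A ` set (list_decode (l i)) = {E \<in> range A. i \<in> vbl E}))"

end

theory Submission imports Defs begin

text \<open>
  The argument derandomises the resampling algorithm of Moser and Tardos. The algorithm reads the
  values of the variables from a table of independent samples. A long chain of resamplings that
  leads to the resampling of an event \<open>A\<close> leaves a witness in the table: a sequence of layers of
  events that starts with \<open>A\<close>. By the hypothesis with its factor \<open>1 - \<epsilon>\<close>, the probability
  that some witness of depth \<open>d\<close> with root \<open>A\<close> is consistent with the table is at most
  \<open>(1 - \<epsilon>)^d * x A / (1 - x A)\<close>. Hence the tables with a consistent witness of depth at least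
  \<open>\<beta> A\<close>, for some \<open>A\<close> and a suitable computable \<open>\<beta>\<close>, are covered by a computable sequence of
  clopen sets \<open>U J\<close> of probability at most \<open>2^(-J-2)\<close>. A computable table outside of all of them
  is found entry by entry: a finite prefix is kept if the avoided part of its cylinder has positive
  probability, and this is certified by a rational lower bound for the part that avoids
  \<open>U 0, \<dots>, U J\<close> which exceeds \<open>2^(-J-1)\<close>.

  On such a table every chain of resamplings that ends in \<open>A\<close> is shorter than \<open>\<beta> A\<close>. So every event
  is resampled finitely often, and once all events within distance \<open>\<beta> A\<close> of \<open>A\<close> are avoided, \<open>A\<close> is
  never resampled again, because this would require a chain that enters from outside. This makes the
  limit of the algorithm computable.
\<close>

section \<open>Recursive functions of several arguments\<close>

text \<open>Probabilities are given only by approximations, so a strict inequality between them can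
  be confirmed but not decided; choices are made by searching for certificates known to exist. A
  witness has layers of events with disjoint variables, and different layers never read the same
  table entry, so its consistency is a conjunction of independent conditions. The sum over all
  witnesses is controlled by the odds \<open>y = x / (1 - x)\<close>: as
  \<open>1 + y = 1 / (1 - x)\<close>, the hypothesis reads
  \<open>Pr[A] * \<Prod> (1 + y E) \<le> (1 - \<epsilon>) * y A\<close>, where \<open>E\<close> runs
  over the neighbours of \<open>A\<close> and \<open>A\<close> itself. Expanding the product sums
  over all candidates for the next older layer, so each layer costs a factor
  \<open>1 - \<epsilon>\<close>; this explicit rate makes \<open>\<beta>\<close> computable. There
  are infinitely many roots and depths, while each \<open>U J\<close> must depend on finitely many
  entries. Stage \<open>J\<close> hence treats only roots with index up to \<open>J\<close>, each
  with a finite interval of depths that the next stage continues.\<close>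

definition recursive :: "nat \<Rightarrow> (nat list \<Rightarrow> nat) \<Rightarrow> bool" where
  "recursive k F \<longleftrightarrow> (\<exists>r. \<forall>xs. length xs = k \<longrightarrow> computes r xs (F xs))"

lemma recursive_cong:
  assumes "recursive k F" and "\<And>xs. length xs = k \<Longrightarrow> F xs = G xs"
  shows "recursive k G"
  using assms unfolding recursive_def by metis

lemma recursive_proj: "i < k \<Longrightarrow> recursive k (\<lambda>xs. xs ! i)"
  unfolding recursive_def by (intro exI[of _ "Proj i"]) (auto intro: computes.Proj)

lemma recursive_zero: "recursive k (\<lambda>_. 0)"
  unfolding recursive_def by (meson computes.Zero)

lemma recursive_comp:
  assumes F: "recursive (length gs) F" and gs: "\<And>g. g \<in> set gs \<Longrightarrow> recursive k g"
  shows "recursive k (\<lambda>xs. F (map (\<lambda>g. g xs) gs))"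
proof -
  obtain f where f: "\<And>xs. length xs = length gs \<Longrightarrow> computes f xs (F xs)"
    using F unfolding recursive_def by blast
  obtain c where c: "\<And>g xs. g \<in> set gs \<Longrightarrow> length xs = k \<Longrightarrow> computes (c g) xs (g xs)"
    using gs unfolding recursive_def by metis
  have "computes (Comp f (map c gs)) xs (F (map (\<lambda>g. g xs) gs))" if "length xs = k" for xs
    by (rule computes.Comp[where ys = "map (\<lambda>g. g xs) gs"])
       (use c f that in \<open>auto simp: list_all2_conv_all_nth\<close>)
  then show ?thesis unfolding recursive_def by blast
qed

lemma recursive_comp1:
  "recursive 1 F \<Longrightarrow> recursive k g \<Longrightarrow> recursive k (\<lambda>xs. F [g xs])"
  using recursive_comp[of "[g]" F k] by simp

lemma recursive_Suc: "recursive k g \<Longrightarrow> recursive k (\<lambda>xs. Suc (g xs))"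
proof -
  have "computes Succ xs (Suc (xs ! 0))" if "length xs = 1" for xs
    using that computes.Succ by (cases xs) auto
  then have "recursive 1 (\<lambda>xs. Suc (xs ! 0))"
    unfolding recursive_def by blast
  then show "recursive k g \<Longrightarrow> recursive k (\<lambda>xs. Suc (g xs))"
    using recursive_comp1 by fastforce
qed

lemma recursive_const: "recursive k (\<lambda>_. c)"
  by (induction c) (auto intro: recursive_zero recursive_Suc)

lemma recursive_rec_nat:
  assumes f: "recursive k f"
    and g: "recursive (k + 2) (\<lambda>ys. g (ys ! 0) (ys ! 1) (drop 2 ys))"
    and n: "recursive k n"
  shows "recursive k (\<lambda>xs. rec_nat (f xs) (\<lambda>i y. g i y xs) (n xs))"
proof -
  obtain rf where rf: "\<And>xs. length xs = k \<Longrightarrow> computes rf xs (f xs)"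
    using f unfolding recursive_def by blast
  obtain rg where rg: "\<And>ys. length ys = k + 2 \<Longrightarrow> computes rg ys (g (ys ! 0) (ys ! 1) (drop 2 ys))"
    using g unfolding recursive_def by blast
  have "computes (Prec rf rg) (m # xs) (rec_nat (f xs) (\<lambda>i y. g i y xs) m)"
    if "length xs = k" for m xs
  proof (induction m)
    case 0
    show ?case using rf[OF that] by (simp add: computes.Prec_0)
  next
    case (Suc m)
    show ?case
      using computes.Prec_Suc[OF Suc, of "g m (rec_nat (f xs) (\<lambda>i y. g i y xs) m) xs"]
        rg[of "m # rec_nat (f xs) (\<lambda>i y. g i y xs) m # xs"] that by simp
  qed
  then have 1: "recursive (Suc k) (\<lambda>ys. rec_nat (f (tl ys)) (\<lambda>i y. g i y (tl ys)) (hd ys))"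
    unfolding recursive_def by (intro exI[of _ "Prec rf rg"]) (auto simp: length_Suc_conv)
  \<comment> \<open>\<open>Prec\<close> expects the counter in front of the parameters, so
    \<open>n\<close> is put before the projections that reproduce \<open>xs\<close>.\<close>
  let ?gs = "n # map (\<lambda>i xs. xs ! i) [0..<k]"
  have "recursive k (\<lambda>xs. (\<lambda>ys. rec_nat (f (tl ys)) (\<lambda>i y. g i y (tl ys)) (hd ys))
      (map (\<lambda>g. g xs) ?gs))"
    by (rule recursive_comp) (use 1 n in \<open>auto intro: recursive_proj\<close>)
  moreover have "map (\<lambda>g. g xs) (map (\<lambda>i xs. xs ! i) [0..<k]) = xs" if "length xs = k" for xs :: "nat list"
    using that by (intro nth_equalityI) auto
  ultimately show ?thesis
    by (elim recursive_cong) simp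
qed

lemma recursive_Least:
  assumes g: "recursive (Suc k) (\<lambda>ys. g (hd ys) (tl ys))"
    and ex: "\<And>xs. length xs = k \<Longrightarrow> \<exists>y. g y xs = 0"
  shows "recursive k (\<lambda>xs. LEAST y. g y xs = 0)"
proof -
  obtain rg where rg: "\<And>ys. length ys = Suc k \<Longrightarrow> computes rg ys (g (hd ys) (tl ys))"
    using g unfolding recursive_def by blast
  have "computes (Mu rg) xs (LEAST y. g y xs = 0)" if "length xs = k" for xs
  proof (rule computes.Mu)
    let ?m = "LEAST y. g y xs = 0"
    have "g ?m xs = 0" using ex[OF that] by (rule LeastI_ex)
    then show "computes rg (?m # xs) 0" using rg[of "?m # xs"] that by simp
    show "\<forall>i<?m. \<exists>v. computes rg (i # xs) (Suc v)"
    proof (intro allI impI)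
      fix i assume "i < ?m"
      then have "g i xs \<noteq> 0" by (rule not_less_Least)
      then show "\<exists>v. computes rg (i # xs) (Suc v)"
        using rg[of "i # xs"] that by (metis length_Cons list.sel(1,3) not0_implies_Suc)
    qed
  qed
  then show ?thesis unfolding recursive_def by blast
qed

lemma recursive_add:
  assumes "recursive k f" "recursive k g"
  shows "recursive k (\<lambda>xs. f xs + g xs)"
proof -
  have "rec_nat a (\<lambda>_. Suc) n = a + n" for a n :: nat
    by (induction n) auto
  moreover have "recursive k (\<lambda>xs. rec_nat (f xs) (\<lambda>i y. Suc y) (g xs))"
    by (intro recursive_rec_nat assms recursive_Suc recursive_proj) simp
  ultimately show ?thesis by simp
qed

lemma recursive_diff:
  assumes "recursive k f" "recursive k g"
  shows "recursive k (\<lambda>xs. f xs - g xs)"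
proof -
  have pred: "recursive m (\<lambda>xs. h xs - 1)" if "recursive m h" for m h
  proof -
    have "rec_nat 0 (\<lambda>i _. i) n = n - 1" for n :: nat
      by (cases n) auto
    moreover have "recursive m (\<lambda>xs. rec_nat 0 (\<lambda>i y. i) (h xs))"
      by (intro recursive_rec_nat that recursive_const recursive_proj) simp
    ultimately show ?thesis by simp
  qed
  have "rec_nat a (\<lambda>_ y. y - 1) n = a - n" for a n :: nat
    by (induction n) auto
  moreover have "recursive k (\<lambda>xs. rec_nat (f xs) (\<lambda>i y. y - 1) (g xs))"
    by (intro recursive_rec_nat assms pred recursive_proj) simp
  ultimately show ?thesis by simp
qed

lemma recursive_triangle:
  assumes "recursive k f" shows "recursive k (\<lambda>xs. triangle (f xs))"
proof -
  have "rec_nat 0 (\<lambda>i y. y + Suc i) n = triangle n" for n :: nat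
    by (induction n) auto
  moreover have "recursive k (\<lambda>xs. rec_nat 0 (\<lambda>i y. y + Suc i) (f xs))"
    by (intro recursive_rec_nat assms recursive_const recursive_add recursive_Suc recursive_proj)
       simp_all
  ultimately show ?thesis by simp
qed

lemma recursive_prod_encode:
  "recursive k f \<Longrightarrow> recursive k g \<Longrightarrow> recursive k (\<lambda>xs. prod_encode (f xs, g xs))"
  unfolding prod_encode_def by (simp add: recursive_add recursive_triangle)

text \<open>\<open>prod_encode (a, b)\<close> is \<open>triangle (a + b) + a\<close>, so
  \<open>a + b\<close> is the first diagonal whose successor starts beyond the code. Both components
  follow from it by subtraction.\<close>

lemma Least_triangle: "(LEAST s. Suc (prod_encode (a, b)) - triangle (Suc s) = 0) = a + b"
proof (rule Least_equality)
  show "Suc (prod_encode (a, b)) - triangle (Suc (a + b)) = 0"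
    by (simp add: prod_encode_def)
  fix s assume *: "Suc (prod_encode (a, b)) - triangle (Suc s) = 0"
  have mono: "triangle m \<le> triangle n" if "m \<le> n" for m n
    using that by (induction rule: dec_induct) auto
  show "a + b \<le> s"
  proof (rule ccontr)
    assume "\<not> ?thesis"
    then have "triangle (Suc s) \<le> triangle (a + b)" by (intro mono) simp
    with * show False by (simp add: prod_encode_def)
  qed
qed

lemma recursive_prod_decode:
  assumes f: "recursive k f"
  shows recursive_fst_decode: "recursive k (\<lambda>xs. fst (prod_decode (f xs)))"
    and recursive_snd_decode: "recursive k (\<lambda>xs. snd (prod_decode (f xs)))"
proof -
  let ?s = "\<lambda>n. LEAST s. Suc n - triangle (Suc s) = 0"
  have ex: "\<exists>s. Suc n - triangle (Suc s) = 0" for n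
  proof -
    have "n \<le> triangle n" by (induction n) auto
    then show ?thesis by (intro exI[of _ n]) simp
  qed
  have hd: "recursive (Suc m) hd" for m
    by (rule recursive_cong[OF recursive_proj[of 0]]) (auto simp: length_Suc_conv)
  have tl: "recursive 2 (\<lambda>ys. hd (tl ys))"
    by (rule recursive_cong[OF recursive_proj[of 1]]) (auto simp: length_Suc_conv numeral_2_eq_2)
  have "recursive (Suc 1) (\<lambda>ys. (\<lambda>s xs. Suc (hd xs) - triangle (Suc s)) (hd ys) (tl ys))"
    by (intro recursive_diff recursive_Suc recursive_triangle hd tl[unfolded numeral_2_eq_2, folded One_nat_def])
  then have "recursive 1 (\<lambda>xs. ?s (hd xs))"
    by (rule recursive_Least) (rule ex)
  from recursive_comp1[OF this f] have s: "recursive k (\<lambda>xs. ?s (f xs))" by simp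
  have ab: "?s n = fst (prod_decode n) + snd (prod_decode n)"
    "n = triangle (fst (prod_decode n) + snd (prod_decode n)) + fst (prod_decode n)" for n
    using Least_triangle[of "fst (prod_decode n)" "snd (prod_decode n)"]
      prod_decode_inverse[of n] by (simp_all add: prod_encode_def case_prod_beta)
  have fst: "n - triangle (?s n) = fst (prod_decode n)" for n
    using ab(2)[of n] unfolding ab(1) by linarith
  then show 1: "recursive k (\<lambda>xs. fst (prod_decode (f xs)))"
    using recursive_diff[OF f recursive_triangle[OF s]] by simp
  have "?s n - fst (prod_decode n) = snd (prod_decode n)" for n
    unfolding ab(1) by simp
  then show "recursive k (\<lambda>xs. snd (prod_decode (f xs)))"
    using recursive_diff[OF s 1] by simp
qed

lemma computable_iff_recursive: "computable f \<longleftrightarrow> recursive 1 (\<lambda>xs. f (xs ! 0))"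
proof -
  have "(\<forall>xs. length xs = 1 \<longrightarrow> computes r xs (f (xs ! 0))) \<longleftrightarrow> (\<forall>n. computes r [n] (f n))" for r
    by (auto simp: length_Suc_conv)
  then show ?thesis unfolding computable_def recursive_def by simp
qed

lemma recursive_computable:
  "computable f \<Longrightarrow> recursive k g \<Longrightarrow> recursive k (\<lambda>xs. f (g xs))"
  unfolding computable_iff_recursive using recursive_comp1 by fastforce

lemma computableI: "recursive 1 (\<lambda>xs. f (xs ! 0)) \<Longrightarrow> computable f"
  by (simp add: computable_iff_recursive)

section \<open>Effective functions between encodable types\<close>

class encodable =
  fixes code :: "'a \<Rightarrow> nat"
  assumes bij_code: "bij code"
begin

definition decode :: "nat \<Rightarrow> 'a" where "decode = inv code"

lemma decode_code [simp]: "decode (code x) = x"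
  by (simp add: decode_def bij_code bij_is_inj)

lemma code_decode [simp]: "code (decode n) = n"
  by (simp add: decode_def bij_code bij_is_surj surj_f_inv_f)

lemma code_eq_iff [simp]: "code x = code y \<longleftrightarrow> x = y"
  by (metis decode_code)

end

instantiation nat :: encodable
begin
definition code_nat :: "nat \<Rightarrow> nat" where [simp]: "code_nat n = n"
instance by standard (simp add: code_nat_def[abs_def] bij_def)
end

instantiation prod :: (encodable, encodable) encodable
begin
definition code_prod :: "'a \<times> 'b \<Rightarrow> nat" where
  "code_prod p = prod_encode (code (fst p), code (snd p))"
instance
proof
  show "bij (code :: 'a \<times> 'b \<Rightarrow> nat)"
  proof (rule o_bij[where g = "\<lambda>n. (decode (fst (prod_decode n)), decode (snd (prod_decode n)))"])
  qed (auto simp: fun_eq_iff code_prod_def)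
qed
end

instantiation list :: (encodable) encodable
begin
definition code_list :: "'a list \<Rightarrow> nat" where
  "code_list xs = list_encode (map code xs)"
instance
proof
  show "bij (code :: 'a list \<Rightarrow> nat)"
  proof (rule o_bij[where g = "\<lambda>n. map decode (list_decode n)"])
  qed (auto simp: fun_eq_iff code_list_def comp_def)
qed
end

lemma code_Pair: "code (x, y) = prod_encode (code x, code y)"
  by (simp add: code_prod_def)

lemma decode_prod_encode: "decode (prod_encode (m, n)) = (decode m, decode n)"
  by (metis code_Pair code_decode decode_code)

lemma decode_nat [simp]: "decode n = (n :: nat)"
  by (metis code_nat_def decode_code)

lemma code_Nil [simp]: "code [] = 0"
  by (simp add: code_list_def)

lemma code_Cons: "code (x # xs) = Suc (code (x, xs))"
  by (simp add: code_list_def code_prod_def)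

lemma code_nat_list: "code (xs :: nat list) = list_encode xs"
  by (simp add: code_list_def code_nat_def[abs_def])

lemma decode_nat_list: "decode n = list_decode n"
  by (metis code_nat_list decode_code list_decode_inverse)

definition effective :: "('a::encodable \<Rightarrow> 'b::encodable) \<Rightarrow> bool" where
  "effective f \<longleftrightarrow> computable (\<lambda>n. code (f (decode n)))"

text \<open>
  Codes are bijective so that unbounded search is total on all of \<^typ>\<open>nat\<close>; as \<^typ>\<open>bool\<close> has no
  such code, predicates are treated separately.
\<close>

definition decidable :: "('a::encodable \<Rightarrow> bool) \<Rightarrow> bool" where
  "decidable P \<longleftrightarrow> effective (\<lambda>x. of_bool (P x) :: nat)"

named_theorems eff

lemma effective_nat_iff: "effective f \<longleftrightarrow> computable f" for f :: "nat \<Rightarrow> nat"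
  unfolding effective_def by simp

lemma effectiveI:
  assumes "computable g" and "\<And>x. g (code x) = code (f x)"
  shows "effective f"
proof -
  have "g n = code (f (decode n))" for n
    by (metis assms(2) code_decode)
  then have "(\<lambda>n. code (f (decode n))) = g" by auto
  with assms(1) show ?thesis unfolding effective_def by simp
qed

lemma effective_compose: "effective f \<Longrightarrow> effective g \<Longrightarrow> effective (\<lambda>x. f (g x))"
proof -
  assume "effective f" "effective g"
  then have "recursive 1 (\<lambda>xs. code (f (decode (code (g (decode (xs ! 0)))))))"
    unfolding effective_def by (intro recursive_computable[of "\<lambda>n. code (f (decode n))"])
      (simp_all add: computable_iff_recursive)
  then show ?thesis by (simp add: effective_def computableI)
qed

lemma effective_id [eff]: "effective (\<lambda>x. x)"
  by (rule effectiveI[where g = "\<lambda>n. n"]) (auto intro: computableI recursive_proj)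

lemma effective_const [eff]: "effective (\<lambda>_. c)"
  by (rule effectiveI[where g = "\<lambda>n. code c"]) (auto intro: computableI recursive_const)

lemma effective_Pair [eff]:
  assumes "effective f" "effective g" shows "effective (\<lambda>x. (f x, g x))"
  using assms unfolding effective_def
  by (auto simp: code_prod_def intro!: computableI recursive_prod_encode intro: recursive_computable recursive_proj
      simp: computable_iff_recursive)

lemma effective_fst [eff]: "effective f \<Longrightarrow> effective (\<lambda>x. fst (f x))"
proof (rule effective_compose[of fst])
  show "effective (fst :: 'b \<times> 'c \<Rightarrow> 'b)"
    by (rule effectiveI[where g = "\<lambda>n. fst (prod_decode n)"])
       (auto intro!: computableI recursive_fst_decode recursive_proj simp: code_prod_def)
qed

lemma effective_snd [eff]: "effective f \<Longrightarrow> effective (\<lambda>x. snd (f x))"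
proof (rule effective_compose[of snd])
  show "effective (snd :: 'b \<times> 'c \<Rightarrow> 'c)"
    by (rule effectiveI[where g = "\<lambda>n. snd (prod_decode n)"])
       (auto intro!: computableI recursive_snd_decode recursive_proj simp: code_prod_def)
qed

lemma effective_compose2:
  assumes "effective (\<lambda>z. F (fst z) (snd z))" "effective g" "effective h"
  shows "effective (\<lambda>x. F (g x) (h x))"
  using effective_compose[OF assms(1) effective_Pair[OF assms(2,3)]] by simp

lemma effective_compose3:
  assumes "effective (\<lambda>z. F (fst z) (fst (snd z)) (snd (snd z)))"
    "effective g" "effective h" "effective i"
  shows "effective (\<lambda>x. F (g x) (h x) (i x))"
  using effective_compose[OF assms(1) effective_Pair[OF assms(2) effective_Pair[OF assms(3,4)]]] by simp

lemma decidable_compose: "decidable P \<Longrightarrow> effective f \<Longrightarrow> decidable (\<lambda>x. P (f x))"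
  unfolding decidable_def by (rule effective_compose)

lemma decidable_compose2:
  assumes "decidable (\<lambda>z. P (fst z) (snd z))" "effective g" "effective h"
  shows "decidable (\<lambda>x. P (g x) (h x))"
  using assms effective_compose2[where F = "\<lambda>x y. of_bool (P x y)"] unfolding decidable_def by fast

lemma effective_rec_nat [eff]:
  assumes f: "effective f" and n: "effective n"
    and g: "effective (\<lambda>z. g (fst z) (fst (snd z)) (snd (snd z)))"
  shows "effective (\<lambda>x. rec_nat (f x) (g x) (n x))"
proof (rule effectiveI)
  \<comment> \<open>The recursion runs on codes: each step packs the code \<open>c\<close> of the
    parameter, the counter and the code of the current value into one number.\<close>
  let ?g = "\<lambda>c i y. code ((\<lambda>z. g (fst z) (fst (snd z)) (snd (snd z)))
      (decode (prod_encode (c, prod_encode (i, y)))))"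
  show "computable (\<lambda>c. rec_nat (code (f (decode c))) (?g c) (code (n (decode c))))"
  proof (intro computableI recursive_rec_nat)
    show "recursive 1 (\<lambda>xs. code (f (decode (xs ! 0))))" "recursive 1 (\<lambda>xs. code (n (decode (xs ! 0))))"
      using f n unfolding effective_def computable_iff_recursive .
    show "recursive (1 + 2) (\<lambda>ys. ?g (drop 2 ys ! 0) (ys ! 0) (ys ! 1))"
      by (rule recursive_computable[OF g[unfolded effective_def]],
          rule recursive_cong[where F = "\<lambda>ys. prod_encode (ys ! 2, prod_encode (ys ! 0, ys ! 1))"])
         (auto intro!: recursive_prod_encode recursive_proj)
  qed
  fix x
  have "rec_nat (code (f x)) (?g (code x)) m = code (rec_nat (f x) (g x) m)" for m
  proof (induction m)
    case (Suc m)
    then show ?case by (simp add: decode_prod_encode)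
  qed simp
  then show "rec_nat (code (f (decode (code x)))) (?g (code x)) (code (n (decode (code x)))) =
      code (rec_nat (f x) (g x) (n x))"
    by simp
qed

lemma effective_Suc [eff]: "effective f \<Longrightarrow> effective (\<lambda>x. Suc (f x))"
  by (rule effective_compose[of Suc])
     (auto simp: effective_nat_iff intro!: computableI recursive_Suc recursive_proj)

lemma effective_add [eff]:
  assumes "effective f" "effective g" shows "effective (\<lambda>x. f x + g x :: nat)"
proof -
  have "rec_nat a (\<lambda>_. Suc) n = a + n" for a n :: nat by (induction n) auto
  moreover have "effective (\<lambda>x. rec_nat (f x) (\<lambda>_ y. Suc y) (g x))" by (intro eff assms)
  ultimately show ?thesis by simp
qed

lemma effective_pred: assumes "effective f" shows "effective (\<lambda>x. f x - Suc 0)"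
proof -
  have "rec_nat 0 (\<lambda>i _. i) n = n - Suc 0" for n :: nat by (cases n) auto
  moreover have "effective (\<lambda>x. rec_nat 0 (\<lambda>i y. i) (f x))" by (intro eff assms)
  ultimately show ?thesis by simp
qed

lemma effective_diff [eff]:
  assumes "effective f" "effective g" shows "effective (\<lambda>x. f x - g x :: nat)"
proof -
  have "rec_nat a (\<lambda>_ y. y - Suc 0) n = a - n" for a n :: nat by (induction n) auto
  moreover have "effective (\<lambda>x. rec_nat (f x) (\<lambda>_ y. y - Suc 0) (g x))"
    by (intro eff assms effective_pred)
  ultimately show ?thesis by simp
qed

lemma effective_mult [eff]:
  assumes "effective f" "effective g" shows "effective (\<lambda>x. f x * g x :: nat)"
proof -
  have "rec_nat 0 (\<lambda>_ y. y + a) n = a * n" for a n :: nat by (induction n) auto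
  moreover have "effective (\<lambda>x. rec_nat 0 (\<lambda>_ y. y + f x) (g x))"
    by (intro eff effective_compose[OF assms(1)] assms(2))
  ultimately show ?thesis by simp
qed

lemma effective_power [eff]:
  assumes "effective f" "effective g" shows "effective (\<lambda>x. f x ^ g x :: nat)"
proof -
  have "rec_nat 1 (\<lambda>_ y. y * a) n = a ^ n" for a n :: nat by (induction n) auto
  moreover have "effective (\<lambda>x. rec_nat 1 (\<lambda>_ y. y * f x) (g x))"
    by (intro eff effective_compose[OF assms(1)] assms(2))
  ultimately show ?thesis by simp
qed

lemma effective_code [eff]: "effective f \<Longrightarrow> effective (\<lambda>x. code (f x))"
  unfolding effective_def by simp

lemma effective_decode [eff]: "effective f \<Longrightarrow> effective (\<lambda>x. decode (f x))"
  unfolding effective_def by simp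

lemma effective_of_bool [eff]: "decidable P \<Longrightarrow> effective (\<lambda>x. of_bool (P x) :: nat)"
  by (simp add: decidable_def)

lemma effective_If [eff]:
  assumes "decidable P" "effective f" "effective g"
  shows "effective (\<lambda>x. if P x then f x else g x)"
proof -
  have "effective (\<lambda>x. rec_nat (g x) (\<lambda>_ _. f x) (of_bool (P x)))"
    by (intro eff assms(1,3) effective_compose[OF assms(2)])
  moreover have "rec_nat (g x) (\<lambda>_ _. f x) (of_bool (P x)) = (if P x then f x else g x)" for x
    by simp
  ultimately show ?thesis by simp
qed

lemma decidable_le [eff]:
  assumes "effective f" "effective g" shows "decidable (\<lambda>x. f x \<le> (g x :: nat))"
proof -
  have "(of_bool (a \<le> b) :: nat) = 1 - (a - b)" for a b :: nat by auto
  moreover have "effective (\<lambda>x. 1 - (f x - g x))" by (intro eff assms)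
  ultimately show ?thesis by (simp add: decidable_def)
qed

lemma decidable_not [eff]: assumes "decidable P" shows "decidable (\<lambda>x. \<not> P x)"
proof -
  have "(of_bool (\<not> b) :: nat) = 1 - of_bool b" for b by auto
  moreover have "effective (\<lambda>x. 1 - of_bool (P x) :: nat)" by (intro eff assms)
  ultimately show ?thesis by (simp only: decidable_def)
qed

lemma decidable_conj [eff]:
  assumes "decidable P" "decidable Q" shows "decidable (\<lambda>x. P x \<and> Q x)"
proof -
  have "(of_bool (a \<and> b) :: nat) = of_bool a * of_bool b" for a b by auto
  moreover have "effective (\<lambda>x. of_bool (P x) * of_bool (Q x) :: nat)" by (intro eff assms)
  ultimately show ?thesis by (simp only: decidable_def)
qed

lemma decidable_disj [eff]:
  assumes "decidable P" "decidable Q" shows "decidable (\<lambda>x. P x \<or> Q x)"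
proof -
  have "decidable (\<lambda>x. \<not> (\<not> P x \<and> \<not> Q x))" by (intro eff assms)
  then show ?thesis by simp
qed

lemma decidable_imp [eff]:
  assumes "decidable P" "decidable Q" shows "decidable (\<lambda>x. P x \<longrightarrow> Q x)"
proof -
  have "decidable (\<lambda>x. \<not> P x \<or> Q x)" by (intro eff assms)
  then show ?thesis by (simp only: imp_conv_disj)
qed

lemma decidable_less [eff]:
  assumes "effective f" "effective g" shows "decidable (\<lambda>x. f x < (g x :: nat))"
proof -
  have "decidable (\<lambda>x. \<not> g x \<le> f x)" by (intro eff assms)
  then show ?thesis by (simp add: not_le)
qed

lemma decidable_eq [eff]:
  fixes f g :: "'a::encodable \<Rightarrow> 'b::encodable"
  assumes "effective f" "effective g" shows "decidable (\<lambda>x. f x = g x)"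
proof -
  have "decidable (\<lambda>x. code (f x) \<le> code (g x) \<and> code (g x) \<le> code (f x))" by (intro eff assms)
  then show ?thesis by (simp add: order_eq_iff[symmetric])
qed

lemma effective_Least [eff]:
  assumes P: "decidable (\<lambda>z. P (fst z) (snd z))" and ex: "\<And>x. \<exists>y. P x y"
  shows "effective (\<lambda>x. LEAST y :: nat. P x y)"
proof (rule effectiveI)
  let ?g = "\<lambda>y xs. code ((\<lambda>z. of_bool (\<not> P (fst z) (snd z)) :: nat) (decode (prod_encode (hd xs, y))))"
  have hd: "recursive (Suc m) hd" for m
    by (rule recursive_cong[OF recursive_proj[of 0]]) (auto simp: length_Suc_conv)
  have tl: "recursive (Suc 1) (\<lambda>ys. hd (tl ys))"
    by (rule recursive_cong[OF recursive_proj[of 1]]) (auto simp: length_Suc_conv numeral_2_eq_2)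
  note d = decode_prod_encode
  have "recursive 1 (\<lambda>xs. LEAST y. ?g y xs = 0)"
  proof (rule recursive_Least)
    have "effective (\<lambda>z. of_bool (\<not> P (fst z) (snd z)) :: nat)" by (intro eff P)
    then show "recursive (Suc 1) (\<lambda>ys. ?g (hd ys) (tl ys))"
      unfolding effective_def
      by (rule recursive_computable) (intro recursive_prod_encode hd tl)
    show "\<exists>y. ?g y xs = 0" for xs
      using ex by (simp add: d)
  qed
  then show "computable (\<lambda>c. LEAST y. P (decode c) y)"
    by (intro computableI) (elim recursive_cong, auto simp: d length_Suc_conv)
qed simp

lemma effective_Cons [eff]:
  assumes "effective f" "effective g" shows "effective (\<lambda>x. f x # g x)"
proof -
  have "effective (\<lambda>x. decode (Suc (code (f x, g x))) :: 'b list)" by (intro eff assms)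
  then show ?thesis by (simp flip: code_Cons)
qed

lemma effective_case_list [eff]:
  fixes xs :: "'a::encodable \<Rightarrow> 'b::encodable list"
  assumes "effective xs" "effective f" "effective (\<lambda>z. g (fst z) (fst (snd z)) (snd (snd z)))"
  shows "effective (\<lambda>x. case xs x of [] \<Rightarrow> f x | y # ys \<Rightarrow> g x y ys)"
proof -
  have "effective (\<lambda>x. if code (xs x) = 0 then f x
      else g x (fst (decode (code (xs x) - Suc 0) :: 'b \<times> 'b list)) (snd (decode (code (xs x) - Suc 0) :: 'b \<times> 'b list)))"
    by (intro eff assms effective_compose3[OF assms(3)])
  moreover have "(if code (xs x) = 0 then f x
      else g x (fst (decode (code (xs x) - Suc 0) :: 'b \<times> 'b list)) (snd (decode (code (xs x) - Suc 0) :: 'b \<times> 'b list))) =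
      (case xs x of [] \<Rightarrow> f x | y # ys \<Rightarrow> g x y ys)" for x
    by (cases "xs x") (auto simp: code_Cons)
  ultimately show ?thesis by simp
qed

lemma effective_tl [eff]: assumes "effective f" shows "effective (\<lambda>x. tl (f x))"
  unfolding tl_def by (intro eff assms)

text \<open>Loops over lists are built before \<open>length\<close> is known to be effective; the
  code itself is an effective bound on the number of iterations.\<close>

lemma length_le_code: "length xs \<le> code xs"
proof (induction xs)
  case (Cons x xs)
  then show ?case
    using le_prod_encode_2[of "code xs" "code x"] by (simp add: code_Cons code_Pair)
qed simp

lemma effective_foldl:
  fixes a :: "'a::encodable \<Rightarrow> 'b::encodable" and xs :: "'a \<Rightarrow> 'c::encodable list"
  assumes "effective a" "effective xs" "effective (\<lambda>z. g (fst z) (fst (snd z)) (snd (snd z)))"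
  shows "effective (\<lambda>x. foldl (g x) (a x) (xs x))"
proof -
  \<comment> \<open>The state holds the accumulator and the rest of the list. An empty rest leaves
    the state fixed, so surplus iterations do no harm.\<close>
  define step where "step x st =
    (case snd st of [] \<Rightarrow> st | y # ys \<Rightarrow> (g x (fst st) y, ys))" for x and st :: "'b \<times> 'c list"
  have "effective (\<lambda>x. fst (rec_nat (a x, xs x) (\<lambda>i st. step x st) (code (xs x))))"
    unfolding step_def by (intro eff assms effective_compose3[OF assms(3)])
  moreover have "fst (rec_nat (b, ys) (\<lambda>i st. step x st) n) = foldl (g x) b ys"
    if "length ys \<le> n" for x b ys n
    using that
  proof (induction n arbitrary: b ys)
    case (Suc n)
    have shift: "rec_nat st (\<lambda>i st. step x st) (Suc n) = rec_nat (step x st) (\<lambda>i st. step x st) n" for st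
      by (induction n) auto
    have "step x (c, []) = (c, [])" "step x (c, z # zs) = (g x c z, zs)" for c z zs
      by (simp_all add: step_def)
    with Suc show ?case
      by (cases ys) (simp_all only: shift list.size foldl.simps le0)
  qed simp
  ultimately show ?thesis by (simp add: length_le_code)
qed

lemma effective_rev [eff]: assumes "effective f" shows "effective (\<lambda>x. rev (f x))"
proof -
  have "foldl (\<lambda>acc y. y # acc) ys xs = rev xs @ ys" for xs ys :: "'b list"
    by (induction xs arbitrary: ys) auto
  moreover have "effective (\<lambda>x. foldl (\<lambda>acc y. y # acc) [] (f x))"
    by (intro eff assms effective_foldl)
  ultimately show ?thesis by simp
qed

lemma effective_rec_list [eff]:
  assumes "effective f" "effective xs"
    "effective (\<lambda>z. g (fst z) (fst (snd z)) (fst (snd (snd z))) (snd (snd (snd z))))"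
  shows "effective (\<lambda>x. rec_list (f x) (g x) (xs x))"
proof -
  have g: "effective (\<lambda>z. g (a z) (b z) (c z) (d z))"
    if "effective a" "effective b" "effective c" "effective d" for a b c d
    using effective_compose[OF assms(3) effective_Pair[OF that(1) effective_Pair[OF that(2)
      effective_Pair[OF that(3,4)]]]] by simp
  \<comment> \<open>The step of \<open>rec_list\<close> also sees the tail; the fold over the
    reversed list rebuilds this tail in its first component.\<close>
  have "effective (\<lambda>x. snd (foldl (\<lambda>st y. (y # fst st, g x y (fst st) (snd st))) ([], f x) (rev (xs x))))"
    by (intro effective_foldl eff assms g)
  moreover have "foldl (\<lambda>st y. (y # fst st, g x y (fst st) (snd st))) ([], f x) (rev ys)
     = (ys, rec_list (f x) (g x) ys)" for x ys
    by (induction ys) auto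
  ultimately show ?thesis by simp
qed

lemma effective_append [eff]:
  assumes "effective f" "effective g" shows "effective (\<lambda>x. f x @ g x)"
proof -
  have "rec_list ys (\<lambda>y _ acc. y # acc) xs = xs @ ys" for xs ys :: "'b list"
    by (induction xs) auto
  moreover have "effective (\<lambda>x. rec_list (g x) (\<lambda>y _ acc. y # acc) (f x))" by (intro eff assms)
  ultimately show ?thesis by simp
qed

lemma effective_map [eff]:
  assumes "effective xs" "effective (\<lambda>z. g (fst z) (snd z))"
  shows "effective (\<lambda>x. map (g x) (xs x))"
proof -
  have "rec_list [] (\<lambda>y _ acc. g x y # acc) ys = map (g x) ys" for x ys
    by (induction ys) auto
  moreover have "effective (\<lambda>x. rec_list [] (\<lambda>y _ acc. g x y # acc) (xs x))"
    by (intro eff assms(1) effective_compose2[OF assms(2)])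
  ultimately show ?thesis by simp
qed

lemma effective_concat [eff]: assumes "effective f" shows "effective (\<lambda>x. concat (f x))"
proof -
  have "rec_list [] (\<lambda>y _ acc. y @ acc) xs = concat xs" for xs :: "'b list list"
    by (induction xs) auto
  moreover have "effective (\<lambda>x. rec_list [] (\<lambda>y _ acc. y @ acc) (f x))" by (intro eff assms)
  ultimately show ?thesis by simp
qed

lemma effective_filter [eff]:
  assumes "effective xs" "decidable (\<lambda>z. P (fst z) (snd z))"
  shows "effective (\<lambda>x. filter (P x) (xs x))"
proof -
  have "rec_list [] (\<lambda>y _ acc. if P x y then y # acc else acc) ys = filter (P x) ys" for x ys
    by (induction ys) auto
  moreover have "effective (\<lambda>x. rec_list [] (\<lambda>y _ acc. if P x y then y # acc else acc) (xs x))"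
    by (intro eff assms(1) decidable_compose2[OF assms(2)])
  ultimately show ?thesis by simp
qed

lemma effective_length [eff]: assumes "effective f" shows "effective (\<lambda>x. length (f x))"
proof -
  have "rec_list 0 (\<lambda>_ _ acc. Suc acc) xs = length xs" for xs :: "'b list"
    by (induction xs) auto
  moreover have "effective (\<lambda>x. rec_list 0 (\<lambda>_ _ acc. Suc acc) (f x))" by (intro eff assms)
  ultimately show ?thesis by simp
qed

lemma effective_sum_list [eff]:
  assumes "effective f" shows "effective (\<lambda>x. sum_list (f x) :: nat)"
proof -
  have "rec_list 0 (\<lambda>y _ acc. y + acc) xs = sum_list xs" for xs :: "nat list"
    by (induction xs) auto
  moreover have "effective (\<lambda>x. rec_list 0 (\<lambda>y _ acc. y + acc) (f x))" by (intro eff assms)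
  ultimately show ?thesis by simp
qed

lemma effective_prod_list [eff]:
  assumes "effective f" shows "effective (\<lambda>x. prod_list (f x) :: nat)"
proof -
  have "rec_list 1 (\<lambda>y _ acc. y * acc) xs = prod_list xs" for xs :: "nat list"
    by (induction xs) auto
  moreover have "effective (\<lambda>x. rec_list 1 (\<lambda>y _ acc. y * acc) (f x))" by (intro eff assms)
  ultimately show ?thesis by simp
qed

lemma decidable_Ball_set [eff]:
  assumes "effective xs" "decidable (\<lambda>z. P (fst z) (snd z))"
  shows "decidable (\<lambda>x. \<forall>y\<in>set (xs x). P x y)"
proof -
  have "rec_list (1 :: nat) (\<lambda>y _ acc. if P x y then acc else 0) ys = of_bool (\<forall>y\<in>set ys. P x y)" for x ys
    by (induction ys) auto
  moreover have "effective (\<lambda>x. rec_list (1 :: nat) (\<lambda>y _ acc. if P x y then acc else 0) (xs x))"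
    by (intro eff assms(1) decidable_compose2[OF assms(2)])
  ultimately show ?thesis by (simp add: decidable_def)
qed

lemma decidable_Bex_set [eff]:
  assumes "effective xs" "decidable (\<lambda>z. P (fst z) (snd z))"
  shows "decidable (\<lambda>x. \<exists>y\<in>set (xs x). P x y)"
proof -
  have "decidable (\<lambda>x. \<not> (\<forall>y\<in>set (xs x). \<not> P x y))" by (intro eff assms)
  then show ?thesis by simp
qed

lemma decidable_member [eff]:
  assumes "effective f" "effective xs" shows "decidable (\<lambda>x. f x \<in> set (xs x))"
proof -
  have "decidable (\<lambda>x. \<exists>y\<in>set (xs x). f x = y)"
    by (intro eff assms effective_compose[OF assms(1)])
  then show ?thesis by simp
qed

lemma effective_upt [eff]:
  assumes "effective f" "effective g" shows "effective (\<lambda>x. [f x..<g x])"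
proof -
  have up: "rec_nat [] (\<lambda>i acc. acc @ [i]) n = [0..<n]" for n :: nat
    by (induction n) auto
  have "filter (\<lambda>i. m \<le> i) [0..<n] = [m..<n]" for m n :: nat
    by (induction n) auto
  moreover have "effective (\<lambda>x. filter (\<lambda>i. f x \<le> i) (rec_nat [] (\<lambda>i acc. acc @ [i]) (g x)))"
    by (intro eff assms effective_compose[OF assms(1)])
  ultimately show ?thesis by (simp add: up)
qed

lemma decidable_All_less [eff]:
  fixes n :: "'a::encodable \<Rightarrow> nat"
  assumes "effective n" "decidable (\<lambda>z. P (fst z) (snd z))"
  shows "decidable (\<lambda>x. \<forall>i<n x. P x i)"
proof -
  have "decidable (\<lambda>x. \<forall>i\<in>set [0..<n x]. P x i)" by (intro eff assms)
  then show ?thesis by (simp add: Ball_def)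
qed

lemma decidable_Ex_less [eff]:
  fixes n :: "'a::encodable \<Rightarrow> nat"
  assumes "effective n" "decidable (\<lambda>z. P (fst z) (snd z))"
  shows "decidable (\<lambda>x. \<exists>i<n x. P x i)"
proof -
  have "decidable (\<lambda>x. \<not> (\<forall>i<n x. \<not> P x i))" by (intro eff assms)
  then show ?thesis by simp
qed

lemma effective_div [eff]:
  assumes "effective f" "effective g" shows "effective (\<lambda>x. f x div g x :: nat)"
proof -
  \<comment> \<open>The disjunct \<open>b = 0\<close> keeps the search total and yields
    \<open>0\<close>, the value of a division by \<open>0\<close>.\<close>
  have "(LEAST q. b = 0 \<or> a < Suc q * b) = a div b" for a b :: nat
  proof (cases "b = 0")
    case False
    show ?thesis
    proof (rule Least_equality)
      show "b = 0 \<or> a < Suc (a div b) * b"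
        using False by (simp add: dividend_less_div_times)
      fix q assume "b = 0 \<or> a < Suc q * b"
      then show "a div b \<le> q" using False by (simp add: less_mult_imp_div_less less_Suc_eq_le[symmetric])
    qed
  qed simp
  moreover have "effective (\<lambda>x. LEAST q. g x = 0 \<or> f x < Suc q * g x)"
  proof (intro eff assms effective_compose[OF assms(1)] effective_compose[OF assms(2)])
    show "\<exists>q. g x = 0 \<or> f x < Suc q * g x" for x
      by (intro exI[of _ "f x"], cases "g x") auto
  qed
  ultimately show ?thesis by simp
qed

lemma effective_drop [eff]:
  assumes "effective f" "effective n" shows "effective (\<lambda>x. drop (n x) (f x))"
proof -
  have "rec_nat xs (\<lambda>_. tl) n = drop n xs" for n and xs :: "'b list"
    by (induction n) (auto simp: drop_Suc tl_drop)
  moreover have "effective (\<lambda>x. rec_nat (f x) (\<lambda>_ ys. tl ys) (n x))" by (intro eff assms)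
  ultimately show ?thesis by simp
qed

lemma effective_take [eff]:
  assumes "effective f" "effective n" shows "effective (\<lambda>x. take (n x) (f x))"
proof -
  have "take n xs = rev (drop (length xs - n) (rev xs))" for n and xs :: "'b list"
    by (cases "n \<le> length xs") (simp_all add: rev_drop)
  moreover have "effective (\<lambda>x. rev (drop (length (f x) - n x) (rev (f x))))" by (intro eff assms)
  ultimately show ?thesis by simp
qed

text \<open>Padding with zeros turns a finite list into a sequence, so that predicates on infinite
  tables can be evaluated effectively on lists.\<close>

definition entry :: "nat list \<Rightarrow> nat \<Rightarrow> nat" where
  "entry xs i = (if i < length xs then xs ! i else 0)"

lemma effective_entry [eff]:
  assumes "effective f" "effective n" shows "effective (\<lambda>x. entry (f x) (n x))"
proof -
  have "entry xs i = (case drop i xs of [] \<Rightarrow> 0 | y # _ \<Rightarrow> y)" for xs i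
    by (cases "i < length xs") (auto simp: entry_def simp flip: Cons_nth_drop_Suc)
  moreover have "effective (\<lambda>x. case drop (n x) (f x) of [] \<Rightarrow> 0 | y # _ \<Rightarrow> y)"
    by (intro eff assms)
  ultimately show ?thesis by simp
qed

lemma effective_remdups [eff]: assumes "effective f" shows "effective (\<lambda>x. remdups (f x))"
proof -
  have "rec_list [] (\<lambda>y ys acc. if y \<in> set ys then acc else y # acc) xs = remdups xs" for xs :: "'b list"
    by (induction xs) auto
  moreover have "effective (\<lambda>x. rec_list [] (\<lambda>y ys acc. if y \<in> set ys then acc else y # acc) (f x))"
    by (intro eff assms)
  ultimately show ?thesis by simp
qed

lemma effective_subseqs [eff]: assumes "effective f" shows "effective (\<lambda>x. List.subseqs (f x))"
proof -
  have "rec_list [[]] (\<lambda>y _ acc. map ((#) y) acc @ acc) xs = List.subseqs xs" for xs :: "'b list"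
    by (induction xs) (auto simp: Let_def)
  moreover have "effective (\<lambda>x. rec_list [[]] (\<lambda>y _ acc. map (\<lambda>ys. y # ys) acc @ acc) (f x))"
    by (intro eff assms)
  ultimately show ?thesis by simp
qed

lemma effective_product_lists [eff]:
  assumes "effective f" shows "effective (\<lambda>x. product_lists (f x))"
proof -
  have "rec_list [[]] (\<lambda>ys _ acc. concat (map (\<lambda>y. map ((#) y) acc) ys)) xss = product_lists xss"
    for xss :: "'b list list"
    by (induction xss) auto
  moreover have "effective (\<lambda>x. rec_list [[]]
      (\<lambda>ys _ acc. concat (map (\<lambda>y. map (\<lambda>zs. y # zs) acc) ys)) (f x))"
    by (intro eff assms)
  ultimately show ?thesis by simp
qed

lemma effective_prod_encode [eff]:
  fixes f g :: "'a::encodable \<Rightarrow> nat"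
  shows "effective f \<Longrightarrow> effective g \<Longrightarrow> effective (\<lambda>x. prod_encode (f x, g x))"
  using effective_code[OF effective_Pair[of f g]] by (simp add: code_Pair)

lemma effective_prod_decode [eff]: "effective f \<Longrightarrow> effective (\<lambda>x. prod_decode (f x))"
proof -
  have "prod_decode n = decode n" for n
    by (metis decode_nat decode_prod_encode prod_decode_inverse surj_pair)
  then show "effective f \<Longrightarrow> effective (\<lambda>x. prod_decode (f x))" by (simp add: effective_decode)
qed

lemma effective_list_decode [eff]: "effective f \<Longrightarrow> effective (\<lambda>x. list_decode (f x))"
  unfolding decode_nat_list[symmetric] by (rule effective_decode)

text \<open>
  A certificate \<open>c\<close> is only guaranteed to exist for histories satisfying \<open>I\<close>, while \<^term>\<open>Least\<close>
  is effective only for searches that always succeed. Hence one searches for the code of a whole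
  initial segment of the sequence, which exists for every length.
\<close>

lemma effective_dependent_choice:
  assumes D: "decidable (\<lambda>z. D (fst z) (snd z :: nat))"
    and Nil: "I []" and ex: "\<And>s. I s \<Longrightarrow> \<exists>c. D s c" and step: "\<And>s c. I s \<Longrightarrow> D s c \<Longrightarrow> I (s @ [c])"
  obtains c where "effective c" "\<And>m. I (map c [0..<m])" "\<And>m. D (map c [0..<m]) (c m)"
proof -
  define c' where "c' s = (LEAST c. D s c)" for s
  define w where "w m = rec_nat [] (\<lambda>_ s. s @ [c' s]) m" for m
  have I_w: "I (w m)" for m
  proof (induction m)
    case (Suc m)
    then have "D (w m) (c' (w m))" unfolding c'_def using ex by (auto intro: LeastI_ex)
    with Suc step show ?case by (simp add: w_def)
  qed (simp add: w_def Nil)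
  have D_w: "D (w m) (c' (w m))" for m
    unfolding c'_def using ex[OF I_w] by (auto intro: LeastI_ex)
  have len: "length (w m) = m" for m
    by (induction m) (auto simp: w_def)
  have take_w: "take i (w m) = w i" if "i \<le> m" for i m
    using that
  proof (induction m)
    case (Suc m)
    have "w (Suc m) = w m @ [c' (w m)]" by (simp add: w_def)
    with Suc len[of m] len[of "Suc m"] show ?case by (cases "i = Suc m") auto
  qed (simp add: w_def)
  have w_nth: "entry (w m) i = c' (w i)" if "i < m" for i m
  proof -
    have "w (Suc i) = w i @ [c' (w i)]" by (simp add: w_def)
    moreover have "entry (w m) i = w (Suc i) ! i"
      using take_w[of "Suc i" m] that len by (metis entry_def Suc_leI lessI nth_take)
    ultimately show ?thesis by (metis len nth_append_length)
  qed
  \<comment> \<open>\<open>Q m u\<close> says that \<open>u\<close> codes the list of length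
    \<open>m\<close> in which every item is the least certificate for the items before it. Exactly
    one such \<open>u\<close> exists for each \<open>m\<close>, so the search for it is
    total.\<close>
  define Q where "Q m u \<longleftrightarrow> length (decode u :: nat list) = m \<and>
    (\<forall>i<m. D (take i (decode u)) (entry (decode u) i) \<and>
      (\<forall>j<entry (decode u) i. \<not> D (take i (decode u)) j))" for m u :: nat
  have Q: "Q m u \<longleftrightarrow> u = code (w m)" for m u
  proof
    assume Q: "Q m u"
    have "take i (decode u) = w i" if "i \<le> m" for i
      using that
    proof (induction i)
      case (Suc i)
      then have 1: "take i (decode u) = w i" by simp
      from Suc.prems have "D (take i (decode u)) (entry (decode u) i)"
        "\<forall>j<entry (decode u) i. \<not> D (take i (decode u)) j"
        using Q unfolding Q_def by auto
      then have "entry (decode u) i = c' (w i)"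
        unfolding c'_def 1 by (intro Least_equality[symmetric]) (auto simp: not_less[symmetric])
      moreover have "i < length (decode u :: nat list)"
        using Suc.prems Q unfolding Q_def by auto
      ultimately show ?case using 1 by (simp add: take_Suc_conv_app_nth entry_def w_def)
    qed (simp add: w_def)
    from this[of m] have "decode u = w m" using Q unfolding Q_def by simp
    then show "u = code (w m)" by (metis code_decode)
  next
    assume u: "u = code (w m)"
    show "Q m u"
      unfolding Q_def u decode_code using D_w
      by (auto simp: len take_w w_nth c'_def dest: not_less_Least)
  qed
  have "effective (\<lambda>m. LEAST u. Q m u)"
    unfolding Q_def
    by (intro eff decidable_compose2[OF D])
       (use Q[unfolded Q_def] in blast)
  moreover have "(LEAST u. Q m u) = code (w m)" for m
    by (simp add: Q Least_equality)
  ultimately have "effective (\<lambda>m. code (w m))" by simp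
  then have "effective (\<lambda>m. decode (code (w m)) :: nat list)" by (rule effective_decode)
  then have eff_w: "effective w" by simp
  define c where "c m = entry (w (Suc m)) m" for m
  have c: "c m = c' (w m)" for m by (simp add: c_def w_nth)
  have map_c: "map c [0..<m] = w m" for m
    by (intro nth_equalityI) (auto simp: len c w_nth[symmetric] entry_def)
  show thesis
  proof
    show "effective c" unfolding c_def by (intro eff effective_compose[OF eff_w])
    show "I (map c [0..<m])" "D (map c [0..<m]) (c m)" for m
      unfolding map_c c using I_w D_w by auto
  qed
qed

section \<open>Infinite tables of independent random values\<close>

definition depends_on :: "((nat \<Rightarrow> 'a) \<Rightarrow> bool) \<Rightarrow> nat set \<Rightarrow> bool" where
  "depends_on Q S \<longleftrightarrow> (\<forall>r r'. (\<forall>m\<in>S. r m = r' m) \<longrightarrow> Q r = Q r')"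

lemma depends_on_mono: "depends_on Q S \<Longrightarrow> S \<subseteq> S' \<Longrightarrow> depends_on Q S'"
  unfolding depends_on_def by blast

lemma depends_onD: "depends_on Q S \<Longrightarrow> (\<And>m. m \<in> S \<Longrightarrow> r m = r' m) \<Longrightarrow> Q r = Q r'"
  unfolding depends_on_def by blast

lemma depends_on_restrict: "depends_on Q S \<Longrightarrow> Q (restrict r S) = Q r"
  by (rule depends_onD) auto

locale random_table =
  fixes D :: "nat \<Rightarrow> nat measure"
  assumes prob_space_D: "prob_space (D m)" and sets_D [simp]: "sets (D m) = UNIV"
begin

lemma space_D [simp]: "space (D m) = UNIV"
  by (metis UNIV_I sets.top sets_D sets.sets_into_space top.extremum_unique)

sublocale product_prob_space D UNIV
  by (intro product_prob_spaceI prob_space_D)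

abbreviation T :: "(nat \<Rightarrow> nat) measure" where "T \<equiv> PiM UNIV D"

lemma space_T [simp]: "space T = UNIV"
  by (simp add: space_PiM)

lemma sets_PiM_finite:
  assumes "finite S" shows "sets (PiM S D) = Pow (PiE S (\<lambda>_. UNIV))"
proof -
  have "sets (PiM S D) = sets (PiM S (\<lambda>_. count_space UNIV))"
    by (intro sets_PiM_cong) auto
  also have "PiM S (\<lambda>_. count_space (UNIV :: nat set)) = count_space (PiE S (\<lambda>_. UNIV))"
    using assms by (intro count_space_PiM_finite) auto
  finally show ?thesis by simp
qed

text \<open>A finite product of countable discrete spaces is again countable and discrete, so any
  condition on finitely many entries is measurable.\<close>

lemma events_depends_on:
  assumes "finite S" "depends_on Q S" shows "{r. Q r} \<in> events"
proof -
  have "(\<lambda>r. restrict r S) \<in> measurable T (PiM S D)"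
    by (rule measurable_restrict_subset) simp
  then have "(\<lambda>r. restrict r S) -` {f \<in> PiE S (\<lambda>_. UNIV). Q f} \<inter> space T \<in> events"
    by (rule measurable_sets) (auto simp: sets_PiM_finite assms(1))
  also have "(\<lambda>r. restrict r S) -` {f \<in> PiE S (\<lambda>_. UNIV). Q f} \<inter> space T = {r. Q r}"
    using depends_on_restrict[OF assms(2)] by auto
  finally show ?thesis .
qed

lemma prob_cylinder:
  assumes "finite S" shows "prob {r. \<forall>m\<in>S. r m = f m} = (\<Prod>m\<in>S. measure (D m) {f m})"
proof -
  have "prob (prod_emb UNIV D S (PiE S (\<lambda>m. {f m}))) = (\<Prod>m\<in>S. measure (D m) {f m})"
    by (rule measure_PiM_emb) (use assms in auto)
  moreover have "prod_emb UNIV D S (PiE S (\<lambda>m. {f m})) = {r. \<forall>m\<in>S. r m = f m}"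
    by (auto simp: prod_emb_def restrict_PiE_iff PiE_iff)
  ultimately show ?thesis by simp
qed

lemma indep_vars_coordinates: "indep_vars D (\<lambda>m r. r m) UNIV"
proof -
  have "distr T T (\<lambda>r. \<lambda>m\<in>UNIV. r m) = PiM UNIV (\<lambda>m. distr T (D m) (\<lambda>r. r m))"
    by (simp add: PiM_component distr_id2 restrict_def)
  then show ?thesis
    by (subst indep_vars_iff_distr_eq_PiM) (auto simp: measurable_component_singleton)
qed

text \<open>The coordinates of a product measure are independent, hence so are its restrictions to
  disjoint blocks of coordinates.\<close>

lemma prob_conj_disjoint:
  assumes "finite S" "finite S'" "S \<inter> S' = {}" "depends_on Q S" "depends_on Q' S'"
  shows "prob {r. Q r \<and> Q' r} = prob {r. Q r} * prob {r. Q' r}"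
proof -
  have ind: "indep_var (PiM S D) (\<lambda>r. restrict (\<lambda>m. r m) S) (PiM S' D) (\<lambda>r. restrict (\<lambda>m. r m) S')"
    by (rule indep_var_restrict[OF indep_vars_coordinates]) (use assms in auto)
  let ?X = "{f \<in> PiE S (\<lambda>_. UNIV). Q f}" and ?X' = "{f \<in> PiE S' (\<lambda>_. UNIV). Q' f}"
  have "prob ((\<lambda>r. (restrict r S, restrict r S')) -` (?X \<times> ?X') \<inter> space T) =
    prob ((\<lambda>r. restrict r S) -` ?X \<inter> space T) * prob ((\<lambda>r. restrict r S') -` ?X' \<inter> space T)"
    by (rule indep_varD[OF ind]) (auto simp: sets_PiM_finite assms)
  moreover have "(\<lambda>r. restrict r S) -` ?X \<inter> space T = {r. Q r}"
    "(\<lambda>r. restrict r S') -` ?X' \<inter> space T = {r. Q' r}"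
    "(\<lambda>r. (restrict r S, restrict r S')) -` (?X \<times> ?X') \<inter> space T = {r. Q r \<and> Q' r}"
    using assms(4,5) by (auto simp: depends_on_restrict)
  ultimately show ?thesis by simp
qed

end

text \<open>Applied both to the given variables and to table entries, this reduces events to single
  evaluations, on which the two spaces can be compared.\<close>

lemma (in prob_space) prob_restrict_mem:
  assumes "finite S" "S \<subseteq> extensional V"
    and "\<And>e. e \<in> S \<Longrightarrow> {\<omega> \<in> space M. \<forall>i\<in>V. X i \<omega> = e i} \<in> events"
  shows "prob {\<omega> \<in> space M. restrict (\<lambda>i. X i \<omega>) V \<in> S} =
    (\<Sum>e\<in>S. prob {\<omega> \<in> space M. \<forall>i\<in>V. X i \<omega> = e i})"
proof -
  have eq: "restrict (\<lambda>i. X i \<omega>) V = e \<longleftrightarrow> (\<forall>i\<in>V. X i \<omega> = e i)" if "e \<in> S" for e \<omega>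
    using assms(2) that by (auto simp: fun_eq_iff extensional_def)
  have "{\<omega> \<in> space M. restrict (\<lambda>i. X i \<omega>) V \<in> S} = (\<Union>e\<in>S. {\<omega> \<in> space M. \<forall>i\<in>V. X i \<omega> = e i})"
    using eq by (auto simp flip: eq)
  moreover have "disjoint_family_on (\<lambda>e. {\<omega> \<in> space M. \<forall>i\<in>V. X i \<omega> = e i}) S"
    unfolding disjoint_family_on_def using eq by auto metis
  ultimately show ?thesis
    using assms(1,3) by (simp add: finite_measure_finite_Union image_subset_iff)
qed

lemma (in prob_space) prob_indep_vars_eq:
  assumes "indep_vars (\<lambda>_. count_space UNIV) X I" "V \<subseteq> I" "finite V"
  shows "prob {\<omega> \<in> space M. \<forall>i\<in>V. X i \<omega> = e i} = (\<Prod>i\<in>V. prob {\<omega> \<in> space M. X i \<omega> = e i})"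
proof (cases "V = {}")
  case True
  then show ?thesis by (simp add: prob_space)
next
  case False
  have "prob (\<Inter>i\<in>V. X i -` {e i} \<inter> space M) = (\<Prod>i\<in>V. prob (X i -` {e i} \<inter> space M))"
    using assms False by (intro indep_varsD) auto
  moreover have "(\<Inter>i\<in>V. X i -` {e i} \<inter> space M) = {\<omega> \<in> space M. \<forall>i\<in>V. X i \<omega> = e i}"
    using False by auto
  moreover have "X i -` {e i} \<inter> space M = {\<omega> \<in> space M. X i \<omega> = e i}" for i by auto
  ultimately show ?thesis by simp
qed

lemma distinct_product_lists: "(\<And>xs. xs \<in> set xss \<Longrightarrow> distinct xs) \<Longrightarrow> distinct (product_lists xss)"
proof (induction xss)
  case (Cons xs xss)
  have "distinct (concat (map (\<lambda>x. map ((#) x) ps) ys))" if "distinct ps" "distinct ys" for ps and ys :: "'a list"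
    using that(2) by (induction ys) (auto simp: that(1) distinct_map)
  with Cons show ?case by simp
qed simp

section \<open>Computable points outside of small sets\<close>

context random_table
begin

abbreviation ranges :: "(nat \<Rightarrow> nat) \<Rightarrow> nat \<Rightarrow> nat list list" where
  "ranges n N \<equiv> product_lists (map (\<lambda>m. [0..<n m]) [0..<N])"

lemma mem_ranges: "s \<in> set (ranges n N) \<longleftrightarrow> length s = N \<and> (\<forall>m<N. s ! m < n m)"
  by (auto simp: product_lists_set list_all2_conv_all_nth)

text \<open>Up to a null set only finitely many prefixes of length \<open>N\<close> occur. The
  resulting finite sum of products of point masses can be approximated from below.\<close>

lemma prob_finitely_many_entries:
  assumes n: "AE r in T. \<forall>m. r m < n m" and G: "depends_on G {..<N}"
  shows "prob {r. G r} = (\<Sum>s\<leftarrow>filter (\<lambda>s. G (entry s)) (ranges n N). \<Prod>m<N. measure (D m) {s ! m})"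
proof -
  let ?S = "{s \<in> set (ranges n N). G (entry s)}"
  let ?C = "\<lambda>s. {r. \<forall>m\<in>{..<N}. r m = s ! m}"
  have G_iff: "G r \<longleftrightarrow> G (entry s)" if "r \<in> ?C s" "s \<in> set (ranges n N)" for r s
    by (rule depends_onD[OF G]) (use that in \<open>auto simp: entry_def mem_ranges\<close>)
  have C: "?C s \<in> events" for s
    by (rule events_depends_on[of "{..<N}"]) (auto simp: depends_on_def)
  have *: "G r \<longleftrightarrow> r \<in> (\<Union>s\<in>?S. ?C s)" if "\<forall>m. r m < n m" for r
  proof
    assume "G r"
    have "map r [0..<N] \<in> set (ranges n N)" using that by (simp add: mem_ranges)
    moreover have "r \<in> ?C (map r [0..<N])" by simp
    ultimately show "r \<in> (\<Union>s\<in>?S. ?C s)" using \<open>G r\<close> G_iff by blast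
  qed (use G_iff in blast)
  have "prob {r. G r} = prob (\<Union>s\<in>?S. ?C s)"
  proof (rule measure_eq_AE)
    show "AE r in T. r \<in> {r. G r} \<longleftrightarrow> r \<in> (\<Union>s\<in>?S. ?C s)"
      using n by eventually_elim (use * in blast)
  qed (use C events_depends_on[OF _ G] in auto)
  also have "\<dots> = (\<Sum>s\<in>?S. prob (?C s))"
  proof (rule finite_measure_finite_Union)
    show "disjoint_family_on ?C ?S"
      unfolding disjoint_family_on_def
    proof (intro ballI impI)
      fix s s' assume "s \<in> ?S" "s' \<in> ?S" "s \<noteq> s'"
      then obtain m where "m < N" "s ! m \<noteq> s' ! m"
        by (auto simp: mem_ranges) (metis nth_equalityI)
      then show "?C s \<inter> ?C s' = {}" by fastforce
    qed
  qed (use C in auto)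
  also have "\<dots> = (\<Sum>s\<in>?S. \<Prod>m<N. measure (D m) {s ! m})"
    by (simp add: prob_cylinder[of "{..<N}", simplified])
  also have "\<dots> = (\<Sum>s\<leftarrow>filter (\<lambda>s. G (entry s)) (ranges n N). \<Prod>m<N. measure (D m) {s ! m})"
    by (subst sum_list_distinct_conv_sum_set) (auto intro!: distinct_filter distinct_product_lists)
  finally show ?thesis .
qed

text \<open>The lower bounds \<open>L k m v / 2 ^ k\<close> can confirm but never refute that a
  probability exceeds a threshold. Hence each entry comes from a search for a certificate, whose
  existence follows from the invariant \<open>inv\<close>.\<close>

lemma computable_point:
  fixes n :: "nat \<Rightarrow> nat" and L :: "nat \<Rightarrow> nat \<Rightarrow> nat \<Rightarrow> nat" and U :: "nat \<Rightarrow> (nat \<Rightarrow> nat) \<Rightarrow> bool"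
    and b :: "nat \<Rightarrow> nat"
  assumes n: "effective n" "AE r in T. \<forall>m. r m < n m"
    and L: "effective (\<lambda>z. L (fst z) (fst (snd z)) (snd (snd z)))"
      "\<And>k m v. L k m v \<le> 2 ^ k * measure (D m) {v}"
      "\<And>m v. (\<lambda>k. L k m v / 2 ^ k) \<longlonglongrightarrow> measure (D m) {v}"
    and U: "decidable (\<lambda>z. U (fst z) (entry (snd z)))" "effective b"
      "\<And>j. depends_on (U j) {..<b j}" "\<And>j. prob {r. U j r} \<le> 1 / 2 ^ (j + 2)"
  obtains r where "effective r" "\<And>m. r m < n m" "\<And>j. \<not> U j r"
proof -
  define val :: "nat \<Rightarrow> nat" where "val c = fst (decode c :: nat \<times> nat \<times> nat \<times> nat)" for c
  define pre where "pre s r \<longleftrightarrow> (\<forall>m<length s. r m = s ! m)" for s and r :: "nat \<Rightarrow> nat"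
  define good where "good s J r \<longleftrightarrow> pre s r \<and> (\<forall>j<Suc J. \<not> U j r)" for s J r
  define inv where "inv s \<longleftrightarrow> 0 < prob {r. pre (map val s) r \<and> (\<forall>j. \<not> U j r)}" for s
  define approx where "approx s J k N =
    (\<Sum>t\<leftarrow>filter (\<lambda>t. good s J (entry t)) (ranges n N). prod_list (map (\<lambda>m. L k m (entry t m)) [0..<N]))"
    for s J k N
  \<comment> \<open>A certificate names the next value \<open>v\<close>, the last stage
    \<open>J\<close> considered, the precision \<open>k\<close> and a number \<open>N\<close> of
    entries that decide these stages. The inequality is
    \<open>1 / 2 ^ Suc J < approx / 2 ^ (k * N)\<close> without denominators: each summand of
    \<open>approx\<close> is a product of \<open>N\<close> numerators over
    \<open>2 ^ k\<close>.\<close>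
  define cert where "cert s c \<longleftrightarrow> (\<exists>v J k N. c = code (v, J, k, N) \<and> length s < N \<and>
      (\<forall>j<Suc J. b j \<le> N) \<and> 2 ^ (k * N) < 2 ^ Suc J * approx (map val s @ [v]) J k N)"
    for s c
  have U_events: "{r. U j r} \<in> events" for j
    by (rule events_depends_on[OF _ U(3)]) simp
  have pre_events: "{r. pre s r} \<in> events" for s
    by (rule events_depends_on[of "{..<length s}"]) (auto simp: pre_def depends_on_def)
  have all_events: "{r. \<forall>j. P j \<longrightarrow> \<not> U j r} \<in> events" for P
  proof -
    have "{r. \<forall>j. P j \<longrightarrow> \<not> U j r} = space T - (\<Union>j\<in>Collect P. {r. U j r})" by auto
    moreover have "(\<Union>j\<in>Collect P. {r. U j r}) \<in> events"
      using U_events by (intro sets.countable_UN'') auto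
    ultimately show ?thesis by (simp only: sets.compl_sets)
  qed
  have events: "{r. pre s r \<and> (\<forall>j. \<not> U j r)} \<in> events" for s
    using sets.Int[OF pre_events[of s] all_events[of "\<lambda>_. True"]] by (simp add: Int_def)
  have good_events: "{r. good s J r} \<in> events" for s J
    using sets.Int[OF pre_events[of s] all_events[of "\<lambda>j. j < Suc J"]] by (simp add: Int_def good_def)
  have good_dep: "depends_on (good s J) {..<N}" if "length s \<le> N" "\<forall>j<Suc J. b j \<le> N" for s J N
  proof -
    have "depends_on (U j) {..<N}" if "j < Suc J" for j
      using depends_on_mono[OF U(3)] \<open>\<forall>j<Suc J. b j \<le> N\<close> that by (metis lessThan_subset_iff)
    with that(1) show ?thesis
      unfolding good_def pre_def depends_on_def
      by (metis (no_types, lifting) lessThan_iff order_less_le_trans)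
  qed
  have prob_good: "prob {r. good s J r} =
      (\<Sum>t\<leftarrow>filter (\<lambda>t. good s J (entry t)) (ranges n N). \<Prod>m<N. measure (D m) {t ! m})"
    if "length s \<le> N" "\<forall>j<Suc J. b j \<le> N" for s J N
    by (rule prob_finitely_many_entries[OF n(2) good_dep[OF that]])
  have prod_L: "real (prod_list (map (\<lambda>m. L k m (entry t m)) [0..<N])) / 2 ^ (k * N) =
      (\<Prod>m<N. L k m (t ! m) / 2 ^ k)" if "t \<in> set (ranges n N)" for t k N
  proof -
    have "prod_list (map (\<lambda>m. L k m (entry t m)) [0..<N]) = (\<Prod>m<N. L k m (t ! m))"
      using that by (subst prod.distinct_set_conv_list[symmetric])
        (auto simp: mem_ranges entry_def atLeast0LessThan)
    then show ?thesis by (simp add: prod_dividef power_mult)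
  qed
  have approx_eq: "approx s J k N / 2 ^ (k * N) =
      (\<Sum>t\<leftarrow>filter (\<lambda>t. good s J (entry t)) (ranges n N). \<Prod>m<N. L k m (t ! m) / 2 ^ k)"
    for s J k N
  proof -
    have "real (approx s J k N) / 2 ^ (k * N) = (\<Sum>t\<leftarrow>filter (\<lambda>t. good s J (entry t)) (ranges n N).
        real (prod_list (map (\<lambda>m. L k m (entry t m)) [0..<N])) / 2 ^ (k * N))"
    proof -
      have "real (sum_list (map f ts)) / d = (\<Sum>t\<leftarrow>ts. real (f t) / d)" for f and ts :: "nat list list" and d
        by (induction ts) (auto simp: add_divide_distrib)
      then show ?thesis unfolding approx_def .
    qed
    also have "\<dots> = (\<Sum>t\<leftarrow>filter (\<lambda>t. good s J (entry t)) (ranges n N). \<Prod>m<N. L k m (t ! m) / 2 ^ k)"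
      by (intro arg_cong[of _ _ sum_list] map_cong refl prod_L) simp
    finally show ?thesis .
  qed
  have approx_le: "approx s J k N / 2 ^ (k * N) \<le> prob {r. good s J r}"
    if "length s \<le> N" "\<forall>j<Suc J. b j \<le> N" for s J k N
    unfolding approx_eq prob_good[OF that] using L(2)
    by (intro sum_list_mono prod_mono) (auto simp: field_simps)
  have approx_lim: "(\<lambda>k. approx s J k N / 2 ^ (k * N)) \<longlonglongrightarrow> prob {r. good s J r}"
    if "length s \<le> N" "\<forall>j<Suc J. b j \<le> N" for s J N
    unfolding approx_eq prob_good[OF that] using L(3)
    by (auto simp: sum_list_sum_nth intro!: tendsto_intros)
  have split: "good s J r \<longleftrightarrow> pre s r \<and> (\<forall>j. \<not> U j r) \<or> good s J r \<and> (\<exists>j>J. U j r)" for s J r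
    unfolding good_def by (metis less_Suc_eq_le not_le)
  \<comment> \<open>The stages after \<open>J\<close> weigh at most
    \<open>1 / 2 ^ (J + 3) + 1 / 2 ^ (J + 4) + ... = 1 / 2 ^ (J + 2)\<close>, which is half of the
    threshold in \<open>cert\<close>.\<close>
  have tail: "prob (\<Union>i. {r. U (i + Suc J) r}) \<le> 1 / 2 ^ (J + 2)" for J
  proof -
    have s: "(\<lambda>i. (1 / 2) ^ (J + 3) * (1 / 2 :: real) ^ i) sums ((1 / 2) ^ (J + 3) * 2)"
      using geometric_sums[of "1 / 2 :: real"] by (intro sums_mult) simp
    have le: "prob {r. U (i + Suc J) r} \<le> (1 / 2) ^ (J + 3) * (1 / 2) ^ i" for i
      using U(4)[of "i + Suc J"] by (simp add: power_add power_divide field_simps power3_eq_cube)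
    have "summable (\<lambda>i. prob {r. U (i + Suc J) r})"
      by (rule summable_comparison_test'[OF sums_summable[OF s], of 0]) (use le in simp)
    moreover from suminf_le[OF le this sums_summable[OF s]]
    have "(\<Sum>i. prob {r. U (i + Suc J) r}) \<le> (1 / 2) ^ (J + 3) * 2"
      unfolding sums_unique[OF s, symmetric] .
    moreover from calculation(1)
    have "prob (\<Union>i. {r. U (i + Suc J) r}) \<le> (\<Sum>i. prob {r. U (i + Suc J) r})"
      using U_events by (intro finite_measure_subadditive_countably) auto
    moreover have "(1 / 2) ^ (J + 3) * 2 = (1 :: real) / 2 ^ (J + 2)"
      by (simp add: power_add power_divide power3_eq_cube)
    ultimately show ?thesis by linarith
  qed
  have inv_step: "inv (s @ [c])" if cert: "cert s c" for s c
  proof -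
    obtain v J k N where c: "c = code (v, J, k, N)" "length s < N" "\<forall>j<Suc J. b j \<le> N"
      "2 ^ (k * N) < 2 ^ Suc J * approx (map val s @ [v]) J k N"
      using cert unfolding cert_def by blast
    let ?s = "map val s @ [v]"
    have "real (2 ^ (k * N)) < real (2 ^ Suc J * approx ?s J k N)"
      using c(4) of_nat_less_iff by blast
    then have "1 / 2 ^ Suc J < approx ?s J k N / 2 ^ (k * N)"
      by (simp add: field_simps)
    also have "\<dots> \<le> prob {r. good ?s J r}"
      using c by (intro approx_le) auto
    also have "\<dots> \<le> prob ({r. pre ?s r \<and> (\<forall>j. \<not> U j r)} \<union> (\<Union>i. {r. U (i + Suc J) r}))"
    proof (rule finite_measure_mono)
      show "{r. good ?s J r} \<subseteq> {r. pre ?s r \<and> (\<forall>j. \<not> U j r)} \<union> (\<Union>i. {r. U (i + Suc J) r})"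
      proof
        fix r assume "r \<in> {r. good ?s J r}"
        then consider "pre ?s r \<and> (\<forall>j. \<not> U j r)" | j where "J < j" "U j r"
          using split[of ?s J r] by auto
        then show "r \<in> {r. pre ?s r \<and> (\<forall>j. \<not> U j r)} \<union> (\<Union>i. {r. U (i + Suc J) r})"
        proof cases
          case (2 j)
          then have "U (j - Suc J + Suc J) r" by simp
          then show ?thesis by blast
        qed blast
      qed
    qed (use events U_events in auto)
    also have "\<dots> \<le> prob {r. pre ?s r \<and> (\<forall>j. \<not> U j r)} + prob (\<Union>i. {r. U (i + Suc J) r})"
      using events U_events by (intro measure_subadditive) auto
    also have "\<dots> \<le> prob {r. pre ?s r \<and> (\<forall>j. \<not> U j r)} + 1 / 2 ^ (J + 2)"
      using tail by simp
    finally have "1 / 2 ^ Suc J - 1 / 2 ^ (J + 2) < prob {r. pre ?s r \<and> (\<forall>j. \<not> U j r)}" by simp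
    moreover have "(0::real) < 1 / 2 ^ Suc J - 1 / 2 ^ (J + 2)"
      by (simp add: field_simps)
    ultimately have "0 < prob {r. pre ?s r \<and> (\<forall>j. \<not> U j r)}" by linarith
    then show ?thesis
      unfolding inv_def c(1) by (simp add: val_def)
  qed
  have ex_cert: "\<exists>c. cert s c" if "inv s" for s
  proof -
    let ?s = "map val s" and ?m = "length s"
    \<comment> \<open>The next entry has only countably many possible values, so a set of positive
      probability cannot split into null sets.\<close>
    have "\<exists>v. 0 < prob {r. pre (?s @ [v]) r \<and> (\<forall>j. \<not> U j r)}"
    proof (rule ccontr)
      assume "\<not> ?thesis"
      then have null: "prob {r. pre (?s @ [v]) r \<and> (\<forall>j. \<not> U j r)} = 0" for v
        by (meson measure_nonneg not_less order_antisym)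
      have "{r. pre ?s r \<and> (\<forall>j. \<not> U j r)} \<subseteq> (\<Union>v. {r. pre (?s @ [v]) r \<and> (\<forall>j. \<not> U j r)})"
      proof
        fix r assume "r \<in> {r. pre ?s r \<and> (\<forall>j. \<not> U j r)}"
        then show "r \<in> (\<Union>v. {r. pre (?s @ [v]) r \<and> (\<forall>j. \<not> U j r)})"
          by (auto simp: pre_def nth_append less_Suc_eq intro!: exI[of _ "r ?m"])
      qed
      then have "prob {r. pre ?s r \<and> (\<forall>j. \<not> U j r)} \<le>
          prob (\<Union>v. {r. pre (?s @ [v]) r \<and> (\<forall>j. \<not> U j r)})"
        using events by (intro finite_measure_mono) auto
      also have "\<dots> \<le> (\<Sum>v. prob {r. pre (?s @ [v]) r \<and> (\<forall>j. \<not> U j r)})"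
        using events null by (intro finite_measure_subadditive_countably) auto
      finally show False using that null unfolding inv_def by simp
    qed
    then obtain v where v: "0 < prob {r. pre (?s @ [v]) r \<and> (\<forall>j. \<not> U j r)}" by blast
    obtain J where J: "(1 / 2) ^ J < prob {r. pre (?s @ [v]) r \<and> (\<forall>j. \<not> U j r)}"
      using real_arch_pow_inv[OF v, of "1 / 2"] by auto
    define N where "N = Suc ?m + (\<Sum>j<Suc J. b j)"
    have N: "length (?s @ [v]) \<le> N" "\<forall>j<Suc J. b j \<le> N"
      unfolding N_def by (simp, intro allI impI trans_le_add2 member_le_sum) auto
    have "1 / 2 ^ Suc J < (1 / 2 :: real) ^ J" by (simp add: power_divide field_simps)
    also have "\<dots> < prob {r. pre (?s @ [v]) r \<and> (\<forall>j. \<not> U j r)}" by (rule J)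
    also have "\<dots> \<le> prob {r. good (?s @ [v]) J r}"
      using good_events by (intro finite_measure_mono) (auto simp: good_def)
    finally have "\<forall>\<^sub>F k in sequentially. 1 / 2 ^ Suc J < approx (?s @ [v]) J k N / 2 ^ (k * N)"
      by (rule order_tendstoD[OF approx_lim[OF N]])
    then obtain k where "1 / 2 ^ Suc J < approx (?s @ [v]) J k N / 2 ^ (k * N)"
      by (auto simp: eventually_sequentially)
    then have "real (2 ^ (k * N)) < real (2 ^ Suc J * approx (?s @ [v]) J k N)"
      by (simp add: field_simps)
    then have "2 ^ (k * N) < 2 ^ Suc J * approx (?s @ [v]) J k N"
      using of_nat_less_iff by blast
    then have "cert s (code (v, J, k, N))"
      unfolding cert_def using N by auto
    then show ?thesis ..
  qed
  have dec: "decidable (\<lambda>z. cert (fst z) (snd z))"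
  proof -
    have eff_L: "effective (\<lambda>x. L (f x) (g x) (h x))"
      if "effective f" "effective g" "effective h" for f g h :: "'x::encodable \<Rightarrow> nat"
      using effective_compose3[OF L(1) that] .
    have dec_U: "decidable (\<lambda>x. U (f x) (entry (g x)))"
      if "effective f" "effective g" for f and g :: "'x::encodable \<Rightarrow> nat list"
      using decidable_compose2[OF U(1) that] .
    have good_entry: "good s J (entry t) \<longleftrightarrow>
      (\<forall>m<length s. entry t m = entry s m) \<and> (\<forall>j<Suc J. \<not> U j (entry t))" for s J t
      by (simp add: good_def pre_def entry_def)
    have "cert s c \<longleftrightarrow> (case decode c of (v, J, k, N) \<Rightarrow> length s < N \<and>
      (\<forall>j<Suc J. b j \<le> N) \<and> 2 ^ (k * N) < 2 ^ Suc J * approx (map val s @ [v]) J k N)" for s c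
      unfolding cert_def by (auto split: prod.split) (metis code_decode)
    then show ?thesis
      unfolding approx_def val_def good_entry case_prod_beta
      by (simp only:) (intro eff eff_L dec_U effective_compose[OF n(1)] effective_compose[OF U(2)])
  qed
  \<comment> \<open>Stage \<open>0\<close> and the tail after it have probability at most
    \<open>1 / 4\<close> each.\<close>
  have inv_Nil: "inv []"
  proof -
    have "1 = prob (space T)" by (rule P.prob_space[symmetric])
    also have "\<dots> \<le> prob ({r. \<forall>j. \<not> U j r} \<union> ({r. U 0 r} \<union> (\<Union>i. {r. U (i + Suc 0) r})))"
    proof (rule finite_measure_mono)
      show "space T \<subseteq> {r. \<forall>j. \<not> U j r} \<union> ({r. U 0 r} \<union> (\<Union>i. {r. U (i + Suc 0) r}))"
      proof
        fix r
        show "r \<in> {r. \<forall>j. \<not> U j r} \<union> ({r. U 0 r} \<union> (\<Union>i. {r. U (i + Suc 0) r}))"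
          by (auto, metis not0_implies_Suc)
      qed
    qed (use all_events[of "\<lambda>_. True"] U_events in auto)
    also have "\<dots> \<le> prob {r. \<forall>j. \<not> U j r} + prob ({r. U 0 r} \<union> (\<Union>i. {r. U (i + Suc 0) r}))"
      using all_events[of "\<lambda>_. True"] U_events by (intro measure_subadditive) auto
    also have "prob ({r. U 0 r} \<union> (\<Union>i. {r. U (i + Suc 0) r})) \<le>
        prob {r. U 0 r} + prob (\<Union>i. {r. U (i + Suc 0) r})"
      using U_events by (intro measure_subadditive) auto
    also have "\<dots> \<le> 1 / 2 ^ 2 + 1 / 2 ^ 2"
      using U(4)[of 0] tail[of 0] by (intro add_mono) (simp_all del: add_Suc_right)
    finally show ?thesis unfolding inv_def pre_def by simp
  qed
  obtain c where c: "effective c" "\<And>m. inv (map c [0..<m])"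
    using effective_dependent_choice[of cert inv, OF dec inv_Nil ex_cert inv_step] by metis
  define r where "r m = val (c m)" for m
  \<comment> \<open>The single point \<open>r\<close> is compared with tables \<open>r'\<close> from
    sets of positive probability: a condition on finitely many entries cannot separate
    \<open>r\<close> from an \<open>r'\<close> that agrees with it long enough. Positive probability
    also allows \<open>r'\<close> to obey the bounds that hold almost surely.\<close>
  have ex: "\<exists>r'. (\<forall>i<m. r' i = r i) \<and> (\<forall>j. \<not> U j r') \<and> (\<forall>i. r' i < n i)" for m
  proof (rule ccontr)
    assume *: "\<not> ?thesis"
    have "AE r' in T. \<not> (pre (map val (map c [0..<m])) r' \<and> (\<forall>j. \<not> U j r'))"
      using n(2) by eventually_elim (use * in \<open>auto simp: pre_def r_def\<close>)
    then have "prob {r'. pre (map val (map c [0..<m])) r' \<and> (\<forall>j. \<not> U j r')} = prob {}"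
      using events by (intro measure_eq_AE) auto
    with c(2)[of m] show False unfolding inv_def by simp
  qed
  show thesis
  proof
    show "effective r" unfolding r_def val_def by (intro eff c(1))
    show "r m < n m" for m
      using ex[of "Suc m"] by (metis lessI)
    show "\<not> U j r" for j
      using ex[of "b j"] depends_onD[OF U(3)[of j]] by (metis lessThan_iff)
  qed
qed

end

section \<open>Layered witnesses of resampling logs\<close>

lemma depends_on_conj:
  assumes "depends_on Q S" "depends_on Q' S" shows "depends_on (\<lambda>r. Q r \<and> Q' r) S"
  unfolding depends_on_def
proof (intro allI impI)
  fix r r' :: "nat \<Rightarrow> 'a" assume "\<forall>m\<in>S. r m = r' m"
  then have "Q r = Q r'" "Q' r = Q' r'"
    by (auto intro!: depends_onD[OF assms(1)] depends_onD[OF assms(2)])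
  then show "(Q r \<and> Q' r) = (Q r' \<and> Q' r')" by simp
qed

text \<open>\<open>K\<close> is meant to contain one index for each event, and \<open>G j\<close>
  contains \<open>j\<close> itself unless \<open>V j\<close> is empty. \<open>R_Nil\<close> excludes
  events that occur without reading any variable, which no resampling could end.\<close>

locale event_system =
  fixes K :: "nat set" and V :: "nat \<Rightarrow> nat list" and R :: "nat \<Rightarrow> nat list list" and G :: "nat \<Rightarrow> nat list"
  assumes R_Nil: "V j = [] \<Longrightarrow> R j = []"
    and set_G: "j \<in> K \<Longrightarrow> set (G j) = {k \<in> K. set (V k) \<inter> set (V j) \<noteq> {}}"
begin

definition occurs :: "nat \<Rightarrow> (nat \<Rightarrow> nat) \<Rightarrow> bool" where
  "occurs j a \<longleftrightarrow> map a (V j) \<in> set (R j)"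

lemma occurs_cong: "(\<And>i. i \<in> set (V j) \<Longrightarrow> a i = a' i) \<Longrightarrow> occurs j a = occurs j a'"
  unfolding occurs_def by (metis map_eq_conv)

definition touches :: "nat \<Rightarrow> nat list \<Rightarrow> bool" where
  "touches j J \<longleftrightarrow> (\<exists>k\<in>set J. set (V j) \<inter> set (V k) \<noteq> {})"

definition vars :: "nat list \<Rightarrow> nat set" where
  "vars J = (\<Union>k\<in>set J. set (V k))"

lemma touches_iff: "touches j J \<longleftrightarrow> set (V j) \<inter> vars J \<noteq> {}"
  by (auto simp: touches_def vars_def)

lemma vars_simps [simp]: "vars [] = {}" "vars (b # J) = set (V b) \<union> vars J"
  by (auto simp: vars_def)

text \<open>Without repetitions, \<open>List.subseqs\<close> lists each set of neighbours once, so
  that no layer is summed twice.\<close>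

definition nbrs :: "nat list \<Rightarrow> nat list" where
  "nbrs J = remdups (concat (map G J))"

text \<open>
  A witness lists its layers from the oldest one to the layer of the root. The table entry
  \<open>prod_encode (i, c)\<close> holds the \<open>c\<close>-th value of variable \<open>i\<close>; in \<open>consistent\<close>, \<open>f i\<close> counts how
  often variable \<open>i\<close> has been resampled before the first layer.
\<close>

primrec witnesses :: "nat \<Rightarrow> nat list \<Rightarrow> nat list list list" where
  "witnesses 0 I = [[I]]"
| "witnesses (Suc d) I = concat (map (\<lambda>s. map (\<lambda>J. J # s)
     (filter (\<lambda>J. J \<noteq> []) (List.subseqs (nbrs (hd s))))) (witnesses d I))"

text \<open>Events of a layer then read different table entries, which makes their occurrences
  independent.\<close>

definition proper :: "nat list list \<Rightarrow> bool" where
  "proper s \<longleftrightarrow> (\<forall>J\<in>set s. \<forall>j\<in>set J. \<forall>k\<in>set J. j \<noteq> k \<longrightarrow> set (V j) \<inter> set (V k) = {})"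

primrec consistent :: "(nat \<Rightarrow> nat) \<Rightarrow> (nat \<Rightarrow> nat) \<Rightarrow> nat list list \<Rightarrow> bool" where
  "consistent r f [] \<longleftrightarrow> True"
| "consistent r f (J # s) \<longleftrightarrow> (\<forall>j\<in>set J. occurs j (\<lambda>i. r (prod_encode (i, f i)))) \<and>
     consistent r (\<lambda>i. f i + of_bool (i \<in> vars J)) s"

lemma occurs_entry_cong:
  "(\<And>i. i \<in> set (V j) \<Longrightarrow> f i = g i) \<Longrightarrow>
    occurs j (\<lambda>i. r (prod_encode (i, f i))) = occurs j (\<lambda>i. r (prod_encode (i, g i)))"
  by (rule occurs_cong) simp

lemma proper_cong: "map set s = map set s' \<Longrightarrow> proper s = proper s'"
proof -
  have "proper s \<longleftrightarrow> (\<forall>J\<in>set (map set s). \<forall>j\<in>J. \<forall>k\<in>J. j \<noteq> k \<longrightarrow> set (V j) \<inter> set (V k) = {})" for s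
    by (simp add: proper_def)
  then show "map set s = map set s' \<Longrightarrow> proper s = proper s'" by metis
qed

lemma consistent_cong: "map set s = map set s' \<Longrightarrow> consistent r f s = consistent r f s'"
proof (induction s arbitrary: s' f)
  case (Cons J s)
  then obtain J' t where s': "s' = J' # t" "set J = set J'" "map set s = map set t"
    by (cases s') auto
  have "vars J = vars J'" using s'(2) by (simp add: vars_def)
  then show ?case using s' Cons.IH[OF s'(3)] by simp
qed simp

subsection \<open>Building a witness from a log\<close>

text \<open>The log is inserted backwards in time, so \<open>b\<close> happened before everything in
  the witness. It goes directly before the oldest layer with which it shares a variable. If there is
  none it is dropped, since the witness then reads no variable that \<open>b\<close> resampled. In a
  witness tree it would be attached to the deepest adjacent vertex.\<close>

fun put :: "nat \<Rightarrow> nat list list \<Rightarrow> nat list list" where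
  "put b [] = []"
| "put b [I] = (if touches b I then [[b], I] else [I])"
| "put b (J # I # s) = (if touches b J then [b] # J # I # s
     else if touches b I then (b # J) # I # s else J # put b (I # s))"

text \<open>Going back before the resampling of \<open>b\<close> lowers the counters of its
  variables by one. The layers that \<open>b\<close> passes contain none of these variables: they
  keep their samples, and they do not change the counters that \<open>b\<close> reads. The layers
  after \<open>b\<close> regain the step when the counters pass the layer of
  \<open>b\<close>.\<close>

lemma consistent_put:
  assumes "consistent r (\<lambda>i. f i + of_bool (i \<in> set (V b))) s"
    and "occurs b (\<lambda>i. r (prod_encode (i, f i)))"
  shows "consistent r f (put b s)"
  using assms
proof (induction b s arbitrary: f rule: put.induct)
  case (2 b I)
  have "occurs j (\<lambda>i. r (prod_encode (i, f i)))" if "\<not> touches b I" "j \<in> set I" for j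
  proof -
    have "occurs j (\<lambda>i. r (prod_encode (i, f i + of_bool (i \<in> set (V b)))))"
      using 2 that by simp
    then show ?thesis
      by (rule iffD1[OF occurs_entry_cong, rotated]) (use that in \<open>auto simp: touches_def\<close>)
  qed
  with 2 show ?case by simp
next
  case (3 b J I s)
  show ?case
  proof (cases "touches b J")
    case True
    with 3 show ?thesis by simp
  next
    case False
    have J: "occurs j (\<lambda>i. r (prod_encode (i, f i)))" if "j \<in> set J" for j
    proof -
      have "occurs j (\<lambda>i. r (prod_encode (i, f i + of_bool (i \<in> set (V b)))))"
        using 3 that by simp
      then show ?thesis
        by (rule iffD1[OF occurs_entry_cong, rotated]) (use that False in \<open>auto simp: touches_def\<close>)
    qed
    have rest: "consistent r (\<lambda>i. f i + of_bool (i \<in> set (V b)) + of_bool (i \<in> vars J)) (I # s)"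
      using 3(2) by simp
    show ?thesis
    proof (cases "touches b I")
      case True
      have "(\<lambda>i. f i + of_bool (i \<in> set (V b)) + of_bool (i \<in> vars J)) =
          (\<lambda>i. f i + of_bool (i \<in> vars (b # J)))"
        using False by (auto simp: touches_iff fun_eq_iff)
      with rest show ?thesis using True False J 3(3) by simp
    next
      case nI: False
      have "consistent r (\<lambda>i. f i + of_bool (i \<in> vars J)) (put b (I # s))"
      proof (rule 3(1)[OF False nI])
        show "consistent r (\<lambda>i. f i + of_bool (i \<in> vars J) + of_bool (i \<in> set (V b))) (I # s)"
          using rest by (simp add: add.commute add.left_commute)
        show "occurs b (\<lambda>i. r (prod_encode (i, f i + of_bool (i \<in> vars J))))"
          by (rule iffD1[OF occurs_entry_cong 3(3)]) (use False in \<open>auto simp: touches_iff\<close>)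
      qed
      then show ?thesis using False nI J by simp
    qed
  qed
qed simp

fun linked :: "nat list list \<Rightarrow> bool" where
  "linked (J # I # s) \<longleftrightarrow> J \<noteq> [] \<and> set J \<subseteq> set (nbrs I) \<and> linked (I # s)"
| "linked _ \<longleftrightarrow> True"

lemma nbrs_subset_K: "set J \<subseteq> K \<Longrightarrow> set (nbrs J) \<subseteq> K"
  by (auto simp: nbrs_def set_G subset_iff)

lemma mem_nbrs: "touches b J \<Longrightarrow> set J \<subseteq> K \<Longrightarrow> b \<in> K \<Longrightarrow> b \<in> set (nbrs J)"
  by (force simp: nbrs_def touches_def set_G subset_iff)

text \<open>If \<open>b\<close> joins a layer, it shares no variable with it, which keeps the
  witness proper, but touches the next layer, which keeps it linked.\<close>

lemma linked_put:
  assumes "linked s" "proper s" "\<Union>(set ` set s) \<subseteq> K" "b \<in> K"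
  shows "linked (put b s) \<and> proper (put b s) \<and> \<Union>(set ` set (put b s)) \<subseteq> K"
  using assms
proof (induction b s rule: put.induct)
  case (2 b I)
  then show ?case using mem_nbrs[of b I] by (auto simp: proper_def)
next
  case (3 b J I s)
  show ?case
  proof (cases "touches b J")
    case True
    with 3 show ?thesis using mem_nbrs[of b J] by (auto simp: proper_def)
  next
    case False
    then have J: "\<forall>j\<in>set J. set (V b) \<inter> set (V j) = {}" by (auto simp: touches_def)
    show ?thesis
    proof (cases "touches b I")
      case True
      with False 3 J show ?thesis using mem_nbrs[of b I] by (auto simp: proper_def)
    next
      case nI: False
      from 3 have IH: "linked (put b (I # s)) \<and> proper (put b (I # s)) \<and> \<Union>(set ` set (put b (I # s))) \<subseteq> K"
        using False nI by (auto simp: proper_def)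
      \<comment> \<open>As \<open>b\<close> does not touch \<open>I\<close>, the recursive call adds
        no layer in front; its first layer still contains \<open>I\<close>, so \<open>J\<close>
        remains in the neighbourhood.\<close>
      have "put b (I # s) \<noteq> [] \<and> set I \<subseteq> set (hd (put b (I # s)))"
        using nI by (cases s) auto
      then obtain I' s' where s': "put b (I # s) = I' # s'" "set I \<subseteq> set I'"
        by (cases "put b (I # s)") auto
      then have "set (nbrs I) \<subseteq> set (nbrs I')" by (auto simp: nbrs_def)
      then show ?thesis using IH 3 False nI unfolding s' by (auto simp: s' proper_def)
    qed
  qed
qed simp

lemma last_put: "last (put b s) = last s \<and> (put b s = [] \<longleftrightarrow> s = [])"
  by (induction b s rule: put.induct) auto

text \<open>Layers are numbered from the root, so that numbers stay valid when older layers are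
  added at the front.\<close>

primrec in_layer :: "nat list list \<Rightarrow> nat \<Rightarrow> nat \<Rightarrow> bool" where
  "in_layer [] k b \<longleftrightarrow> False"
| "in_layer (J # s) k b \<longleftrightarrow> k = length s \<and> b \<in> set J \<or> in_layer s k b"

lemma in_layer_less: "in_layer s k b \<Longrightarrow> k < length s"
  by (induction s) auto

lemma length_put: "\<not> touches b I \<Longrightarrow> length (put b (I # s)) = length (I # s)"
  by (induction s arbitrary: I) auto

lemma in_layer_put: "in_layer s k x \<Longrightarrow> in_layer (put b s) k x"
  by (induction b s rule: put.induct) (auto simp: length_put)

text \<open>The oldest layer touched by \<open>b\<close> is at least as far from the root as that of
  \<open>x\<close>, and \<open>b\<close> goes one layer further.\<close>

lemma in_layer_put_touches:
  "in_layer s k x \<Longrightarrow> set (V b) \<inter> set (V x) \<noteq> {} \<Longrightarrow> \<exists>k'>k. in_layer (put b s) k' b"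
proof (induction b s rule: put.induct)
  case (2 b I)
  then show ?case by (auto simp: touches_def)
next
  case (3 b J I s)
  show ?case
  proof (cases "touches b J")
    case True
    then show ?thesis using in_layer_less[OF 3(2)] by auto
  next
    case False
    then have x: "in_layer (I # s) k x" using 3 by (auto simp: touches_def)
    then have "k \<le> length s" using in_layer_less by fastforce
    show ?thesis
    proof (cases "touches b I")
      case True
      then show ?thesis using False \<open>k \<le> length s\<close> by (auto intro!: exI[of _ "Suc (length s)"])
    next
      case nI: False
      then show ?thesis using 3(1)[OF False nI x 3(3)] False by auto
    qed
  qed
qed simp

abbreviation put_all :: "nat list list \<Rightarrow> nat list \<Rightarrow> nat list list" where
  "put_all \<equiv> foldl (\<lambda>s b. put b s)"

text \<open>The number of samples of variable \<open>i\<close> used up by the log is the position of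
  its current sample in the table.\<close>

definition count_var :: "nat list \<Rightarrow> nat \<Rightarrow> nat" where
  "count_var L i = length (filter (\<lambda>b. i \<in> set (V b)) L)"

lemma count_var_simps [simp]:
  "count_var [] i = 0" "count_var (b # L) i = count_var L i + of_bool (i \<in> set (V b))"
  "count_var (L @ L') i = count_var L i + count_var L' i"
  by (auto simp: count_var_def)

text \<open>A log lists the resampled events, the most recent one first.\<close>

primrec legal :: "(nat \<Rightarrow> nat) \<Rightarrow> nat list \<Rightarrow> bool" where
  "legal r [] \<longleftrightarrow> True"
| "legal r (b # L) \<longleftrightarrow> legal r L \<and> b \<in> K \<and> occurs b (\<lambda>i. r (prod_encode (i, count_var L i)))"

text \<open>The chain leads back in time from a resampling of \<open>b\<close> that comes right
  after the log \<open>L\<close>. Every link will force a further layer of the witness.\<close>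

primrec chain :: "nat \<Rightarrow> nat \<Rightarrow> nat list \<Rightarrow> bool" where
  "chain 0 b L \<longleftrightarrow> True"
| "chain (Suc n) b L \<longleftrightarrow>
     (\<exists>u b' L'. L = u @ b' # L' \<and> set (V b') \<inter> set (V b) \<noteq> {} \<and> chain n b' L')"

text \<open>Each \<open>put\<close> goes back by one resampling, and the counters fall from
  \<open>count_var L\<close> to \<open>0\<close>, their value at the start of the run.\<close>

lemma consistent_put_all:
  "legal r L \<Longrightarrow> consistent r (count_var L) s \<Longrightarrow> consistent r (\<lambda>_. 0) (put_all s L)"
proof (induction L arbitrary: s)
  case Nil
  then show ?case by (simp add: count_var_def)
next
  case (Cons b L)
  have "consistent r (\<lambda>i. count_var L i + of_bool (i \<in> set (V b))) s"
    using Cons.prems(2) by (simp add: count_var_simps(2)[abs_def])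
  then have "consistent r (count_var L) (put b s)"
    using Cons.prems(1) by (intro consistent_put) simp_all
  then show ?case using Cons by simp
qed

lemma linked_put_all:
  "legal r L \<Longrightarrow> linked s \<Longrightarrow> proper s \<Longrightarrow> \<Union>(set ` set s) \<subseteq> K \<Longrightarrow>
    linked (put_all s L) \<and> proper (put_all s L)"
proof (induction L arbitrary: s)
  case (Cons b L)
  then show ?case using linked_put[of s b] by simp
qed simp

lemma last_put_all: "last (put_all s L) = last s \<and> (put_all s L = [] \<longleftrightarrow> s = [])"
  by (induction L arbitrary: s) (auto simp: last_put)

lemma in_layer_put_all: "in_layer s k x \<Longrightarrow> in_layer (put_all s L) k x"
  by (induction L arbitrary: s) (auto intro: in_layer_put)

lemma chain_length_put_all: "in_layer s k b \<Longrightarrow> chain n b L \<Longrightarrow> k + n < length (put_all s L)"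
proof (induction n arbitrary: s k b L)
  case 0
  then show ?case using in_layer_less[OF in_layer_put_all] by simp
next
  case (Suc n)
  then obtain u b' L' where L: "L = u @ b' # L'" "set (V b') \<inter> set (V b) \<noteq> {}" "chain n b' L'"
    by auto
  obtain k' where "k < k'" "in_layer (put b' (put_all s u)) k' b'"
    using in_layer_put_touches[OF in_layer_put_all[OF Suc.prems(1)] L(2)] by blast
  with Suc.IH[OF this(2) L(3)] show ?case by (simp add: L(1))
qed

text \<open>\<open>witnesses\<close> lists a layer only in the order of one particular neighbour
  list, so a constructed witness is found up to reordering within its layers. \<open>proper\<close>
  and \<open>consistent\<close> do not see the difference.\<close>

lemma linked_imp_witness:
  "linked s \<Longrightarrow> s \<noteq> [] \<Longrightarrow> \<exists>s'\<in>set (witnesses (length s - 1) (last s)). map set s' = map set s"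
proof (induction s rule: linked.induct)
  case (1 J I s)
  then obtain s' where s': "s' \<in> set (witnesses (length s) (last (I # s)))" "map set s' = map set (I # s)"
    by auto
  then obtain I' t where I': "s' = I' # t" "set I' = set I" by (cases s') auto
  have "set (nbrs I') = set (nbrs I)" using I'(2) by (simp add: nbrs_def)
  then have "set J \<in> set ` set (List.subseqs (nbrs I'))" using 1 by (simp add: subseqs_powset)
  then obtain J' where J': "J' \<in> set (List.subseqs (nbrs I'))" "set J' = set J" by auto
  with 1 have "J' \<noteq> []" by auto
  with J' s' I' have "J' # s' \<in> set (witnesses (Suc (length s)) (last (I # s)))"
    by (auto intro!: bexI[of _ s'])
  with s' J' show ?case by (intro bexI[of _ "J' # s'"]) auto
qed auto

text \<open>Inserting the log before the root \<open>[b]\<close> may also create layers for entries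
  outside of the chain, hence only \<open>d \<ge> n\<close>.\<close>

lemma chain_imp_witness:
  assumes "legal r (b # L)" "chain n b L"
  shows "\<exists>d\<ge>n. \<exists>s\<in>set (witnesses d [b]). proper s \<and> consistent r (\<lambda>_. 0) s"
proof -
  let ?s = "put_all [[b]] L"
  have "in_layer [[b]] 0 b" by simp
  then have len: "n < length ?s"
    using chain_length_put_all[of "[[b]]" 0 b n L] assms(2) by simp
  have lk: "linked ?s" "proper ?s"
    using linked_put_all[of r L "[[b]]"] assms(1) by (auto simp: proper_def)
  have "?s \<noteq> []" "last ?s = [b]" using last_put_all[of "[[b]]" L] by auto
  with linked_imp_witness[OF lk(1)] obtain s' where s': "s' \<in> set (witnesses (length ?s - 1) [b])"
    "map set s' = map set ?s" by auto
  have "consistent r (\<lambda>_. 0) ?s"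
    using assms(1) by (intro consistent_put_all) auto
  then have "consistent r (\<lambda>_. 0) s'" "proper s'"
    using consistent_cong[OF s'(2)] proper_cong[OF s'(2)] lk by auto
  with s' len show ?thesis by (intro exI[of _ "length ?s - 1"]) auto
qed

subsection \<open>Weights of witnesses\<close>

abbreviation weight :: "(nat \<Rightarrow> real) \<Rightarrow> nat list \<Rightarrow> real" where
  "weight p J \<equiv> (\<Prod>j\<leftarrow>J. p j)"

lemma sum_subseqs: "(\<Sum>J\<leftarrow>List.subseqs xs. weight y J) = (\<Prod>j\<leftarrow>xs. 1 + y j)"
proof (induction xs)
  case (Cons x xs)
  have "(\<Sum>J\<leftarrow>map ((#) x) Js. weight y J) = y x * (\<Sum>J\<leftarrow>Js. weight y J)" for Js
    by (induction Js) (auto simp: algebra_simps)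
  with Cons show ?case by (simp add: Let_def algebra_simps)
qed simp

lemma prod_list_nonneg': "(\<And>x. x \<in> set xs \<Longrightarrow> 0 \<le> f x) \<Longrightarrow> 0 \<le> (\<Prod>x\<leftarrow>xs. f x :: real)"
  by (induction xs) auto

text \<open>A neighbour shared by several events of \<open>J\<close> counts once on the left but
  repeatedly in the product of the single bounds; this is harmless because
  \<open>1 + y k \<ge> 1\<close>. As \<open>J\<close> is not empty, at least one factor
  \<open>\<theta>\<close> arises.\<close>

lemma weight_nbrs_le:
  fixes p y :: "nat \<Rightarrow> real"
  assumes p: "\<And>j. j \<in> K \<Longrightarrow> 0 \<le> p j" and y: "\<And>j. j \<in> K \<Longrightarrow> 0 \<le> y j"
    and lll: "\<And>j. j \<in> K \<Longrightarrow> p j * (\<Prod>k\<in>set (G j). 1 + y k) \<le> \<theta> * y j"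
    and \<theta>: "0 \<le> \<theta>" "\<theta> \<le> 1"
    and J: "set J \<subseteq> K" "J \<noteq> []"
  shows "weight p J * (\<Prod>k\<leftarrow>nbrs J. 1 + y k) \<le> \<theta> * weight y J"
proof -
  have eq: "(\<Prod>k\<leftarrow>nbrs J. 1 + y k) = (\<Prod>k\<in>(\<Union>j\<in>set J. set (G j)). 1 + y k)" for J
    unfolding nbrs_def by (subst prod.distinct_set_conv_list[symmetric]) auto
  have G: "k \<in> K" if "k \<in> set (G j)" "j \<in> K" for j k
    using that set_G by auto
  have "weight p J * (\<Prod>k\<in>(\<Union>j\<in>set J. set (G j)). 1 + y k) \<le> \<theta> ^ length J * weight y J"
    using J(1)
  proof (induction J)
    case (Cons j J)
    let ?A = "set (G j)" and ?B = "\<Union>j\<in>set J. set (G j)"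
    have AB: "k \<in> K" if "k \<in> ?A \<union> ?B" for k using that Cons.prems G by auto
    have ge1: "1 \<le> (\<Prod>k\<in>?A \<inter> ?B. 1 + y k)"
      by (rule prod_ge_1) (use AB y in auto)
    have nn: "0 \<le> (\<Prod>k\<in>X. 1 + y k)" if "X \<subseteq> ?A \<union> ?B" for X
      by (rule prod_nonneg) (use that AB y in \<open>auto intro!: add_nonneg_nonneg\<close>)
    have "(\<Prod>k\<in>?A \<union> ?B. 1 + y k) \<le> (\<Prod>k\<in>?A \<union> ?B. 1 + y k) * (\<Prod>k\<in>?A \<inter> ?B. 1 + y k)"
      using ge1 nn[of "?A \<union> ?B"] by (simp add: mult_le_cancel_left1)
    also have "\<dots> = (\<Prod>k\<in>?A. 1 + y k) * (\<Prod>k\<in>?B. 1 + y k)"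
      by (rule prod.union_inter) auto
    finally have "weight p (j # J) * (\<Prod>k\<in>?A \<union> ?B. 1 + y k) \<le>
        weight p (j # J) * ((\<Prod>k\<in>?A. 1 + y k) * (\<Prod>k\<in>?B. 1 + y k))"
      using Cons.prems p by (intro mult_left_mono prod_list_nonneg') auto
    also have "\<dots> = (p j * (\<Prod>k\<in>?A. 1 + y k)) * (weight p J * (\<Prod>k\<in>?B. 1 + y k))" by simp
    also have "\<dots> \<le> (\<theta> * y j) * (\<theta> ^ length J * weight y J)"
    proof (rule mult_mono)
      show "p j * (\<Prod>k\<in>?A. 1 + y k) \<le> \<theta> * y j" using lll Cons.prems by simp
      show "weight p J * (\<Prod>k\<in>?B. 1 + y k) \<le> \<theta> ^ length J * weight y J"
        using Cons by simp
      show "0 \<le> \<theta> * y j" using \<theta> y Cons.prems by simp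
      show "0 \<le> weight p J * (\<Prod>k\<in>?B. 1 + y k)"
        using nn[of ?B] Cons.prems p by (intro mult_nonneg_nonneg prod_list_nonneg') auto
    qed
    finally show ?case by (simp add: algebra_simps)
  qed simp
  also have "\<dots> \<le> \<theta> ^ 1 * weight y J"
    using J y \<theta> by (intro mult_right_mono power_decreasing prod_list_nonneg') (auto simp: Suc_le_eq)
  finally show ?thesis by (simp add: eq)
qed

lemma set_subseqs_subset: "J \<in> set (List.subseqs xs) \<Longrightarrow> set J \<subseteq> set xs"
  using subseqs_powset[of xs] by (metis Pow_iff image_eqI)

lemma witnesses_props:
  assumes "s \<in> set (witnesses d [b])" "b \<in> K"
  shows "s \<noteq> [] \<and> \<Union>(set ` set s) \<subseteq> K \<and> (\<forall>J\<in>set s. J \<noteq> [] \<and> distinct J) \<and> length s = Suc d"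
  using assms(1)
proof (induction d arbitrary: s)
  case (Suc d)
  then obtain t J where s: "s = J # t" "t \<in> set (witnesses d [b])" "J \<noteq> []"
    "J \<in> set (List.subseqs (nbrs (hd t)))" by auto
  note IH = Suc.IH[OF s(2)]
  have "distinct J" using subseqs_distinctD[OF s(4)] by (simp add: nbrs_def)
  moreover have "set J \<subseteq> set (nbrs (hd t))" using s(4) by (rule set_subseqs_subset)
  moreover have "set (nbrs (hd t)) \<subseteq> K" using IH by (intro nbrs_subset_K) (auto simp: neq_Nil_conv)
  ultimately show ?case using IH s by auto
qed (use assms(2) in auto)

lemma sum_list_concat_map: "sum_list (map f (concat xss)) = (\<Sum>xs\<leftarrow>xss. sum_list (map f xs) :: real)"
  by (induction xss) auto

lemma sum_witnesses_le:
  fixes p y :: "nat \<Rightarrow> real"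
  assumes p: "\<And>j. j \<in> K \<Longrightarrow> 0 \<le> p j" and y: "\<And>j. j \<in> K \<Longrightarrow> 0 \<le> y j"
    and lll: "\<And>j. j \<in> K \<Longrightarrow> p j * (\<Prod>k\<in>set (G j). 1 + y k) \<le> \<theta> * y j"
    and \<theta>: "0 \<le> \<theta>" "\<theta> \<le> 1" and b: "b \<in> K"
  shows "(\<Sum>s\<leftarrow>witnesses d [b]. \<Prod>J\<leftarrow>s. weight p J) \<le> \<theta> ^ d * y b"
proof -
  \<comment> \<open>In \<open>?v\<close> the oldest layer carries the weight \<open>y\<close>
    instead of \<open>p\<close>. Summing \<open>y\<close> over all candidates for a new layer gives
    the product of \<open>1 + y k\<close> over the neighbours; by \<open>weight_nbrs_le\<close> this
    product times the weight \<open>p\<close> of the former oldest layer is at most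
    \<open>\<theta>\<close> times its weight \<open>y\<close>. So each layer gains a factor
    \<open>\<theta>\<close>.\<close>
  let ?v = "\<lambda>s. weight y (hd s) * (\<Prod>J\<leftarrow>tl s. weight p J)"
  have le: "weight p I * (\<Prod>k\<leftarrow>nbrs I. 1 + y k) \<le> \<theta> * weight y I" if "set I \<subseteq> K" "I \<noteq> []" for I
    by (rule weight_nbrs_le[OF _ _ _ \<theta>]) (use p y lll that in auto)
  have nn: "0 \<le> weight y J" "0 \<le> weight p J" if "set J \<subseteq> K" for J
    using that p y by (auto intro!: prod_list_nonneg')
  have main: "(\<Sum>s\<leftarrow>witnesses d [b]. ?v s) \<le> \<theta> ^ d * y b"
  proof (induction d)
    case (Suc d)
    have step: "(\<Sum>J\<leftarrow>filter (\<lambda>J. J \<noteq> []) (List.subseqs (nbrs (hd s))). ?v (J # s)) \<le> \<theta> * ?v s"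
      if s: "s \<in> set (witnesses d [b])" for s
    proof -
      note props = witnesses_props[OF s b]
      obtain I t where I: "s = I # t" using props by (cases s) auto
      have K: "set I \<subseteq> K" "I \<noteq> []" using props I by auto
      have t: "0 \<le> (\<Prod>J\<leftarrow>t. weight p J)"
        using props I by (intro prod_list_nonneg' nn) auto
      have sK: "set J \<subseteq> K" if "J \<in> set (List.subseqs (nbrs I))" for J
        using set_subseqs_subset[OF that] nbrs_subset_K[OF K(1)] by (rule order_trans)
      have "(\<Sum>J\<leftarrow>filter (\<lambda>J. J \<noteq> []) (List.subseqs (nbrs I)). weight y J) \<le>
          (\<Sum>J\<leftarrow>List.subseqs (nbrs I). weight y J)"
        unfolding sum_list_map_filter' using sK nn by (intro sum_list_mono) auto
      also have "\<dots> = (\<Prod>k\<leftarrow>nbrs I. 1 + y k)" by (rule sum_subseqs)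
      finally have "(\<Sum>J\<leftarrow>filter (\<lambda>J. J \<noteq> []) (List.subseqs (nbrs I)). weight y J) *
          (weight p I * (\<Prod>J\<leftarrow>t. weight p J)) \<le>
          (\<Prod>k\<leftarrow>nbrs I. 1 + y k) * (weight p I * (\<Prod>J\<leftarrow>t. weight p J))"
        using t nn K by (intro mult_right_mono) auto
      also have "\<dots> = (weight p I * (\<Prod>k\<leftarrow>nbrs I. 1 + y k)) * (\<Prod>J\<leftarrow>t. weight p J)" by simp
      also have "\<dots> \<le> (\<theta> * weight y I) * (\<Prod>J\<leftarrow>t. weight p J)"
        using le[OF K] t by (intro mult_right_mono)
      finally show ?thesis by (simp add: I sum_list_mult_const mult.assoc)
    qed
    have "(\<Sum>s\<leftarrow>witnesses (Suc d) [b]. ?v s) =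
        (\<Sum>s\<leftarrow>witnesses d [b]. \<Sum>J\<leftarrow>filter (\<lambda>J. J \<noteq> []) (List.subseqs (nbrs (hd s))). ?v (J # s))"
      by (simp add: sum_list_concat_map comp_def)
    also have "\<dots> \<le> (\<Sum>s\<leftarrow>witnesses d [b]. \<theta> * ?v s)"
      by (intro sum_list_mono step)
    also have "\<dots> = \<theta> * (\<Sum>s\<leftarrow>witnesses d [b]. ?v s)" by (simp add: sum_list_const_mult)
    also have "\<dots> \<le> \<theta> * (\<theta> ^ d * y b)" using Suc \<theta> by (intro mult_left_mono)
    finally show ?case by simp
  qed simp
  have "(\<Sum>s\<leftarrow>witnesses d [b]. \<Prod>J\<leftarrow>s. weight p J) \<le> (\<Sum>s\<leftarrow>witnesses d [b]. ?v s)"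
  proof (rule sum_list_mono)
    fix s assume s: "s \<in> set (witnesses d [b])"
    note props = witnesses_props[OF s b]
    obtain I t where I: "s = I # t" using props by (cases s) auto
    have K: "set I \<subseteq> K" "I \<noteq> []" using props I by auto
    have t: "0 \<le> (\<Prod>J\<leftarrow>t. weight p J)"
      using props I by (intro prod_list_nonneg' nn) auto
    have "1 \<le> (\<Prod>k\<leftarrow>nbrs I. 1 + y k)"
      unfolding nbrs_def using y nbrs_subset_K[OF K(1)]
      by (subst prod.distinct_set_conv_list[symmetric]) (auto intro!: prod_ge_1 simp: nbrs_def)
    then have "weight p I \<le> weight p I * (\<Prod>k\<leftarrow>nbrs I. 1 + y k)"
      using nn(2)[OF K(1)] by (simp add: mult_le_cancel_left1)
    also have "\<dots> \<le> \<theta> * weight y I" by (rule le[OF K])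
    also have "\<dots> \<le> weight y I" using nn(1)[OF K(1)] \<theta> by (simp add: mult_left_le_one_le)
    finally show "(\<Prod>J\<leftarrow>s. weight p J) \<le> ?v s"
      using t by (simp add: I mult_right_mono)
  qed
  with main show ?thesis by linarith
qed

end

subsection \<open>Probabilities of witnesses\<close>

text \<open>All samples of a variable will have the same distribution, so the bound can be demanded
  for every choice \<open>f\<close> of sample numbers.\<close>

locale event_table = event_system + random_table +
  fixes p :: "nat \<Rightarrow> real"
  assumes prob_occurs: "j \<in> K \<Longrightarrow> prob {r. occurs j (\<lambda>i. r (prod_encode (i, f i)))} \<le> p j"
begin

definition layer_occurs :: "(nat \<Rightarrow> nat) \<Rightarrow> nat list \<Rightarrow> (nat \<Rightarrow> nat) \<Rightarrow> bool" where
  "layer_occurs f J r \<longleftrightarrow> (\<forall>j\<in>set J. occurs j (\<lambda>i. r (prod_encode (i, f i))))"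

lemma p_nonneg: "j \<in> K \<Longrightarrow> 0 \<le> p j"
  using prob_occurs[of j undefined] measure_nonneg order_trans by blast

lemma depends_on_occurs:
  "depends_on (\<lambda>r. occurs j (\<lambda>i. r (prod_encode (i, f i)))) ((\<lambda>i. prod_encode (i, f i)) ` set (V j))"
  unfolding depends_on_def by (auto intro!: occurs_cong)

lemma depends_on_layer:
  "depends_on (layer_occurs f J) ((\<lambda>i. prod_encode (i, f i)) ` vars J)"
  unfolding layer_occurs_def
  using depends_on_mono[OF depends_on_occurs[of _ f], of _ "(\<lambda>i. prod_encode (i, f i)) ` vars J"]
  unfolding depends_on_def vars_def by blast

lemma finite_vars [simp]: "finite (vars J)"
  by (simp add: vars_def)

lemma prob_layer:
  assumes "set J \<subseteq> K" "distinct J"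
    "\<forall>j\<in>set J. \<forall>k\<in>set J. j \<noteq> k \<longrightarrow> set (V j) \<inter> set (V k) = {}"
  shows "prob {r. layer_occurs f J r} \<le> weight p J"
  using assms
proof (induction J)
  case Nil
  then show ?case by (simp add: layer_occurs_def)
next
  case (Cons j J)
  have eq: "{r. layer_occurs f (j # J) r} =
      {r. occurs j (\<lambda>i. r (prod_encode (i, f i))) \<and> layer_occurs f J r}"
    by (auto simp: layer_occurs_def)
  have disj: "(\<lambda>i. prod_encode (i, f i)) ` set (V j) \<inter> (\<lambda>i. prod_encode (i, f i)) ` vars J = {}"
    using Cons.prems by (fastforce simp: vars_def)
  have "prob {r. layer_occurs f (j # J) r} =
      prob {r. occurs j (\<lambda>i. r (prod_encode (i, f i)))} * prob {r. layer_occurs f J r}"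
    unfolding eq by (rule prob_conj_disjoint[OF _ _ disj depends_on_occurs depends_on_layer]) simp_all
  also have "\<dots> \<le> p j * weight p J"
    using Cons prob_occurs[of j f] p_nonneg[of j] by (intro mult_mono) auto
  finally show ?case by simp
qed

text \<open>Each layer advances a counter by at most one, which bounds \<open>c\<close> from above.
  The lower bound keeps later layers away from entries already read.\<close>

lemma depends_on_consistent:
  "depends_on (\<lambda>r. consistent r f s)
    {prod_encode (i, c) |i c. i \<in> \<Union>(vars ` set s) \<and> f i \<le> c \<and> c < f i + length s}"
proof (induction s arbitrary: f)
  case Nil
  show ?case by (simp add: depends_on_def)
next
  case (Cons J s)
  let ?S = "\<lambda>f s. {prod_encode (i, c) |i c. i \<in> \<Union>(vars ` set s) \<and> f i \<le> c \<and> c < f i + length s}"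
  let ?g = "\<lambda>i. f i + of_bool (i \<in> vars J)"
  have "?S ?g s \<subseteq> ?S f (J # s)"
  proof
    fix x assume "x \<in> ?S ?g s"
    then obtain i c where "x = prod_encode (i, c)" "i \<in> \<Union>(vars ` set s)" "?g i \<le> c" "c < ?g i + length s"
      by blast
    moreover have "of_bool (i \<in> vars J) \<le> (1 :: nat)" by simp
    ultimately show "x \<in> ?S f (J # s)" by fastforce
  qed
  then have "depends_on (\<lambda>r. consistent r ?g s) (?S f (J # s))"
    by (rule depends_on_mono[OF Cons])
  moreover have "(\<lambda>i. prod_encode (i, f i)) ` vars J \<subseteq> ?S f (J # s)" by auto
  then have "depends_on (layer_occurs f J) (?S f (J # s))"
    by (rule depends_on_mono[OF depends_on_layer])
  ultimately have "depends_on (\<lambda>r. layer_occurs f J r \<and> consistent r ?g s) (?S f (J # s))"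
    by (rule depends_on_conj[rotated])
  then show ?case by (simp only: consistent.simps layer_occurs_def)
qed

lemma finite_consistent_entries:
  "finite {prod_encode (i, c) |i c. i \<in> \<Union>(vars ` set s) \<and> f i \<le> c \<and> c < f i + length s}"
proof -
  have "{prod_encode (i, c) |i c. i \<in> \<Union>(vars ` set s) \<and> f i \<le> c \<and> c < f i + length s} =
      prod_encode ` (SIGMA i:\<Union>(vars ` set s). {f i..<f i + length s})"
    by auto
  then show ?thesis by simp
qed

text \<open>The first layer reads sample \<open>f i\<close> of its variables \<open>i\<close>, and
  later layers read these variables only from \<open>f i + 1\<close> on, so the two parts are
  independent.\<close>

lemma prob_consistent:
  assumes "\<Union>(set ` set s) \<subseteq> K" "\<forall>J\<in>set s. distinct J" "proper s"
  shows "prob {r. consistent r f s} \<le> (\<Prod>J\<leftarrow>s. weight p J)"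
  using assms
proof (induction s arbitrary: f)
  case (Cons J s)
  let ?g = "\<lambda>i. f i + of_bool (i \<in> vars J)"
  have eq: "{r. consistent r f (J # s)} = {r. layer_occurs f J r \<and> consistent r ?g s}"
    by (simp add: layer_occurs_def)
  have "prob {r. consistent r f (J # s)} = prob {r. layer_occurs f J r} * prob {r. consistent r ?g s}"
    unfolding eq
    by (rule prob_conj_disjoint[OF _ finite_consistent_entries[where f = ?g] _ depends_on_layer depends_on_consistent]) auto
  also have "\<dots> \<le> weight p J * (\<Prod>J\<leftarrow>s. weight p J)"
  proof (rule mult_mono)
    show "prob {r. layer_occurs f J r} \<le> weight p J"
      using Cons.prems by (intro prob_layer) (auto simp: proper_def)
    show "prob {r. consistent r ?g s} \<le> (\<Prod>J\<leftarrow>s. weight p J)"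
      using Cons by (auto simp: proper_def)
    show "0 \<le> weight p J" using Cons.prems p_nonneg by (intro prod_list_nonneg') auto
  qed simp
  finally show ?case by simp
qed simp

lemma events_consistent: "{r. consistent r f s} \<in> events"
  by (rule events_depends_on[OF finite_consistent_entries depends_on_consistent])

lemma prob_witnesses_le:
  fixes y :: "nat \<Rightarrow> real"
  assumes y: "\<And>j. j \<in> K \<Longrightarrow> 0 \<le> y j"
    and lll: "\<And>j. j \<in> K \<Longrightarrow> p j * (\<Prod>k\<in>set (G j). 1 + y k) \<le> \<theta> * y j"
    and \<theta>: "0 \<le> \<theta>" "\<theta> \<le> 1" and b: "b \<in> K"
  shows "prob {r. \<exists>s\<in>set (witnesses d [b]). proper s \<and> consistent r f s} \<le> \<theta> ^ d * y b"
proof -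
  have union: "prob {r. \<exists>s\<in>set ss. proper s \<and> consistent r f s} \<le>
      (\<Sum>s\<leftarrow>ss. prob {r. proper s \<and> consistent r f s})" for ss
  proof (induction ss)
    case (Cons s ss)
    have ev: "{r. proper s \<and> consistent r f s} \<in> events" for s
      using events_consistent by (cases "proper s") auto
    have ev': "{r. \<exists>s\<in>set ss. proper s \<and> consistent r f s} \<in> events"
    proof -
      have "{r. \<exists>s\<in>set ss. proper s \<and> consistent r f s} = (\<Union>s\<in>set ss. {r. proper s \<and> consistent r f s})"
        by auto
      then show ?thesis using ev by auto
    qed
    have "{r. \<exists>s'\<in>set (s # ss). proper s' \<and> consistent r f s'} =
        {r. proper s \<and> consistent r f s} \<union> {r. \<exists>s\<in>set ss. proper s \<and> consistent r f s}" by auto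
    then have "prob {r. \<exists>s'\<in>set (s # ss). proper s' \<and> consistent r f s'} \<le>
        prob {r. proper s \<and> consistent r f s} + prob {r. \<exists>s\<in>set ss. proper s \<and> consistent r f s}"
      using measure_subadditive[OF ev ev'] by simp
    with Cons show ?case by simp
  qed simp
  also have "(\<Sum>s\<leftarrow>witnesses d [b]. prob {r. proper s \<and> consistent r f s}) \<le>
      (\<Sum>s\<leftarrow>witnesses d [b]. \<Prod>J\<leftarrow>s. weight p J)"
  proof (rule sum_list_mono)
    fix s assume s: "s \<in> set (witnesses d [b])"
    note props = witnesses_props[OF s b]
    show "prob {r. proper s \<and> consistent r f s} \<le> (\<Prod>J\<leftarrow>s. weight p J)"
    proof (cases "proper s")
      case True
      then show ?thesis using prob_consistent[of s f] props by simp
    next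
      case False
      have "0 \<le> (\<Prod>J\<leftarrow>s. weight p J)"
        using props p_nonneg by (intro prod_list_nonneg') auto
      with False show ?thesis by simp
    qed
  qed
  also have "\<dots> \<le> \<theta> ^ d * y b"
    by (rule sum_witnesses_le[OF p_nonneg y lll \<theta> b])
  finally show ?thesis .
qed

end

section \<open>Running the resampling algorithm\<close>

context event_system
begin

definition state :: "(nat \<Rightarrow> nat) \<Rightarrow> nat list \<Rightarrow> nat \<Rightarrow> nat" where
  "state r L i = r (prod_encode (i, count_var L i))"

text \<open>With a schedule fixed in advance each step tests a single event; whether any of
  infinitely many events occurs never has to be decided.\<close>

primrec run :: "(nat \<Rightarrow> nat) \<Rightarrow> (nat \<Rightarrow> nat) \<Rightarrow> nat \<Rightarrow> nat list" where
  "run r \<sigma> 0 = []"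
| "run r \<sigma> (Suc t) = (if occurs (\<sigma> t) (state r (run r \<sigma> t)) then \<sigma> t # run r \<sigma> t else run r \<sigma> t)"

text \<open>The ball of radius \<open>n\<close> around \<open>J\<close> in the graph that joins
  events with a common variable.\<close>

primrec surrounding :: "nat \<Rightarrow> nat list \<Rightarrow> nat list" where
  "surrounding 0 J = J"
| "surrounding (Suc n) J = surrounding n J @ nbrs (surrounding n J)"

lemma legal_Cons_state: "legal r (b # L) \<longleftrightarrow> legal r L \<and> b \<in> K \<and> occurs b (state r L)"
  by (simp add: state_def[abs_def])

lemma legal_append: "legal r (u @ L) \<Longrightarrow> legal r L"
  by (induction u) auto

lemma legal_subset: "legal r L \<Longrightarrow> set L \<subseteq> K"
  by (induction L) auto

lemma legal_V: "legal r L \<Longrightarrow> b \<in> set L \<Longrightarrow> V b \<noteq> []"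
  by (induction L) (auto simp: occurs_def R_Nil)

text \<open>An event with variables shares them with itself, so its own resamplings form a
  chain.\<close>

lemma chain_count_list: "V b \<noteq> [] \<Longrightarrow> count_list L b = n \<Longrightarrow> chain n b L"
proof (induction n arbitrary: L)
  case (Suc n)
  then have "b \<in> set L" by (metis count_notin nat.distinct(1))
  then obtain u L' where L: "L = u @ b # L'" "b \<notin> set u" by (metis split_list_first)
  with Suc.prems have "chain n b L'" by (intro Suc.IH) simp_all
  moreover have "set (V b) \<inter> set (V b) \<noteq> {}" using Suc.prems by simp
  ultimately show ?case unfolding chain.simps L(1) by blast
qed simp

lemma surrounding_mono: "m \<le> n \<Longrightarrow> set (surrounding m J) \<subseteq> set (surrounding n J)"
  by (induction rule: dec_induct) auto

lemma surrounding_subset: "set J \<subseteq> K \<Longrightarrow> set (surrounding n J) \<subseteq> K"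
  by (induction n) (auto dest: nbrs_subset_K)

text \<open>A single event containing variable \<open>i\<close> has all the others in its finite
  neighbour list.\<close>

lemma finite_containing: "finite {b \<in> K. i \<in> set (V b)}"
proof (cases "{b \<in> K. i \<in> set (V b)} = {}")
  case False
  then obtain b where "b \<in> K" "i \<in> set (V b)" by auto
  then have "{b \<in> K. i \<in> set (V b)} \<subseteq> set (G b)" by (auto simp: set_G)
  then show ?thesis by (rule finite_subset) simp
qed (simp only: finite.emptyI)

text \<open>
  Events of a region that is quiet in \<open>L\<close> can only be resampled later because of a chain of
  resamplings that enters the region from outside.
\<close>

lemma chain_from_outside:
  assumes J: "set J \<subseteq> K" and quiet: "\<forall>b\<in>set (surrounding m J). \<not> occurs b (state r L)"
    and "legal r (b # u @ L)" "b \<in> set (surrounding k J)" "k + n = m"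
  shows "chain n b (u @ L)"
  using assms(3-)
proof (induction n arbitrary: b u k)
  case (Suc n)
  have "b \<in> set (surrounding m J)" using surrounding_mono[of k m J] Suc.prems by auto
  with quiet have "\<not> occurs b (state r L)" by blast
  moreover have b: "occurs b (state r (u @ L))" "b \<in> K"
    using Suc.prems(1) by (auto simp only: legal_Cons_state)
  \<comment> \<open>Since \<open>b\<close> came to occur after \<open>L\<close>, one of its
    variables was resampled in \<open>u\<close>, by an event \<open>b'\<close> at most one step
    further from \<open>J\<close>. This extends the chain until the radius \<open>m\<close> is used
    up.\<close>
  ultimately obtain i where i: "i \<in> set (V b)" "state r (u @ L) i \<noteq> state r L i"
    using occurs_cong by blast
  have "count_var u i \<noteq> 0"
  proof
    assume "count_var u i = 0"
    with i(2) show False by (simp add: state_def)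
  qed
  then obtain b' where "b' \<in> set u" "i \<in> set (V b')"
    by (auto simp: count_var_def filter_empty_conv)
  then obtain u1 u2 where u: "u = u1 @ b' # u2" by (metis split_list)
  have leg: "legal r (b' # u2 @ L)"
    using Suc.prems(1) legal_append[of r "b # u1" "b' # u2 @ L"] by (simp add: u)
  then have "b' \<in> K" by simp
  have sub: "set (surrounding k J) \<subseteq> K" by (rule surrounding_subset[OF J])
  have "touches b' (surrounding k J)"
    using \<open>i \<in> set (V b')\<close> i(1) Suc.prems(2) by (auto simp: touches_def)
  then have "b' \<in> set (surrounding (Suc k) J)"
    using mem_nbrs[OF _ sub \<open>b' \<in> K\<close>] by simp
  then have "chain n b' (u2 @ L)"
    by (rule Suc.IH[OF leg]) (use Suc.prems(3) in simp)
  moreover have "u @ L = u1 @ b' # (u2 @ L)" by (simp add: u)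
  moreover have "set (V b') \<inter> set (V b) \<noteq> {}" using i(1) \<open>i \<in> set (V b')\<close> by auto
  ultimately show ?case unfolding chain.simps by blast
qed simp

end

text \<open>\<open>bound\<close> is all that remains of the probabilistic part: the table
  \<open>r\<close> is fixed and the rest is combinatorial.\<close>

locale resampling = event_system +
  fixes r :: "nat \<Rightarrow> nat" and \<sigma> :: "nat \<Rightarrow> nat" and \<beta> :: "nat \<Rightarrow> nat"
  assumes bound: "legal r (b # L) \<Longrightarrow> chain n b L \<Longrightarrow> n < \<beta> b"
    and \<sigma>_K: "\<sigma> t \<in> K" and \<sigma>_fair: "b \<in> K \<Longrightarrow> \<exists>t\<ge>T. \<sigma> t = b"
begin

abbreviation log :: "nat \<Rightarrow> nat list" where "log \<equiv> run r \<sigma>"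

lemma legal_log: "legal r (log t)"
  by (induction t) (auto simp: \<sigma>_K legal_Cons_state simp del: legal.simps(2))

lemma log_extends: "t \<le> t' \<Longrightarrow> \<exists>u. log t' = u @ log t"
proof (induction rule: dec_induct)
  case (step n)
  then obtain u where "log n = u @ log t" by blast
  then show ?case by (cases "occurs (\<sigma> n) (state r (log n))") auto
qed simp

lemma count_list_le: "legal r L \<Longrightarrow> count_list L b \<le> \<beta> b"
proof (cases "count_list L b")
  case (Suc n)
  assume L: "legal r L"
  from Suc have "b \<in> set L" by (metis count_notin nat.distinct(1))
  then obtain u L' where u: "L = u @ b # L'" "b \<notin> set u" by (metis split_list_first)
  then have "count_list L' b = n" using Suc by simp
  then have "chain n b L'" using chain_count_list[of b L'] legal_V[OF L \<open>b \<in> set L\<close>] by simp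
  moreover have "legal r (b # L')" using legal_append L u by blast
  \<comment> \<open>The most recent resampling of \<open>b\<close> is not counted in the length
    \<open>n\<close> of the chain, so \<open>n < \<beta> b\<close> gives
    \<open>Suc n \<le> \<beta> b\<close>.\<close>
  ultimately show ?thesis using bound[of b L' n] Suc by simp
qed simp

lemma count_var_mono: "t \<le> t' \<Longrightarrow> count_var (log t) i \<le> count_var (log t') i"
  using log_extends[of t t'] by auto

lemma count_var_le: "legal r L \<Longrightarrow> count_var L i \<le> (\<Sum>b\<in>{b \<in> K. i \<in> set (V b)}. \<beta> b)"
proof -
  assume L: "legal r L"
  let ?B = "{b \<in> K. i \<in> set (V b)}"
  have "count_var L i = (\<Sum>b\<in>?B. count_list L b)" if "set L \<subseteq> K" for L
    using that
  proof (induction L)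
    case (Cons b L)
    have "(\<Sum>k\<in>?B. if b = k then count_list L k + 1 else count_list L k) =
        (\<Sum>k\<in>?B. count_list L k) + (\<Sum>k\<in>?B. if b = k then 1 else 0)"
      unfolding sum.distrib[symmetric] by (intro sum.cong) auto
    moreover have "(\<Sum>k\<in>?B. if b = k then 1 else 0) = (of_bool (i \<in> set (V b)) :: nat)"
      using finite_containing Cons.prems by (subst sum.delta') auto
    ultimately show ?case using Cons by simp
  qed simp
  from this[OF legal_subset[OF L]] show ?thesis
    using count_list_le[OF L] by (auto intro!: sum_mono)
qed

lemma count_var_stable: "\<exists>T. \<forall>t\<ge>T. count_var (log t) i = count_var (log T) i"
proof -
  let ?N = "\<Sum>b\<in>{b \<in> K. i \<in> set (V b)}. \<beta> b"
  obtain T where "\<forall>t. count_var (log t) i \<le> count_var (log T) i"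
    using ex_has_greatest_nat[of "\<lambda>_. True" 0 "\<lambda>t. count_var (log t) i" "Suc ?N"]
      count_var_le[OF legal_log] by (auto simp: less_Suc_eq_le)
  then show ?thesis using count_var_mono by (metis order_antisym)
qed

text \<open>By fairness, an occurring event would be visited while its variables still have the same
  samples; its resampling would then move their counters.\<close>

lemma not_occurs_stable:
  assumes "b \<in> K" and stable: "\<And>i t. i \<in> set (V b) \<Longrightarrow> T \<le> t \<Longrightarrow> count_var (log t) i = count_var (log T) i"
  shows "\<not> occurs b (state r (log T))"
proof
  assume occ: "occurs b (state r (log T))"
  obtain t where t: "T \<le> t" "\<sigma> t = b" using \<sigma>_fair[OF assms(1)] by blast
  have "occurs b (state r (log t)) = occurs b (state r (log T))"
    by (rule occurs_cong) (simp add: state_def stable[OF _ t(1)])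
  with occ t have log: "log (Suc t) = b # log t" by simp
  have "V b \<noteq> []" using occ R_Nil by (auto simp: occurs_def)
  then obtain i where i: "i \<in> set (V b)" by (meson last_in_set)
  have "count_var (b # log t) i = count_var (log t) i"
    using stable[OF i, of t] stable[OF i, of "Suc t"] t(1) unfolding log[symmetric] by (metis le_SucI)
  then show False using i by simp
qed

lemma eventually_quiet: "set J \<subseteq> K \<Longrightarrow> \<exists>T. \<forall>b\<in>set J. \<not> occurs b (state r (log T))"
proof -
  assume J: "set J \<subseteq> K"
  obtain T where T: "\<And>i t. T i \<le> t \<Longrightarrow> count_var (log t) i = count_var (log (T i)) i"
    using count_var_stable by metis
  define T' where "T' = (\<Sum>i\<in>vars J. T i)"
  have le: "T i \<le> T'" if "i \<in> vars J" for i
    unfolding T'_def by (rule member_le_sum) (use that in \<open>auto simp: vars_def\<close>)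
  have "\<not> occurs b (state r (log T'))" if b: "b \<in> set J" for b
  proof (rule not_occurs_stable)
    fix i t assume i: "i \<in> set (V b)" "T' \<le> t"
    then have "T i \<le> T'" using le b by (auto simp: vars_def)
    with i(2) T[of i t] T[of i T'] show "count_var (log t) i = count_var (log T') i" by simp
  qed (use J b in auto)
  then show ?thesis by blast
qed

lemma quiet_imp_stable:
  assumes J: "set J = {b \<in> K. i \<in> set (V b)}" and m: "\<And>b. b \<in> set J \<Longrightarrow> \<beta> b \<le> m"
    and quiet: "\<forall>b\<in>set (surrounding m J). \<not> occurs b (state r (log T))" and "T \<le> t"
  shows "count_var (log t) i = count_var (log T) i"
proof (rule ccontr)
  assume *: "\<not> ?thesis"
  obtain u where u: "log t = u @ log T" using log_extends[OF \<open>T \<le> t\<close>] by blast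
  with * have "count_var u i \<noteq> 0" by simp
  then obtain b where b: "b \<in> set u" "i \<in> set (V b)"
    by (auto simp: count_var_def filter_empty_conv)
  then obtain u1 u2 where u': "u = u1 @ b # u2" by (metis split_list)
  then have leg: "legal r (b # u2 @ log T)"
    using legal_append[of r u1 "b # u2 @ log T"] legal_log[of t] by (simp add: u)
  then have "b \<in> set J" using b J by simp
  \<comment> \<open>Since \<open>b\<close> lies in \<open>J\<close>, at radius \<open>0\<close>, the
    full radius \<open>m\<close> becomes a chain of length \<open>m\<close>, which
    \<open>\<beta> b \<le> m\<close> forbids.\<close>
  then have "chain m b (u2 @ log T)"
    using J by (intro chain_from_outside[OF _ quiet leg, of 0]) auto
  from bound[OF leg this] m[OF \<open>b \<in> set J\<close>] show False by simp
qed

text \<open>Stability concerns all later times, but quietness of a finite ball at one time can be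
  tested. The first quiet time already fixes the final sample of variable \<open>i\<close>.\<close>

lemma limit_avoids:
  assumes inc: "\<And>i. set (inc i) = {b \<in> K. i \<in> set (V b)}"
  defines "Q \<equiv> \<lambda>i T. \<forall>b\<in>set (surrounding (\<Sum>b\<leftarrow>inc i. \<beta> b) (inc i)). \<not> occurs b (state r (log T))"
  defines "a \<equiv> \<lambda>i. state r (log (LEAST T. Q i T)) i"
  shows "\<exists>T. Q i T" and "b \<in> K \<Longrightarrow> \<not> occurs b a"
proof -
  show ex: "\<exists>T. Q i T" for i
    unfolding Q_def using inc by (intro eventually_quiet surrounding_subset) auto
  have stable: "count_var (log t) i = count_var (log (LEAST T. Q i T)) i"
    if "(LEAST T. Q i T) \<le> t" for i t
  proof (rule quiet_imp_stable[OF inc _ _ that])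
    show "\<forall>b\<in>set (surrounding (\<Sum>b\<leftarrow>inc i. \<beta> b) (inc i)). \<not> occurs b (state r (log (LEAST T. Q i T)))"
      using LeastI_ex[OF ex[of i]] unfolding Q_def .
  qed (auto intro: member_le_sum_list)
  assume b: "b \<in> K"
  \<comment> \<open>At this common time all variables of \<open>b\<close> have reached their final
    samples, so the state agrees with \<open>a\<close> on \<open>V b\<close>.\<close>
  define T where "T = (\<Sum>i\<leftarrow>V b. LEAST T. Q i T)"
  have T: "(LEAST T. Q i T) \<le> T" if "i \<in> set (V b)" for i
    unfolding T_def using that by (auto intro: member_le_sum_list)
  have "\<not> occurs b (state r (log T))"
  proof (rule not_occurs_stable[OF b])
    fix i t assume "i \<in> set (V b)" "T \<le> t"
    then show "count_var (log t) i = count_var (log T) i"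
      using T[of i] stable[of i t] stable[of i T] by simp
  qed
  moreover have "occurs b (state r (log T)) = occurs b a"
    by (rule occurs_cong) (simp add: a_def state_def stable[OF T])
  ultimately show "\<not> occurs b a" by simp
qed

end

section \<open>Effectiveness of the construction\<close>

locale effective_event_system = event_system +
  assumes eff_V: "effective V" and eff_R: "effective R" and eff_G: "effective G"
    and dec_K: "decidable (\<lambda>j. j \<in> K)"
begin

lemma eff_comp:
  "effective f \<Longrightarrow> effective (\<lambda>x. V (f x))"
  "effective f \<Longrightarrow> effective (\<lambda>x. R (f x))"
  "effective f \<Longrightarrow> effective (\<lambda>x. G (f x))"
  "effective f \<Longrightarrow> decidable (\<lambda>x. f x \<in> K)"
  by (rule effective_compose[OF eff_V] effective_compose[OF eff_R] effective_compose[OF eff_G]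
      decidable_compose[OF dec_K], assumption)+

lemma decidable_occurs:
  assumes "effective f" "effective (\<lambda>z. g (fst z) (snd z))"
  shows "decidable (\<lambda>x. occurs (f x) (g x))"
  unfolding occurs_def by (intro eff eff_comp assms)

lemma effective_nbrs: "effective f \<Longrightarrow> effective (\<lambda>x. nbrs (f x))"
  unfolding nbrs_def by (intro eff eff_comp)

lemma effective_count_var:
  assumes "effective f" "effective g" shows "effective (\<lambda>x. count_var (f x) (g x))"
  unfolding count_var_def by (intro eff eff_comp assms effective_compose[OF assms(2)])

lemma effective_surrounding:
  assumes "effective n" "effective f" shows "effective (\<lambda>x. surrounding (n x) (f x))"
proof -
  have "surrounding n J = rec_nat J (\<lambda>_ L. L @ nbrs L) n" for n J
    by (induction n) auto
  then show ?thesis by (simp only:) (intro eff effective_nbrs assms)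
qed

lemma effective_state:
  assumes "effective r" "effective f" "effective g"
  shows "effective (\<lambda>x. state r (f x) (g x))"
  unfolding state_def by (intro effective_compose[OF assms(1)] eff effective_count_var assms)

lemma effective_run:
  assumes "effective r" "effective \<sigma>" "effective f"
  shows "effective (\<lambda>x. run r \<sigma> (f x))"
proof -
  have "run r \<sigma> t = rec_nat [] (\<lambda>t L. if occurs (\<sigma> t) (state r L) then \<sigma> t # L else L) t" for t
    by (induction t) auto
  then show ?thesis
    by (simp only:) (intro eff decidable_occurs effective_state assms effective_compose[OF assms(2)])
qed

lemma effective_limit:
  assumes r: "effective r" and \<sigma>: "effective \<sigma>" and \<beta>: "effective \<beta>" and inc: "effective inc"
    and ex: "\<And>i. \<exists>T. \<forall>b\<in>set (surrounding (\<Sum>b\<leftarrow>inc i. \<beta> b) (inc i)). \<not> occurs b (state r (run r \<sigma> T))"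
  shows "effective (\<lambda>i. state r (run r \<sigma> (LEAST T.
    \<forall>b\<in>set (surrounding (\<Sum>b\<leftarrow>inc i. \<beta> b) (inc i)). \<not> occurs b (state r (run r \<sigma> T)))) i)"
  by (intro effective_state effective_run eff effective_surrounding decidable_occurs r \<sigma>
      effective_compose[OF \<beta>] effective_compose[OF inc] ex)

lemma effective_witnesses:
  assumes "effective n" "effective f" shows "effective (\<lambda>x. witnesses (n x) (f x))"
proof -
  \<comment> \<open>\<open>hd []\<close> is unspecified, so a case distinction replaces
    \<open>hd\<close>; the two agree on witnesses, which are never empty.\<close>
  have "witnesses d I = rec_nat [[I]] (\<lambda>_ W. concat (map (\<lambda>s. map (\<lambda>J. J # s)
      (filter (\<lambda>J. J \<noteq> []) (List.subseqs (nbrs (case s of [] \<Rightarrow> [] | J # _ \<Rightarrow> J))))) W)) d" for d I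
  proof (induction d)
    case (Suc d)
    have "s \<noteq> []" if "s \<in> set (witnesses e I)" for e s
      using that by (cases e) auto
    then have "hd s = (case s of [] \<Rightarrow> [] | J # _ \<Rightarrow> J)" if "s \<in> set (witnesses d I)" for s
      using that by (cases s) auto
    then have eq: "map (\<lambda>s. map (\<lambda>J. J # s) (filter (\<lambda>J. J \<noteq> []) (List.subseqs (nbrs (hd s))))) (witnesses d I) =
      map (\<lambda>s. map (\<lambda>J. J # s) (filter (\<lambda>J. J \<noteq> []) (List.subseqs (nbrs (case s of [] \<Rightarrow> [] | J # _ \<Rightarrow> J)))))
        (witnesses d I)"
      by (intro map_cong refl) simp
    show ?case unfolding witnesses.simps eq by (simp add: Suc.IH)
  qed simp
  then show ?thesis by (simp only:) (intro eff effective_nbrs assms)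
qed

lemma decidable_proper: assumes "effective f" shows "decidable (\<lambda>x. proper (f x))"
proof -
  have "proper s \<longleftrightarrow> (\<forall>J\<in>set s. \<forall>j\<in>set J. \<forall>k\<in>set J. j \<noteq> k \<longrightarrow> (\<forall>i\<in>set (V j). i \<notin> set (V k)))" for s
    unfolding proper_def by blast
  then show ?thesis by (simp only:) (intro eff eff_comp assms)
qed

text \<open>The recursion passes the counters as a function, which has no code. Counting the earlier
  layers that contain a variable replaces it, and only bounded quantifiers remain.\<close>

lemma consistent_iff:
  "consistent r f s \<longleftrightarrow> (\<forall>k<length s. \<forall>j\<in>set (case drop k s of [] \<Rightarrow> [] | J # _ \<Rightarrow> J).
    occurs j (\<lambda>i. r (prod_encode (i, f i + length (filter (\<lambda>J. \<exists>b\<in>set J. i \<in> set (V b)) (take k s))))))"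
proof (induction s arbitrary: f)
  case (Cons J s)
  have len: "length (if P then x # xs else xs) = of_bool P + length xs" for P x and xs :: "nat list list"
    by simp
  show ?case
    unfolding consistent.simps Cons.IH
    by (simp add: All_less_Suc2 vars_def add.assoc len) (simp add: Ball_def)
qed simp

lemma decidable_consistent:
  assumes "effective f" "effective g"
  shows "decidable (\<lambda>x. consistent (entry (f x)) (\<lambda>_. 0) (g x))"
  unfolding consistent_iff add_0
  by (intro eff eff_comp decidable_occurs effective_compose[OF assms(1)] effective_compose[OF assms(2)])

end

lemma in_concat_mapI: "x \<in> set xs \<Longrightarrow> y \<in> set (f x) \<Longrightarrow> y \<in> set (concat (map f xs))"
  by auto

locale effective_event_table = effective_event_system + event_table
begin

lemma computable_solution:
  fixes y :: "nat \<Rightarrow> real" and \<delta> :: "nat \<Rightarrow> nat \<Rightarrow> nat" and L :: "nat \<Rightarrow> nat \<Rightarrow> nat \<Rightarrow> nat"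
    and n \<sigma> :: "nat \<Rightarrow> nat" and inc :: "nat \<Rightarrow> nat list"
  assumes y: "\<And>j. j \<in> K \<Longrightarrow> 0 \<le> y j"
    and lll: "\<And>j. j \<in> K \<Longrightarrow> p j * (\<Prod>k\<in>set (G j). 1 + y k) \<le> \<theta> * y j"
    and \<theta>: "0 \<le> \<theta>" "\<theta> < 1"
    and \<delta>: "effective (\<lambda>z. \<delta> (fst z) (snd z))" "\<And>j J. J \<le> \<delta> j J"
      "\<And>j J. j \<in> K \<Longrightarrow> \<theta> ^ \<delta> j J * y j \<le> (1 - \<theta>) / 4 ^ Suc J"
    and n: "effective n" "AE r in T. \<forall>m. r m < n m"
    and L: "effective (\<lambda>z. L (fst z) (fst (snd z)) (snd (snd z)))"
      "\<And>k m v. real (L k m v) \<le> 2 ^ k * measure (D m) {v}"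
      "\<And>m v. (\<lambda>k. real (L k m v) / 2 ^ k) \<longlonglongrightarrow> measure (D m) {v}"
    and \<sigma>: "effective \<sigma>" "\<And>t. \<sigma> t \<in> K" "\<And>b t0. b \<in> K \<Longrightarrow> \<exists>t\<ge>t0. \<sigma> t = b"
    and inc: "effective inc" "\<And>i. set (inc i) = {b \<in> K. i \<in> set (V b)}"
  obtains a where "effective a" "\<And>i. \<exists>c. a i < n (prod_encode (i, c))" "\<And>b. b \<in> K \<Longrightarrow> \<not> occurs b a"
proof -
  define W where "W j d r \<longleftrightarrow> (\<exists>s\<in>set (witnesses d [j]). proper s \<and> consistent r (\<lambda>_. 0) s)"
    for j d and r :: "nat \<Rightarrow> nat"
  define U where "U J r \<longleftrightarrow> (\<exists>j<Suc J. j \<in> K \<and> (\<exists>d<\<delta> j (Suc J). \<delta> j J \<le> d \<and> W j d r))"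
    for J and r :: "nat \<Rightarrow> nat"
  \<comment> \<open>For fixed \<open>j\<close>, the intervals of depths treated in the stages \<open>J \<ge> j\<close> cover all depths from
    \<open>\<delta> j j\<close> on, since \<open>\<delta> j J\<close> tends to infinity with \<open>J\<close>.\<close>
  define entries where "entries J = concat (map (\<lambda>j. concat (map (\<lambda>d. concat (map (\<lambda>s.
      concat (map (\<lambda>i. map (\<lambda>c. prod_encode (i, c)) [0..<length s]) (concat (map V (concat s)))))
      (witnesses d [j]))) [0..<\<delta> j (Suc J)])) [0..<Suc J])" for J
  define b where "b J = Suc (sum_list (entries J))" for J
  have eff_\<delta>: "effective (\<lambda>x. \<delta> (f x) (g x))" if "effective f" "effective g"
    for f g :: "'x::encodable \<Rightarrow> nat"
    using effective_compose2[OF \<delta>(1) that] .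
  have dec_U: "decidable (\<lambda>z. U (fst z) (entry (snd z)))"
    unfolding U_def W_def
    by (intro eff eff_\<delta> eff_comp effective_witnesses decidable_proper decidable_consistent)
  have eff_b: "effective b"
    unfolding b_def entries_def by (intro eff eff_\<delta> eff_comp effective_witnesses)
  have dep_W: "depends_on (W j d) {..<b J}" if jd: "j < Suc J" "d < \<delta> j (Suc J)" for j d J
  proof -
    have dep: "depends_on (\<lambda>r. consistent r (\<lambda>_. 0) s) {..<b J}" if s: "s \<in> set (witnesses d [j])" for s
    proof (rule depends_on_mono[OF depends_on_consistent])
      show "{prod_encode (i, c) |i c. i \<in> \<Union>(vars ` set s) \<and> 0 \<le> c \<and> c < 0 + length s} \<subseteq> {..<b J}"
      proof
        fix m assume "m \<in> {prod_encode (i, c) |i c. i \<in> \<Union>(vars ` set s) \<and> 0 \<le> c \<and> c < 0 + length s}"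
        then obtain i c where m: "m = prod_encode (i, c)" "i \<in> set (concat (map V (concat s)))" "c < length s"
          by (auto simp: vars_def)
        have "m \<in> set (entries J)"
          unfolding entries_def
        proof (rule in_concat_mapI[of j])
          show "j \<in> set [0..<Suc J]" using jd by auto
          show "m \<in> set (concat (map (\<lambda>d. concat (map (\<lambda>s.
            concat (map (\<lambda>i. map (\<lambda>c. prod_encode (i, c)) [0..<length s]) (concat (map V (concat s)))))
            (witnesses d [j]))) [0..<\<delta> j (Suc J)]))"
          proof (rule in_concat_mapI[of d])
            show "d \<in> set [0..<\<delta> j (Suc J)]" using jd by auto
            show "m \<in> set (concat (map (\<lambda>s.
              concat (map (\<lambda>i. map (\<lambda>c. prod_encode (i, c)) [0..<length s]) (concat (map V (concat s)))))
              (witnesses d [j])))"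
              by (rule in_concat_mapI[OF s], rule in_concat_mapI[OF m(2)]) (use m in auto)
          qed
        qed
        then have "m \<le> sum_list (entries J)" by (rule member_le_sum_list) simp
        then show "m \<in> {..<b J}" by (simp add: b_def)
      qed
    qed
    show ?thesis
      unfolding W_def depends_on_def using dep depends_onD by (metis (no_types, lifting))
  qed
  have dep_U: "depends_on (U J) {..<b J}" for J
    unfolding depends_on_def
  proof (intro allI impI)
    fix r r' :: "nat \<Rightarrow> nat" assume *: "\<forall>m\<in>{..<b J}. r m = r' m"
    have "W j d r = W j d r'" if "j < Suc J" "d < \<delta> j (Suc J)" for j d
      by (rule depends_onD[OF dep_W[OF that]]) (use * in simp)
    then show "U J r = U J r'" unfolding U_def by blast
  qed
  \<comment> \<open>Each root \<open>j\<close> contributes a geometric tail from depth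
    \<open>\<delta> j J\<close> on, and the factor \<open>1 - \<theta>\<close> in the choice of
    \<open>\<delta>\<close> cancels the sum of the series. The at most \<open>Suc J\<close> roots
    together give at most \<open>Suc J / 4 ^ Suc J \<le> 2 ^ J / 4 ^ Suc J\<close>.\<close>
  have prob_U: "prob {r. U J r} \<le> 1 / 2 ^ (J + 2)" for J
  proof -
    let ?I = "{j\<in>{..<Suc J}. j \<in> K}" and ?D = "\<lambda>j. {\<delta> j J..<\<delta> j (Suc J)}"
    have ev: "{r. W j d r} \<in> events" if "j < Suc J" "d < \<delta> j (Suc J)" for j d
      by (rule events_depends_on[OF _ dep_W[OF that]]) simp
    have "{r. U J r} = (\<Union>j\<in>?I. \<Union>d\<in>?D j. {r. W j d r})"
      unfolding U_def set_eq_iff UN_iff mem_Collect_eq atLeastLessThan_iff lessThan_iff Bex_def by blast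
    then have "prob {r. U J r} \<le> (\<Sum>j\<in>?I. prob (\<Union>d\<in>?D j. {r. W j d r}))"
      using ev by (auto intro!: P.finite_measure_subadditive_finite)
    also have "\<dots> \<le> (\<Sum>j\<in>?I. 1 / 4 ^ Suc J)"
    proof (rule sum_mono)
      fix j assume j: "j \<in> ?I"
      have "prob (\<Union>d\<in>?D j. {r. W j d r}) \<le> (\<Sum>d\<in>?D j. prob {r. W j d r})"
        using ev j by (intro P.finite_measure_subadditive_finite) auto
      also have "\<dots> \<le> (\<Sum>d\<in>?D j. \<theta> ^ d * y j)"
      proof (rule sum_mono)
        fix d
        show "prob {r. W j d r} \<le> \<theta> ^ d * y j"
          unfolding W_def by (rule prob_witnesses_le) (use y lll \<theta> j in auto)
      qed
      also have "\<dots> = (\<Sum>d\<in>?D j. \<theta> ^ d) * y j" by (simp add: sum_distrib_right)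
      also have "\<dots> \<le> (\<theta> ^ \<delta> j J / (1 - \<theta>)) * y j"
      proof (rule mult_right_mono)
        have "(\<Sum>d\<in>{m..<m'}. \<theta> ^ d) \<le> \<theta> ^ m / (1 - \<theta>)" for m m'
        proof (cases "m \<le> m'")
          case True
          then have "(1 - \<theta>) * (\<Sum>d\<in>{m..<m'}. \<theta> ^ d) = \<theta> ^ m - \<theta> ^ m'"
          proof (induction rule: dec_induct)
            case (step i)
            have "(1 - \<theta>) * (\<Sum>d\<in>{m..<Suc i}. \<theta> ^ d) =
                (1 - \<theta>) * (\<Sum>d\<in>{m..<i}. \<theta> ^ d) + (\<theta> ^ i - \<theta> ^ Suc i)"
              using step.hyps(1) by (simp add: algebra_simps)
            with step.IH show ?case by linarith
          qed simp
          then have "(\<Sum>d\<in>{m..<m'}. \<theta> ^ d) = (\<theta> ^ m - \<theta> ^ m') / (1 - \<theta>)"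
            using \<theta> by (simp add: field_simps)
          then show ?thesis using \<theta> by (simp add: divide_right_mono)
        qed (use \<theta> in simp)
        then show "(\<Sum>d\<in>?D j. \<theta> ^ d) \<le> \<theta> ^ \<delta> j J / (1 - \<theta>)" .
      qed (use y j in auto)
      also have "\<dots> = \<theta> ^ \<delta> j J * y j / (1 - \<theta>)" by simp
      also have "\<dots> \<le> (1 - \<theta>) / 4 ^ Suc J / (1 - \<theta>)"
        using \<delta>(3)[of j J] j \<theta> by (intro divide_right_mono) auto
      also have "\<dots> = 1 / 4 ^ Suc J" using \<theta> by simp
      finally show "prob (\<Union>d\<in>?D j. {r. W j d r}) \<le> 1 / 4 ^ Suc J" .
    qed
    also have "\<dots> \<le> (\<Sum>j<Suc J. 1 / 4 ^ Suc J)"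
      by (rule sum_mono2) auto
    also have "\<dots> = real (Suc J) / 4 ^ Suc J" by simp
    also have "\<dots> \<le> 2 ^ J / 4 ^ Suc J"
    proof -
      have "Suc J \<le> 2 ^ J" by (simp add: Suc_leI)
      then have "real (Suc J) \<le> 2 ^ J" using of_nat_le_iff[of "Suc J" "2 ^ J", where ?'a = real] by simp
      then show ?thesis by (intro divide_right_mono) auto
    qed
    also have "(2 :: real) ^ J / 4 ^ Suc J = 1 / 2 ^ (J + 2)"
    proof -
      have "(4 :: real) ^ J = 2 ^ J * 2 ^ J" by (simp flip: power_mult_distrib)
      then show ?thesis by simp
    qed
    finally show ?thesis .
  qed
  obtain r where r: "effective r" "\<And>m. r m < n m" "\<And>J. \<not> U J r"
    using computable_point[OF n L dec_U eff_b dep_U prob_U] by metis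
  have noW: "\<not> W j d r" if j: "j \<in> K" "\<delta> j j \<le> d" for j d
  proof
    assume "W j d r"
    define S where "S = {J. j \<le> J \<and> \<delta> j J \<le> d}"
    have "S \<subseteq> {..d}" unfolding S_def using order_trans[OF \<delta>(2)] by blast
    then have "finite S" by (rule finite_subset) simp
    moreover have "j \<in> S" using j(2) by (simp add: S_def)
    ultimately have "Max S \<in> S" "Suc (Max S) \<notin> S"
      by (auto intro: Max_in dest: Max_ge)
    then obtain J where J: "j \<le> J \<and> \<delta> j J \<le> d" "\<not> \<delta> j (Suc J) \<le> d"
      by (auto simp: S_def)
    with J j \<open>W j d r\<close> have "U J r" unfolding U_def by (auto simp: not_le less_Suc_eq_le)
    with r(3) show False by blast
  qed
  \<comment> \<open>The diagonal \<open>\<delta> b b\<close> appears because the root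
    \<open>b\<close> is treated only from stage \<open>b\<close> on.\<close>
  interpret resampling K V R G r \<sigma> "\<lambda>b. \<delta> b b"
  proof
    fix b Lg m assume lg: "legal r (b # Lg)" "chain m b Lg"
    from chain_imp_witness[OF this] obtain d where "m \<le> d" "W b d r"
      unfolding W_def by blast
    moreover have "b \<in> K" using lg by simp
    ultimately show "m < \<delta> b b" using noW by (meson not_le order_trans)
  qed (use \<sigma> in auto)
  define a where "a i = state r (run r \<sigma> (LEAST t.
    \<forall>b\<in>set (surrounding (\<Sum>b\<leftarrow>inc i. \<delta> b b) (inc i)). \<not> occurs b (state r (run r \<sigma> t)))) i" for i
  show thesis
  proof
    show "effective a"
      unfolding a_def
      by (rule effective_limit[OF r(1) \<sigma>(1) eff_\<delta>[OF effective_id effective_id] inc(1)])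
         (rule limit_avoids(1)[OF inc(2)])
    show "\<exists>c. a i < n (prod_encode (i, c))" for i
      unfolding a_def state_def using r(2) by blast
    show "\<not> occurs b a" if "b \<in> K" for b
      using limit_avoids(2)[OF inc(2) that] unfolding a_def .
  qed
qed

end

section \<open>Rational and real data\<close>

lemma effective_computable: "computable f \<Longrightarrow> effective g \<Longrightarrow> effective (\<lambda>x. f (g x))"
  by (rule effective_compose) (simp_all add: effective_nat_iff)

lemma effective_numerator_denominator:
  assumes "computable_rat q"
  shows "effective (\<lambda>n. nat (fst (quotient_of (q n))))" "effective (\<lambda>n. nat (snd (quotient_of (q n))))"
proof -
  define h where "h n = (case quotient_of (q n) of (a, b) \<Rightarrow> prod_encode (int_encode a, nat b))" for n
  have h: "computable h" using assms unfolding computable_rat_def h_def .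
  \<comment> \<open>\<open>int_encode\<close> gives nonnegative integers even codes and negative
    ones odd codes, so a parity test recovers \<open>nat a\<close>.\<close>
  have "nat a = (if 2 * (int_encode a div 2) = int_encode a then int_encode a div 2 else 0)" for a
    by (auto simp: int_encode_def sum_encode_def)
  moreover have "int_encode (fst (quotient_of (q n))) = fst (prod_decode (h n))" for n
    by (simp add: h_def case_prod_beta)
  moreover have "effective (\<lambda>n. if 2 * (fst (prod_decode (h n)) div 2) = fst (prod_decode (h n))
      then fst (prod_decode (h n)) div 2 else 0)"
    by (intro eff effective_computable[OF h])
  ultimately show "effective (\<lambda>n. nat (fst (quotient_of (q n))))" by (simp only:)
  have "nat (snd (quotient_of (q n))) = snd (prod_decode (h n))" for n
    by (simp add: h_def case_prod_beta)
  moreover have "effective (\<lambda>n. snd (prod_decode (h n)))"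
    by (intro eff effective_computable[OF h])
  ultimately show "effective (\<lambda>n. nat (snd (quotient_of (q n))))" by simp
qed

lemma of_rat_eq_quotient:
  "of_rat q = (real_of_int (fst (quotient_of q)) / real_of_int (snd (quotient_of q)))"
proof -
  have "q = of_int (fst (quotient_of q)) / of_int (snd (quotient_of q))"
    by (rule quotient_of_div) simp
  then show ?thesis by (metis of_rat_divide of_rat_of_int_eq)
qed

text \<open>
  \<^const>\<open>nat\<close> and the subtraction on \<^typ>\<open>nat\<close> truncate at \<open>0\<close>, which is harmless since \<open>0 \<le> z\<close>.
\<close>

lemma dyadic_lower_bound:
  fixes q :: rat and z :: real
  assumes "\<bar>of_rat q - z\<bar> \<le> 1 / 2 ^ k" "0 \<le> z"
  defines "l \<equiv> nat (fst (quotient_of q)) * 2 ^ k div nat (snd (quotient_of q)) - 1"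
  shows "real l \<le> 2 ^ k * z" "2 ^ k * z - 3 \<le> real l"
proof -
  obtain a d where ad: "quotient_of q = (a, d)" by (metis surj_pair)
  have d: "0 < d" using quotient_of_denom_pos[OF ad] .
  have q: "of_rat q = real_of_int a / real_of_int d" using of_rat_eq_quotient[of q] ad by simp
  have "\<bar>2 ^ k * of_rat q - 2 ^ k * z\<bar> = 2 ^ k * \<bar>of_rat q - z\<bar>"
    by (simp add: abs_mult flip: right_diff_distrib)
  also have "\<dots> \<le> 2 ^ k * (1 / 2 ^ k)" using assms(1) by (intro mult_left_mono) auto
  finally have dist: "\<bar>2 ^ k * of_rat q - 2 ^ k * z\<bar> \<le> 1" by simp
  have z0: "0 \<le> 2 ^ k * z" using assms(2) by simp
  let ?N = "nat a * 2 ^ k" and ?d = "nat d"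
  have floor: "real (?N div ?d) \<le> real ?N / real ?d" "real ?N / real ?d < real (?N div ?d) + 1"
  proof -
    have "?d * (?N div ?d) \<le> ?N" "?N < ?d * (?N div ?d) + ?d"
      using d dividend_less_times_div[of ?d ?N] by (simp_all add: add.commute)
    then have "real (?d * (?N div ?d)) \<le> real ?N" "real ?N < real (?d * (?N div ?d) + ?d)"
      by (simp_all only: of_nat_le_iff of_nat_less_iff)
    then show "real (?N div ?d) \<le> real ?N / real ?d" "real ?N / real ?d < real (?N div ?d) + 1"
      using d by (simp_all add: field_simps)
  qed
  have l: "l = ?N div ?d - 1" by (simp add: l_def ad)
  show "real l \<le> 2 ^ k * z" "2 ^ k * z - 3 \<le> real l"
  proof -
    \<comment> \<open>Subtracting \<open>1\<close> pays for the approximation error, which is at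
      most \<open>1\<close> after scaling, and makes \<open>l\<close> a true lower bound. The loss
      of \<open>3\<close> consists of this error, the rounding of the division and the
      subtraction.\<close>
    have "real l \<le> 2 ^ k * z \<and> 2 ^ k * z - 3 \<le> real l"
    proof (cases "0 \<le> a")
      case True
      then have "real ?N / real ?d = 2 ^ k * of_rat q" using d by (simp add: q)
      with floor dist z0 show ?thesis unfolding l by (cases "?N div ?d") auto
    next
      case False
      then have "of_rat q \<le> (0 :: real)" using d by (simp add: q divide_nonpos_pos)
      then have "2 ^ k * of_rat q \<le> (0 :: real)" by (simp add: mult_nonneg_nonpos)
      with False dist z0 show ?thesis unfolding l by simp
    qed
    then show "real l \<le> 2 ^ k * z" "2 ^ k * z - 3 \<le> real l" by auto
  qed
qed

lemma computable_real_lower_approximation: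
  assumes "computable_real z" "\<And>m. 0 \<le> z m"
  obtains L :: "nat \<Rightarrow> nat \<Rightarrow> nat" where "effective (\<lambda>x. L (fst x) (snd x))"
    "\<And>k m. real (L k m) \<le> 2 ^ k * z m" "\<And>m. (\<lambda>k. real (L k m) / 2 ^ k) \<longlonglongrightarrow> z m"
proof -
  obtain q where q: "computable_rat q" "\<And>m k. \<bar>of_rat (q (prod_encode (m, k))) - z m\<bar> \<le> 1 / 2 ^ k"
    using assms(1) unfolding computable_real_def by blast
  define L where "L k m = nat (fst (quotient_of (q (prod_encode (m, k))))) * 2 ^ k div
      nat (snd (quotient_of (q (prod_encode (m, k))))) - 1" for k m
  note bounds = dyadic_lower_bound[OF q(2) assms(2), folded L_def]
  have lim: "(\<lambda>k. real (L k m) / 2 ^ k) \<longlonglongrightarrow> z m" for m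
  proof (rule tendsto_sandwich)
    show "\<forall>\<^sub>F k in sequentially. z m - 3 * (1 / 2) ^ k \<le> real (L k m) / 2 ^ k"
    proof (intro always_eventually allI)
      fix k
      have "2 ^ k * z m - 3 \<le> real (L k m)" by (rule bounds)
      then have "(2 ^ k * z m - 3) / 2 ^ k \<le> real (L k m) / 2 ^ k" by (intro divide_right_mono) auto
      then show "z m - 3 * (1 / 2) ^ k \<le> real (L k m) / 2 ^ k"
        by (simp add: power_one_over diff_divide_distrib)
    qed
    show "\<forall>\<^sub>F k in sequentially. real (L k m) / 2 ^ k \<le> z m"
    proof (intro always_eventually allI)
      fix k
      have "real (L k m) \<le> 2 ^ k * z m" by (rule bounds)
      then show "real (L k m) / 2 ^ k \<le> z m"
        by (simp add: pos_divide_le_eq mult.commute)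
    qed
    have "(\<lambda>k. z m - 3 * (1 / 2) ^ k) \<longlonglongrightarrow> z m - 3 * 0"
      by (intro tendsto_intros LIMSEQ_realpow_zero) auto
    then show "(\<lambda>k. z m - 3 * (1 / 2) ^ k) \<longlonglongrightarrow> z m" by simp
  qed simp
  have "effective (\<lambda>x. L (fst x) (snd x))"
    unfolding L_def
    by (intro eff effective_compose[OF effective_numerator_denominator(1)[OF q(1)]]
        effective_compose[OF effective_numerator_denominator(2)[OF q(1)]])
  with bounds(1) lim show thesis by (intro that) auto
qed

lemma real_fraction_of_rat:
  assumes "0 < q"
  shows "of_rat q = real (nat (fst (quotient_of q))) / real (nat (snd (quotient_of q)))"
    and "0 < nat (fst (quotient_of q))" "0 < nat (snd (quotient_of q))"
proof -
  obtain a d where ad: "quotient_of q = (a, d)" by (metis surj_pair)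
  have d: "0 < d" using quotient_of_denom_pos[OF ad] .
  have "q = of_int a / of_int d" using quotient_of_div[OF ad] .
  with assms d have a: "0 < a" by (simp add: zero_less_divide_iff)
  show "of_rat q = real (nat (fst (quotient_of q))) / real (nat (snd (quotient_of q)))"
    using of_rat_eq_quotient[of q] a d by (simp add: ad)
  show "0 < nat (fst (quotient_of q))" "0 < nat (snd (quotient_of q))"
    using a d by (simp_all add: ad)
qed

text \<open>For rational data the inequality compares natural numbers, so a sufficient depth can be
  found by search.\<close>

lemma geometric_threshold:
  fixes q :: "nat \<Rightarrow> rat" and \<epsilon> :: rat
  assumes q: "computable_rat q" "\<And>j. 0 < q j \<and> q j < 1" and \<epsilon>: "0 < \<epsilon>" "\<epsilon> < 1"
  obtains \<delta> :: "nat \<Rightarrow> nat \<Rightarrow> nat" where "effective (\<lambda>z. \<delta> (fst z) (snd z))" "\<And>j J. J \<le> \<delta> j J"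
    "\<And>j J. (1 - of_rat \<epsilon>) ^ \<delta> j J * (of_rat (q j) / (1 - of_rat (q j))) \<le>
      (1 - (1 - of_rat \<epsilon> :: real)) / 4 ^ Suc J"
proof -
  define u where "u j = nat (fst (quotient_of (q j)))" for j
  define w where "w j = nat (snd (quotient_of (q j)))" for j
  define a where "a = nat (fst (quotient_of \<epsilon>))"
  define b where "b = nat (snd (quotient_of \<epsilon>))"
  have qu: "of_rat (q j) = real (u j) / real (w j)" "0 < u j" "0 < w j" for j
    using real_fraction_of_rat[of "q j"] q(2)[of j] by (auto simp: u_def w_def)
  have \<epsilon>a: "of_rat \<epsilon> = real a / real b" "0 < a" "0 < b"
    using real_fraction_of_rat[of \<epsilon>] \<epsilon> by (auto simp: a_def b_def)
  have uw: "u j < w j" for j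
  proof -
    have "real (u j) / real (w j) < 1" using q(2)[of j] by (simp flip: qu(1))
    then show ?thesis using qu(3)[of j] by (simp add: divide_less_eq)
  qed
  have "real a / real b < 1" using \<epsilon>(2) by (simp flip: \<epsilon>a(1))
  then have ab: "a < b" using \<epsilon>a(3) by (simp add: divide_less_eq)
  \<comment> \<open>The inequality with \<open>\<epsilon> = a / b\<close> and
    \<open>q j = u j / w j\<close>, cleared of denominators; \<open>a < b\<close> and
    \<open>u j < w j\<close> make the truncated subtractions exact.\<close>
  define P where "P j J d \<longleftrightarrow> (b - a) ^ d * u j * 4 ^ Suc J * b \<le> a * b ^ d * (w j - u j)" for j J d
  have P: "P j J d \<longleftrightarrow> (1 - of_rat \<epsilon>) ^ d * (of_rat (q j) / (1 - of_rat (q j))) \<le>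
      (of_rat \<epsilon> :: real) / 4 ^ Suc J" for j J d
  proof -
    have "P j J d \<longleftrightarrow> real ((b - a) ^ d * u j * 4 ^ Suc J * b) \<le> real (a * b ^ d * (w j - u j))"
      unfolding P_def of_nat_le_iff ..
    also have "\<dots> \<longleftrightarrow> (real b - real a) ^ d * real (u j) * 4 ^ Suc J * real b \<le>
        real a * real b ^ d * (real (w j) - real (u j))"
      using ab uw[of j] by (simp add: of_nat_diff)
    also have "\<dots> \<longleftrightarrow> ((real b - real a) / real b) ^ d * (real (u j) / (real (w j) - real (u j))) \<le>
        (real a / real b) / 4 ^ Suc J"
      using ab uw[of j] by (simp add: power_divide divide_simps mult_ac)
    also have "(real b - real a) / real b = 1 - of_rat \<epsilon>" using \<epsilon>a by (simp add: field_simps)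
    also have "real (u j) / (real (w j) - real (u j)) = of_rat (q j) / (1 - of_rat (q j))"
      unfolding qu(1)[of j] using qu(3)[of j] uw[of j] by (simp add: field_simps)
    also have "real a / real b = of_rat \<epsilon>" using \<epsilon>a by simp
    finally show ?thesis .
  qed
  let ?\<theta> = "1 - of_rat \<epsilon> :: real"
  have \<theta>: "0 \<le> ?\<theta>" "?\<theta> < 1" using \<epsilon> by auto
  have y: "0 \<le> of_rat (q j) / (1 - of_rat (q j) :: real)" for j
    using q(2)[of j] by (simp add: less_imp_le)
  have ex: "\<exists>d. P j J d" for j J
  proof -
    have "(\<lambda>d. ?\<theta> ^ d * (of_rat (q j) / (1 - of_rat (q j)))) \<longlonglongrightarrow>
        0 * (of_rat (q j) / (1 - of_rat (q j)))"
      using \<theta> by (intro tendsto_intros LIMSEQ_realpow_zero)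
    moreover have "0 * (of_rat (q j) / (1 - of_rat (q j))) < (of_rat \<epsilon> :: real) / 4 ^ Suc J"
      using \<epsilon> by simp
    ultimately have "\<forall>\<^sub>F d in sequentially. ?\<theta> ^ d * (of_rat (q j) / (1 - of_rat (q j))) < of_rat \<epsilon> / 4 ^ Suc J"
      by (rule order_tendstoD)
    then show ?thesis unfolding P by (auto simp: eventually_sequentially intro: less_imp_le)
  qed
  \<comment> \<open>Adding \<open>J\<close> ensures \<open>J \<le> \<delta> j J\<close>, and a
    larger exponent only decreases the power.\<close>
  define \<delta> where "\<delta> j J = (LEAST d. P j J d) + J" for j J
  show thesis
  proof
    have "effective u" "effective w"
      unfolding u_def w_def by (rule effective_numerator_denominator[OF q(1)])+
    then have uw': "effective (\<lambda>x. u (f x))" "effective (\<lambda>x. w (f x))" if "effective f"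
      for f :: "'x::encodable \<Rightarrow> nat"
      using that effective_compose by blast+
    show "effective (\<lambda>z. \<delta> (fst z) (snd z))"
      unfolding \<delta>_def P_def by (intro eff uw') (use ex in \<open>simp add: P_def\<close>)
    show "J \<le> \<delta> j J" for j J by (simp add: \<delta>_def)
    show "?\<theta> ^ \<delta> j J * (of_rat (q j) / (1 - of_rat (q j))) \<le> (1 - ?\<theta>) / 4 ^ Suc J" for j J
    proof -
      have "?\<theta> ^ \<delta> j J * (of_rat (q j) / (1 - of_rat (q j))) \<le>
          ?\<theta> ^ (LEAST d. P j J d) * (of_rat (q j) / (1 - of_rat (q j)))"
        using \<theta> y by (intro mult_right_mono power_decreasing) (auto simp: \<delta>_def)
      also have "\<dots> \<le> of_rat \<epsilon> / 4 ^ Suc J"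
        using LeastI_ex[OF ex[of j J]] unfolding P .
      finally show ?thesis by simp
    qed
  qed
qed

theorem theorem2:
  fixes M :: "'a measure"
    and P :: "nat \<Rightarrow> 'a \<Rightarrow> nat"
    and n :: "nat \<Rightarrow> nat"
    and A :: "nat \<Rightarrow> event"
    and x :: "event \<Rightarrow> rat"
    and \<epsilon> :: rat
  assumes "prob_space M"
    and "prob_space.indep_vars M (\<lambda>_. count_space UNIV) P UNIV"
    and "\<And>i \<omega>. \<omega> \<in> space M \<Longrightarrow> P i \<omega> \<in> {..<n i}"
    and "computable n"
    and "computable_real
           (\<lambda>m. case prod_decode m of (i, v) \<Rightarrow> measure M {\<omega> \<in> space M. P i \<omega> = v})"
    and "\<And>j. finite (vbl (A j))"
    and "\<And>j. evals (A j) \<subseteq> PiE (vbl (A j)) (\<lambda>i. {..<n i})"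
    and "computable_events A"
    and "\<And>i. finite {E \<in> range A. i \<in> vbl E}"
    and "computable_incidence A"
    and "0 < \<epsilon>" and "\<epsilon> < 1"
    and "\<And>E. E \<in> range A \<Longrightarrow> 0 < x E \<and> x E < 1"
    and "computable_rat (\<lambda>j. x (A j))"
    and "\<And>E. E \<in> range A \<Longrightarrow>
           event_prob M P E
             \<le> (1 - of_rat \<epsilon>) * of_rat (x E) * (\<Prod>F\<in>neighbours (range A) E. 1 - of_rat (x F))"
  shows "\<exists>a. computable a \<and> (\<forall>i. a i \<in> {..<n i}) \<and> (\<forall>E\<in>range A. avoids a E)"
proof -
  interpret pM: prob_space M by fact
  note indep = assms(2) and P_less = assms(3) and fin = assms(6) and evals = assms(7)
    and \<epsilon> = assms(11,12) and x01 = assms(13) and lll = assms(15)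
  obtain vl where vl: "computable vl" "\<And>j. set (list_decode (vl j)) = vbl (A j)"
    using assms(8) unfolding computable_events_def computable_finite_sets_def by blast
  obtain el where el: "computable el"
    "\<And>j. set (list_decode (el j)) = eval_encode (vbl (A j)) ` evals (A j)"
    using assms(8) unfolding computable_events_def computable_finite_sets_def by blast
  obtain l where l: "computable l" "\<And>i. A ` set (list_decode (l i)) = {E \<in> range A. i \<in> vbl E}"
    using assms(10) unfolding computable_incidence_def by blast
  note eff_vl = effective_computable[OF vl(1)] and eff_el = effective_computable[OF el(1)]
    and eff_l = effective_computable[OF l(1)]

  \<comment> \<open>Events as finite lists of value lists\<close>
  define V where "V j = filter (\<lambda>i. i \<in> set (list_decode (vl j)))
    [0..<Suc (sum_list (list_decode (vl j)))]" for j
  define R where "R j = map list_decode (list_decode (el j))" for j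
  have set_V: "set (V j) = vbl (A j)" for j
  proof -
    have "i \<le> sum_list (list_decode (vl j))" if "i \<in> set (list_decode (vl j))" for i
      using that by (rule member_le_sum_list) simp
    then show ?thesis unfolding V_def by (auto simp: vl(2) less_Suc_eq_le simp del: upt_Suc)
  qed
  \<comment> \<open>Filtering an initial segment of the numbers produces the increasing order on
    which \<open>eval_encode\<close> is based.\<close>
  have V_eq: "V j = sorted_list_of_set (vbl (A j))" for j
  proof -
    have "sorted (V j)" "distinct (V j)"
      unfolding V_def by (auto simp del: upt_Suc intro: sorted_wrt_filter)
    then show ?thesis
      by (metis set_V sorted_list_of_set.idem_if_sorted_distinct)
  qed
  have set_R: "set (R j) = (\<lambda>e. map e (V j)) ` evals (A j)" for j
    by (simp add: R_def el(2) image_image eval_encode_def V_eq)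
  have ext: "e \<in> extensional (vbl (A j))" if "e \<in> evals (A j)" for e j
    using evals[of j] that by (auto simp: PiE_def)
  have map_mem: "map a (V j) \<in> set (R j) \<longleftrightarrow> restrict a (vbl (A j)) \<in> evals (A j)" for a j
  proof
    assume "map a (V j) \<in> set (R j)"
    then obtain e where e: "e \<in> evals (A j)" "map a (V j) = map e (V j)" by (auto simp: set_R)
    then have "restrict a (vbl (A j)) = e"
      using ext[OF e(1)] by (intro extensionalityI[of _ "vbl (A j)"]) (auto simp: set_V[symmetric])
    with e show "restrict a (vbl (A j)) \<in> evals (A j)" by simp
  next
    assume "restrict a (vbl (A j)) \<in> evals (A j)"
    moreover have "map a (V j) = map (restrict a (vbl (A j))) (V j)" by (simp add: set_V)
    ultimately show "map a (V j) \<in> set (R j)" unfolding set_R image_def by blast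
  qed
  have evals_eq: "evals (A j) = {e \<in> extensional (vbl (A j)). map e (V j) \<in> set (R j)}" for j
    using ext by (auto simp: map_mem extensional_restrict)
  \<comment> \<open>Lists for equal events may differ in order and repetitions, so \<open>R\<close>
    is compared as a set. This makes equality of events decidable.\<close>
  have A_eq: "A k = A j \<longleftrightarrow> V k = V j \<and> (\<forall>s\<in>set (R k). s \<in> set (R j)) \<and> (\<forall>s\<in>set (R j). s \<in> set (R k))"
    for k j
  proof
    assume "A k = A j"
    then show "V k = V j \<and> (\<forall>s\<in>set (R k). s \<in> set (R j)) \<and> (\<forall>s\<in>set (R j). s \<in> set (R k))"
      by (simp add: V_eq set_R)
  next
    assume *: "V k = V j \<and> (\<forall>s\<in>set (R k). s \<in> set (R j)) \<and> (\<forall>s\<in>set (R j). s \<in> set (R k))"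
    then have "vbl (A k) = vbl (A j)" by (metis set_V)
    moreover have "evals (A k) = evals (A j)"
      unfolding evals_eq using * \<open>vbl (A k) = vbl (A j)\<close> by auto
    ultimately show "A k = A j" by (rule event.expand[OF conjI])
  qed
  have eff_V: "effective V" and eff_R: "effective R"
    unfolding V_def R_def by (intro eff eff_vl eff_el)+
  note eff_VR = effective_compose[OF eff_V] effective_compose[OF eff_R]

  \<comment> \<open>Canonical indices of events\<close>
  define c where "c j = (LEAST k. A k = A j)" for j
  \<comment> \<open>An event may have several indices, while the hypothesis takes a product over a
    set of events. One index for each event keeps the two products in agreement.\<close>
  define K where "K = {j. c j = j}"
  have A_c: "A (c j) = A j" for j
    unfolding c_def by (rule LeastI) simp
  have c_cong: "c j = c k" if "A j = A k" for j k
    unfolding c_def that ..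
  have c_K: "c j \<in> K" for j
    by (simp add: K_def c_cong[OF A_c])
  have K_inj: "j = k" if "j \<in> K" "k \<in> K" "A j = A k" for j k
    using c_cong[OF that(3)] that by (simp add: K_def)
  have eff_c: "effective c"
    unfolding c_def A_eq by (intro eff eff_VR) (use A_eq in blast)
  note eff_c' = effective_compose[OF eff_c]

  \<comment> \<open>Computable incidence and neighbour lists\<close>
  have c_l: "c ` set (list_decode (l i)) = {k \<in> K. i \<in> set (V k)}" for i
  proof
    show "c ` set (list_decode (l i)) \<subseteq> {k \<in> K. i \<in> set (V k)}"
      using l(2)[of i] c_K by (auto simp: set_V A_c)
    show "{k \<in> K. i \<in> set (V k)} \<subseteq> c ` set (list_decode (l i))"
    proof
      fix k assume k: "k \<in> {k \<in> K. i \<in> set (V k)}"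
      then have "A k \<in> A ` set (list_decode (l i))" by (simp add: l(2) set_V)
      then obtain k' where "k' \<in> set (list_decode (l i))" "A k = A k'" by auto
      moreover have "k = c k'" using k c_cong[of k k'] \<open>A k = A k'\<close> by (simp add: K_def)
      ultimately show "k \<in> c ` set (list_decode (l i))" by blast
    qed
  qed
  define inc where "inc i = map c (list_decode (l i))" for i
  define G where "G j = concat (map inc (V j))" for j
  have set_inc: "set (inc i) = {k \<in> K. i \<in> set (V k)}" for i
    by (simp add: inc_def c_l)
  have set_G: "set (G j) = {k \<in> K. set (V k) \<inter> set (V j) \<noteq> {}}" for j
    by (auto simp: G_def set_inc)
  have eff_inc: "effective inc"
    unfolding inc_def by (intro eff eff_l eff_c')
  have eff_G: "effective G"
    unfolding G_def by (intro eff eff_VR effective_compose[OF eff_inc])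

  \<comment> \<open>The local lemma condition in terms of odds\<close>
  have Aj: "A j \<in> range A" for j by simp
  let ?\<theta> = "1 - of_rat \<epsilon> :: real" and ?x = "\<lambda>j. of_rat (x (A j)) :: real"
  have x: "0 < ?x j" "?x j < 1" for j
    using x01[OF Aj[of j]] by auto
  have \<theta>: "0 \<le> ?\<theta>" "?\<theta> < 1" using \<epsilon> by auto
  define p where "p j = event_prob M P (A j)" for j
  define y where "y j = ?x j / (1 - ?x j)" for j
  have y: "0 \<le> y j" "(1 - ?x j) * (1 + y j) = 1" "?x j * (1 + y j) = y j" for j
    using x[of j] by (auto simp: y_def field_simps)
  have p_eq: "p j = measure M {\<omega> \<in> space M. restrict (\<lambda>i. P i \<omega>) (vbl (A j)) \<in> evals (A j)}" for j
    by (simp add: p_def event_prob_def avoids_def)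
  have p_nonneg: "0 \<le> p j" for j by (simp add: p_eq)
  \<comment> \<open>Without variables the only evaluation is the empty one, so a nonempty
    \<open>R j\<close> would describe the sure event; but the hypothesis forces
    \<open>p j < 1\<close>.\<close>
  have R_Nil: "R j = []" if "V j = []" for j
  proof (rule ccontr)
    assume "R j \<noteq> []"
    then obtain s where "s \<in> set (R j)" by (meson last_in_set)
    moreover from this have "s = []" using that by (auto simp: set_R)
    ultimately have "map (\<lambda>i. P i \<omega>) (V j) \<in> set (R j)" for \<omega> using that by simp
    then have "p j = 1" by (simp add: p_eq map_mem pM.prob_space)
    moreover have "p j \<le> ?\<theta> * ?x j * (\<Prod>F\<in>neighbours (range A) (A j). 1 - of_rat (x F))"
      unfolding p_def by (rule lll) simp
    moreover have "\<dots> \<le> ?\<theta> * ?x j * 1"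
    proof (intro mult_left_mono prod_le_1)
      fix F assume "F \<in> neighbours (range A) (A j)"
      then have "0 < x F \<and> x F < 1" by (intro x01) (simp add: neighbours_def)
      then have "0 < (of_rat (x F) :: real)" "(of_rat (x F) :: real) < 1" by auto
      then show "0 \<le> 1 - (of_rat (x F) :: real) \<and> 1 - (of_rat (x F) :: real) \<le> 1" by simp
    qed (use \<theta> x[of j] in auto)
    moreover have "?\<theta> * ?x j < 1"
    proof -
      have "?\<theta> * ?x j \<le> 1 * ?x j" using \<theta> x[of j] by (intro mult_right_mono) auto
      then show ?thesis using x(2)[of j] by linarith
    qed
    ultimately show False by simp
  qed
  have lll': "p j * (\<Prod>k\<in>set (G j). 1 + y k) \<le> ?\<theta> * y j" if j: "j \<in> K" for j
  proof (cases "V j = []")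
    case True
    \<comment> \<open>Here \<open>j\<close> is missing from \<open>G j\<close>, but the event is
      impossible.\<close>
    then have "evals (A j) = {}" using R_Nil[OF True] set_R[of j] by simp
    then show ?thesis using \<theta> y(1)[of j] by (simp add: p_eq)
  next
    case False
    then have jG: "j \<in> set (G j)" using j by (simp add: set_G)
    let ?N = "set (G j) - {j}"
    have N: "neighbours (range A) (A j) = A ` ?N"
    proof
      show "neighbours (range A) (A j) \<subseteq> A ` ?N"
      proof
        fix E assume "E \<in> neighbours (range A) (A j)"
        then obtain k where k: "E = A k" "A k \<noteq> A j" "vbl (A k) \<inter> vbl (A j) \<noteq> {}"
          by (auto simp: neighbours_def)
        then have "c k \<in> ?N" using A_c[of k] c_K by (auto simp: set_G set_V)
        then show "E \<in> A ` ?N" using k A_c[of k] by (metis imageI)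
      qed
      show "A ` ?N \<subseteq> neighbours (range A) (A j)"
        using K_inj[OF _ j] by (auto simp: neighbours_def set_G set_V)
    qed
    have "inj_on A ?N" using K_inj by (auto simp: inj_on_def set_G)
    then have prod: "(\<Prod>F\<in>neighbours (range A) (A j). 1 - of_rat (x F)) = (\<Prod>k\<in>?N. 1 - ?x k)"
      unfolding N by (simp add: prod.reindex)
    have "p j \<le> ?\<theta> * ?x j * (\<Prod>k\<in>?N. 1 - ?x k)"
      using lll[OF Aj[of j]] unfolding p_def prod .
    then have "p j * (\<Prod>k\<in>set (G j). 1 + y k) \<le>
        ?\<theta> * ?x j * (\<Prod>k\<in>?N. 1 - ?x k) * (\<Prod>k\<in>set (G j). 1 + y k)"
      using y(1) by (intro mult_right_mono prod_nonneg) (auto intro: add_nonneg_nonneg)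
    \<comment> \<open>Unlike the set of neighbours, \<open>G j\<close> contains \<open>j\<close>;
      its factor \<open>1 + y j\<close> turns \<open>?x j\<close> into \<open>y j\<close>, and the
      other factors cancel in pairs.\<close>
    also have "\<dots> = ?\<theta> * (?x j * (1 + y j)) * (\<Prod>k\<in>?N. (1 - ?x k) * (1 + y k))"
      using jG by (simp add: prod.remove prod.distrib)
    also have "\<dots> = ?\<theta> * y j" by (simp only: y prod.neutral_const mult_1_right)
    finally show ?thesis .
  qed

  \<comment> \<open>The table of independent samples\<close>
  define D where "D m = distr M (count_space UNIV) (P (fst (prod_decode m)))" for m
  have P_rv [measurable]: "P i \<in> measurable M (count_space UNIV)" for i
    using indep unfolding pM.indep_vars_def by simp
  have D_singleton: "measure (D m) {v} = measure M {\<omega> \<in> space M. P (fst (prod_decode m)) \<omega> = v}" for m v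
    unfolding D_def by (subst measure_distr) (auto intro!: arg_cong[where f = "measure M"])
  interpret random_table D
  proof (rule random_table.intro)
    show "prob_space (D m)" for m unfolding D_def by (rule pM.prob_space_distr) measurable
    show "sets (D m) = UNIV" for m by (simp add: D_def)
  qed
  \<comment> \<open>Both sides are sums over evaluations of products of point masses, on the table
    by the product measure and on \<open>M\<close> by independence. Different variables read
    different entries for every \<open>f\<close>, as the variable is part of the code of the
    entry.\<close>
  have occ_prob: "prob {r. map (\<lambda>i. r (prod_encode (i, f i))) (V j) \<in> set (R j)} = p j" for j f
  proof -
    let ?S = "evals (A j)" and ?V = "vbl (A j)"
    have fS: "finite ?S" using evals[of j] fin[of j] by (meson finite_PiE finite_lessThan finite_subset)
    have S: "?S \<subseteq> extensional ?V" using ext by blast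
    have "prob {r \<in> space T. restrict (\<lambda>i. r (prod_encode (i, f i))) ?V \<in> ?S} =
        (\<Sum>e\<in>?S. prob {r \<in> space T. \<forall>i\<in>?V. r (prod_encode (i, f i)) = e i})"
    proof (rule P.prob_restrict_mem[OF fS S])
      fix e
      show "{r \<in> space T. \<forall>i\<in>?V. r (prod_encode (i, f i)) = e i} \<in> events"
        using events_depends_on[of "(\<lambda>i. prod_encode (i, f i)) ` ?V" "\<lambda>r. \<forall>i\<in>?V. r (prod_encode (i, f i)) = e i"]
          fin[of j] by (simp add: depends_on_def)
    qed
    also have "\<dots> = (\<Sum>e\<in>?S. \<Prod>i\<in>?V. measure M {\<omega> \<in> space M. P i \<omega> = e i})"
    proof (rule sum.cong[OF refl])
      fix e
      have "prob {r \<in> space T. \<forall>i\<in>?V. r (prod_encode (i, f i)) = e i} =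
          prob {r. \<forall>m\<in>(\<lambda>i. prod_encode (i, f i)) ` ?V. r m = e (fst (prod_decode m))}" by simp
      also have "\<dots> = (\<Prod>m\<in>(\<lambda>i. prod_encode (i, f i)) ` ?V. measure (D m) {e (fst (prod_decode m))})"
        using fin[of j] by (intro prob_cylinder) simp
      also have "\<dots> = (\<Prod>i\<in>?V. measure M {\<omega> \<in> space M. P i \<omega> = e i})"
        by (subst prod.reindex) (auto simp: inj_on_def D_singleton)
      finally show "prob {r \<in> space T. \<forall>i\<in>?V. r (prod_encode (i, f i)) = e i} =
          (\<Prod>i\<in>?V. measure M {\<omega> \<in> space M. P i \<omega> = e i})" .
    qed
    also have "\<dots> = (\<Sum>e\<in>?S. measure M {\<omega> \<in> space M. \<forall>i\<in>?V. P i \<omega> = e i})"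
      using pM.prob_indep_vars_eq[OF indep, of ?V] fin[of j] by simp
    also have "\<dots> = p j"
      unfolding p_eq using fin[of j] by (intro pM.prob_restrict_mem[OF fS S, symmetric]) measurable
    finally show ?thesis by (simp add: map_mem)
  qed
  interpret effective_event_table K V R G D p
  proof
    show "decidable (\<lambda>j. j \<in> K)" unfolding K_def mem_Collect_eq by (intro eff eff_c')
    show "prob {r. event_system.occurs V R j (\<lambda>i. r (prod_encode (i, f i)))} \<le> p j" for j f
    proof -
      interpret event_system K V R G by unfold_locales (use R_Nil set_G in auto)
      show ?thesis unfolding occurs_def using occ_prob[of f j] by simp
    qed
  qed (use R_Nil set_G eff_V eff_R eff_G in auto)

  \<comment> \<open>Computable data for the construction\<close>
  obtain \<delta> where \<delta>: "effective (\<lambda>z. \<delta> (fst z) (snd z))" "\<And>j J. J \<le> \<delta> j J"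
    "\<And>j J. ?\<theta> ^ \<delta> j J * y j \<le> (1 - ?\<theta>) / 4 ^ Suc J"
    using geometric_threshold[OF assms(14) x01[OF Aj] \<epsilon>] unfolding y_def by blast
  define n' where "n' m = n (fst (prod_decode m))" for m
  have n': "effective n'"
    unfolding n'_def by (intro effective_computable[OF assms(4)] eff)
  have AE_n': "AE r in T. \<forall>m. r m < n' m"
    unfolding AE_all_countable
  proof
    fix m
    have "AE v in D m. v < n' m"
      unfolding D_def by (subst AE_distr_iff) (use P_less in \<open>auto simp: n'_def\<close>)
    then have "AE v in distr T (D m) (\<lambda>r. r m). v < n' m" unfolding PiM_component[OF UNIV_I] .
    then show "AE r in T. r m < n' m"
      by (subst (asm) AE_distr_iff) auto
  qed
  obtain L0 where L0: "effective (\<lambda>z. L0 (fst z) (snd z))"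
    "\<And>k m. real (L0 k m) \<le> 2 ^ k *
      (case prod_decode m of (i, v) \<Rightarrow> measure M {\<omega> \<in> space M. P i \<omega> = v})"
    "\<And>m. (\<lambda>k. real (L0 k m) / 2 ^ k) \<longlonglongrightarrow>
      (case prod_decode m of (i, v) \<Rightarrow> measure M {\<omega> \<in> space M. P i \<omega> = v})"
    by (rule computable_real_lower_approximation[OF assms(5)]) (auto simp: case_prod_beta)
  \<comment> \<open>The distribution of an entry depends only on its variable, so the sample number
    is discarded.\<close>
  define L where "L k m v = L0 k (prod_encode (fst (prod_decode m), v))" for k m v
  have L: "effective (\<lambda>z. L (fst z) (fst (snd z)) (snd (snd z)))"
    "\<And>k m v. real (L k m v) \<le> 2 ^ k * measure (D m) {v}"
    "\<And>m v. (\<lambda>k. real (L k m v) / 2 ^ k) \<longlonglongrightarrow> measure (D m) {v}"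
  proof -
    show "effective (\<lambda>z. L (fst z) (fst (snd z)) (snd (snd z)))"
      unfolding L_def by (intro effective_compose2[OF L0(1)] eff)
    show "real (L k m v) \<le> 2 ^ k * measure (D m) {v}" for k m v
      using L0(2)[of k "prod_encode (fst (prod_decode m), v)"] by (simp add: L_def D_singleton)
    show "(\<lambda>k. real (L k m v) / 2 ^ k) \<longlonglongrightarrow> measure (D m) {v}" for m v
      using L0(3)[of "prod_encode (fst (prod_decode m), v)"] by (simp add: L_def D_singleton)
  qed
  \<comment> \<open>The code of a pair \<open>(b, t0)\<close> is at least \<open>t0\<close>, so
    every index is visited arbitrarily late; \<open>c\<close> keeps the schedule inside
    \<open>K\<close>.\<close>
  define \<sigma> where "\<sigma> t = c (fst (prod_decode t))" for t
  have \<sigma>: "effective \<sigma>" unfolding \<sigma>_def by (intro eff_c' eff)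
  have \<sigma>_fair: "\<exists>t\<ge>t0. \<sigma> t = b" if "b \<in> K" for b t0
    using that by (intro exI[of _ "prod_encode (b, t0)"]) (simp add: \<sigma>_def K_def le_prod_encode_2)
  obtain a where a: "effective a" "\<And>i. \<exists>c. a i < n' (prod_encode (i, c))" "\<And>b. b \<in> K \<Longrightarrow> \<not> occurs b a"
    by (rule computable_solution[OF y(1) lll' \<theta> \<delta>(1,2) \<delta>(3) n' AE_n' L \<sigma> _ \<sigma>_fair eff_inc set_inc])
       (auto simp: \<sigma>_def c_K)
  have "avoids a (A j)" for j
    using a(3)[OF c_K[of j]] by (simp add: avoids_def occurs_def map_mem A_c)
  moreover have "a i < n i" for i using a(2)[of i] by (simp add: n'_def)
  ultimately show ?thesis using a(1) by (auto simp: effective_nat_iff)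
qed

end
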